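(* Let $(V,g)$ be a Euclidean vector space and $\mathfrak{g}\subseteq\mathfrak{so}(V)$ a Lie subalgebra. Then there are orthogonal decompositions $V=\bigoplus_j W_j$ and $\mathfrak{g}=\bigoplus_j\mathfrak{g}_j$ (as Lie algebras) such that each $\mathfrak{g}_j$ preserves $W_j$, acts faithfully on $W_j$ and trivially on $W_i$ for $i\neq j$, and each representation $(\mathfrak{g}_j,W_j)$ is of one of the following types: (i) $(\mathfrak{so}(W),W)$ for some Euclidean vector space $W$; (ii) the adjoint representation of a compact simple Lie algebra (with an invariant inner product); (iii) a representation with vanishing skew-symmetric prolongation, $\Lambda^3W_j\cap(\Lambda^1W_j\otimes\mathfrak{g}_j)=\{0\}$.
   Context: $\Lambda^2V$ is identified with $\mathfrak{so}(V)$ via $F\mapsto g(F\cdot,\cdot)$. The skew-symmetric prolongation of $\mathfrak{h}\subseteq\mathfrak{so}(W)$ is $\Lambda^3W\cap(\Lambda^1W\otimes\mathfrak{h})=\{T\in\Lambda^3W:X\lrcorner T\in\mathfrak{h}\ \forall X\in W\}$. *)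

theory Defs
  imports "HOL-Analysis.Analysis"
begin

definition lie_br :: "('a::real_vector \<Rightarrow> 'a) \<Rightarrow> ('a \<Rightarrow> 'a) \<Rightarrow> ('a \<Rightarrow> 'a)" where
  "lie_br A B = (\<lambda>x. A (B x) - B (A x))"

definition so_V :: "('a::euclidean_space \<Rightarrow> 'a) \<Rightarrow> bool" where
  "so_V A \<longleftrightarrow> linear A \<and> (\<forall>x y. A x \<bullet> y = - (x \<bullet> A y))"

text \<open>so(W) for a subspace W of V: skew-symmetric linear maps W \<rightarrow> W (values outside W irrelevant).\<close>
definition so_on :: "'a::euclidean_space set \<Rightarrow> ('a \<Rightarrow> 'a) \<Rightarrow> bool" where
  "so_on W f \<longleftrightarrow> (\<forall>x\<in>W. f x \<in> W) \<and> (\<forall>x\<in>W. \<forall>y\<in>W. f (x + y) = f x + f y)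
     \<and> (\<forall>c. \<forall>x\<in>W. f (c *\<^sub>R x) = c *\<^sub>R f x) \<and> (\<forall>x\<in>W. \<forall>y\<in>W. f x \<bullet> y = - (x \<bullet> f y))"

definition endo_subspace :: "('a::real_vector \<Rightarrow> 'a) set \<Rightarrow> bool" where
  "endo_subspace S \<longleftrightarrow> (\<lambda>_. 0) \<in> S \<and> (\<forall>A\<in>S. \<forall>B\<in>S. (\<lambda>x. A x + B x) \<in> S)
     \<and> (\<forall>c. \<forall>A\<in>S. (\<lambda>x. c *\<^sub>R A x) \<in> S)"

definition lie_subalgebra_so :: "('a::euclidean_space \<Rightarrow> 'a) set \<Rightarrow> bool" where
  "lie_subalgebra_so G \<longleftrightarrow> (\<forall>A\<in>G. so_V A) \<and> endo_subspace G \<and> (\<forall>A\<in>G. \<forall>B\<in>G. lie_br A B \<in> G)"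

definition lie_ideal :: "('a::real_vector \<Rightarrow> 'a) set \<Rightarrow> ('a \<Rightarrow> 'a) set \<Rightarrow> bool" where
  "lie_ideal I g \<longleftrightarrow> I \<subseteq> g \<and> endo_subspace I \<and> (\<forall>A\<in>g. \<forall>B\<in>I. lie_br A B \<in> I)"

definition simple_lie :: "('a::real_vector \<Rightarrow> 'a) set \<Rightarrow> bool" where
  "simple_lie g \<longleftrightarrow> (\<exists>A\<in>g. \<exists>B\<in>g. lie_br A B \<noteq> (\<lambda>_. 0))
     \<and> (\<forall>I. lie_ideal I g \<longrightarrow> I = {\<lambda>_. 0} \<or> I = g)"

text \<open>Inner product on so(V): \<langle>A,B\<rangle> = tr(A^T B).\<close>
definition frob :: "('a::euclidean_space \<Rightarrow> 'a) \<Rightarrow> ('a \<Rightarrow> 'a) \<Rightarrow> real" where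
  "frob A B = (\<Sum>b\<in>Basis. A b \<bullet> B b)"

definition type_full_so :: "('a::euclidean_space \<Rightarrow> 'a) set \<Rightarrow> 'a set \<Rightarrow> bool" where
  "type_full_so g W \<longleftrightarrow> (\<forall>f. so_on W f \<longrightarrow> (\<exists>A\<in>g. \<forall>w\<in>W. A w = f w))"

text \<open>Type (ii): (g, W) is isomorphic to the adjoint representation of a simple Lie algebra
  g \<subseteq> so(V) (hence compact), via a linear bijection \<phi> : g \<rightarrow> W intertwining ad and the action.\<close>
definition type_adjoint :: "('a::euclidean_space \<Rightarrow> 'a) set \<Rightarrow> 'a set \<Rightarrow> bool" where
  "type_adjoint g W \<longleftrightarrow> simple_lie g \<and>
     (\<exists>\<phi>. bij_betw \<phi> g W
        \<and> (\<forall>A\<in>g. \<forall>B\<in>g. \<phi> (\<lambda>x. A x + B x) = \<phi> A + \<phi> B)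
        \<and> (\<forall>c. \<forall>A\<in>g. \<phi> (\<lambda>x. c *\<^sub>R A x) = c *\<^sub>R \<phi> A)
        \<and> (\<forall>A\<in>g. \<forall>B\<in>g. \<phi> (lie_br A B) = A (\<phi> B)))"

definition alt3_on :: "'a::euclidean_space set \<Rightarrow> ('a \<Rightarrow> 'a \<Rightarrow> 'a \<Rightarrow> real) \<Rightarrow> bool" where
  "alt3_on W T \<longleftrightarrow>
     (\<forall>x\<in>W. \<forall>x'\<in>W. \<forall>y\<in>W. \<forall>z\<in>W. T (x + x') y z = T x y z + T x' y z)
   \<and> (\<forall>c. \<forall>x\<in>W. \<forall>y\<in>W. \<forall>z\<in>W. T (c *\<^sub>R x) y z = c * T x y z)
   \<and> (\<forall>x\<in>W. \<forall>y\<in>W. \<forall>z\<in>W. T x y z = - T y x z)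
   \<and> (\<forall>x\<in>W. \<forall>y\<in>W. \<forall>z\<in>W. T x y z = - T x z y)"

text \<open>Type (iii): vanishing skew-symmetric prolongation
  \<Lambda>^3 W \<inter> (\<Lambda>^1 W \<otimes> g) = 0, where X \<lrcorner> T \<in> \<Lambda>^2 W is identified with the
  endomorphism F of W given by g(F u, v) = T(X,u,v).\<close>
definition skew_prolong_zero :: "('a::euclidean_space \<Rightarrow> 'a) set \<Rightarrow> 'a set \<Rightarrow> bool" where
  "skew_prolong_zero g W \<longleftrightarrow>
     (\<forall>T. alt3_on W T \<and> (\<forall>X\<in>W. \<exists>A\<in>g. \<forall>u\<in>W. \<forall>v\<in>W. T X u v = A u \<bullet> v)
        \<longrightarrow> (\<forall>x\<in>W. \<forall>y\<in>W. \<forall>z\<in>W. T x y z = 0))"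

end

theory Submission
  imports Defs
begin

text \<open>Let \<open>L\<close> be the skew-symmetric prolongation of \<open>G\<close>. If \<open>L = 0\<close>, then \<open>G\<close> itself is of type (iii).
  Otherwise take a nonzero \<open>T \<in> L\<close> with kernel \<open>K\<close> of maximal dimension and let \<open>s\<close> be the orthogonal
  complement of \<open>K\<close>. For \<open>x \<in> s\<close> the \<open>3\<close>-form \<open>T(x)\<cdot>T\<close> has \<open>x\<close> and \<open>K\<close> in its kernel, so it vanishes by
  maximality. This is the Jacobi identity: \<open>[x, y] = T(x, y)\<close> makes \<open>s\<close> a Lie algebra of compact type,
  which is simple since otherwise a component of \<open>T\<close> would have a larger kernel. If \<open>s\<close> has rank one,
  then \<open>s\<close> is \<open>so(3)\<close>, \<open>so(s)\<close> lies in \<open>G\<close>, and a maximal \<open>U\<close> with \<open>so(U)\<close> contained in \<open>G\<close> is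
  invariant: this is type (i). If the rank is at least two, a root space argument shows that \<open>T\<close> is
  the only tensor supported on \<open>s\<close> up to scaling; then \<open>G\<close> preserves \<open>s\<close>, acts on it by derivations,
  and all of these are inner: this is type (ii). In both cases a factor splits off, and one concludes
  by induction on the dimension.\<close>

section \<open>Skew-symmetric endomorphisms\<close>

text \<open>Maximality of the kernel acts as a nondegeneracy principle: a tensor supported on
  \<open>s\<close> that is annihilated by one vector outside \<open>K\<close> is zero. The Jacobi
  identity is its first use; the root argument uses it again with vectors of a torus. Everything
  stays over the reals. A weight vector h1 - i h2 is a pair of real vectors, eigenvalues come from
  extremal problems, and no classification of root systems enters. The hard point is that an element
  of \<open>G\<close> might move \<open>s\<close>. The directions in which \<open>T\<close> then
  moves contain a copy of \<open>s\<close>, and two members of this copy share a kernel as large as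
  \<open>K\<close> but placed differently. Uniqueness is therefore needed for every tensor of
  maximal kernel, not only for \<open>T\<close>. This fixes the case distinction: a single such
  tensor of rank one yields an orthogonal block, and otherwise all of them have rank at least
  two.\<close>

lemma quadratic_nonpos_imp_zero:
  fixes A B :: real
  assumes "\<And>t. 2 * t * A + t\<^sup>2 * B \<le> 0"
  shows "A = 0"
proof (rule ccontr)
  assume A: "A \<noteq> 0"
  \<comment> \<open>For t = s A the linear term outweighs the quadratic one, because s |B| <
    1.\<close>
  define s where "s = 1 / (\<bar>B\<bar> + 1)"
  have s: "s > 0" "s * \<bar>B\<bar> < 1" by (auto simp: s_def field_simps)
  have "2 * (s * A) * A + (s * A)\<^sup>2 * B \<le> 0" by (rule assms)
  moreover have "2 * (s * A) * A + (s * A)\<^sup>2 * B = s * A\<^sup>2 * (2 + s * B)"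
    by (simp add: power2_eq_square algebra_simps)
  moreover have "2 + s * B > 0"
  proof -
    have "\<bar>s * B\<bar> < 1" using s by (simp add: abs_mult)
    then show ?thesis by linarith
  qed
  moreover have "s * A\<^sup>2 > 0" using s A by simp
  ultimately show False by (metis mult_pos_pos not_le)
qed

text \<open>A maximiser of the Rayleigh quotient on the unit sphere of \<open>S\<close> is an
  eigenvector: the first variation in the direction \<open>N x - c *\<^sub>R x\<close> has to
  vanish. The bound by \<open>c\<close> is kept because later arguments rest on extremality.\<close>

lemma symmetric_eigenvector:
  fixes N :: "'a::euclidean_space \<Rightarrow> 'a"
  assumes N: "linear N" and S: "subspace S" and inv: "\<And>x. x \<in> S \<Longrightarrow> N x \<in> S"
    and sym: "\<And>x y. x \<in> S \<Longrightarrow> y \<in> S \<Longrightarrow> N x \<bullet> y = x \<bullet> N y"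
    and nz: "z \<in> S" "z \<noteq> 0"
  obtains x c where "x \<in> S" "norm x = 1" "N x = c *\<^sub>R x" "\<And>y. y \<in> S \<Longrightarrow> y \<bullet> N y \<le> c * (y \<bullet> y)"
proof -
  have cont: "continuous_on (sphere 0 1 \<inter> S) (\<lambda>y. y \<bullet> N y)"
    by (intro continuous_intros linear_continuous_on) (use N in \<open>simp add: linear_conv_bounded_linear\<close>)
  have "compact (sphere 0 1 \<inter> S)"
    by (intro compact_Int_closed compact_sphere closed_subspace S)
  moreover have "(1 / norm z) *\<^sub>R z \<in> sphere 0 1 \<inter> S"
    using nz S by (simp add: subspace_scale)
  ultimately obtain x where x: "x \<in> sphere 0 1 \<inter> S" "\<And>y. y \<in> sphere 0 1 \<inter> S \<Longrightarrow> y \<bullet> N y \<le> x \<bullet> N x"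
    using continuous_attains_sup[OF _ _ cont] by blast
  define c where "c = x \<bullet> N x"
  have xS: "x \<in> S" and nx: "norm x = 1" using x(1) by auto
  have bound: "y \<bullet> N y \<le> c * (y \<bullet> y)" if "y \<in> S" for y
  proof (cases "y = 0")
    case False
    have "(1 / norm y) *\<^sub>R y \<in> sphere 0 1 \<inter> S" using False that S by (simp add: subspace_scale)
    from x(2)[OF this] have "(y \<bullet> N y) / (norm y)\<^sup>2 \<le> c"
      by (simp add: linear_scale[OF N] c_def power2_eq_square)
    then show ?thesis using False by (simp add: field_simps dot_square_norm)
  qed simp
  have "N x = c *\<^sub>R x"
  proof -
    define z where "z = N x - c *\<^sub>R x"
    have zS: "z \<in> S" using xS S inv by (simp add: z_def subspace_diff subspace_scale)
    have "z \<bullet> z = 0"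
    proof (rule quadratic_nonpos_imp_zero[where B = "z \<bullet> N z - c * (z \<bullet> z)"])
      fix t :: real
      have key: "2 * t * s + t\<^sup>2 * (q - c * s) \<le> 0"
        if "c + 2 * t * p + t\<^sup>2 * q \<le> c * (1 + 2 * t * r + t\<^sup>2 * s)" "s = p - c * r" for p q r s
      proof -
        have "2 * t * s + t\<^sup>2 * (q - c * s)
            = (c + 2 * t * p + t\<^sup>2 * q) - c * (1 + 2 * t * r + t\<^sup>2 * s)"
          unfolding that(2) by (simp add: field_simps)
        then show ?thesis using that(1) by linarith
      qed
      have zx: "x \<bullet> z = z \<bullet> x" "x \<bullet> N z = z \<bullet> N x" "x \<bullet> N x = c" "x \<bullet> x = 1"
        using sym[OF xS zS] nx by (auto simp: inner_commute c_def dot_square_norm)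
      have e1: "(x + t *\<^sub>R z) \<bullet> N (x + t *\<^sub>R z) = c + 2 * t * (z \<bullet> N x) + t\<^sup>2 * (z \<bullet> N z)"
        by (simp add: linear_add[OF N] linear_scale[OF N] inner_add_left inner_add_right
            power2_eq_square zx distrib_left)
      have e2: "(x + t *\<^sub>R z) \<bullet> (x + t *\<^sub>R z) = 1 + 2 * t * (z \<bullet> x) + t\<^sup>2 * (z \<bullet> z)"
        by (simp add: inner_add_left inner_add_right power2_eq_square zx distrib_left)
      have "z \<bullet> z = z \<bullet> (N x - c *\<^sub>R x)" by (simp add: z_def)
      then have e3: "z \<bullet> z = z \<bullet> N x - c * (z \<bullet> x)" by (simp add: inner_diff_right)
      show "2 * t * (z \<bullet> z) + t\<^sup>2 * (z \<bullet> N z - c * (z \<bullet> z)) \<le> 0"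
        using bound[OF subspace_add[OF S xS subspace_scale[OF S zS]], of t] key[OF _ e3] unfolding e1 e2 by blast
    qed
    then show ?thesis by (simp add: z_def)
  qed
  then show ?thesis using that xS nx bound by blast
qed

lemma so_V_linear: "so_V A \<Longrightarrow> linear A"
  and so_V_skew: "so_V A \<Longrightarrow> A x \<bullet> y = - (x \<bullet> A y)"
  by (auto simp: so_V_def)

text \<open>The operator -a^2 is symmetric and nonnegative. Its top eigenvalue is m^2 with m the
  norm of \<open>a\<close> on \<open>S\<close>; the vectors \<open>x\<close> and \<open>a x\<close>
  replace a complex eigenvector for i m.\<close>

lemma skew_top_eigenvector:
  fixes a :: "'a::euclidean_space \<Rightarrow> 'a"
  assumes a: "so_V a" and S: "subspace S" and inv: "\<And>x. x \<in> S \<Longrightarrow> a x \<in> S"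
    and nz: "z \<in> S" "z \<noteq> 0"
  obtains x m where "x \<in> S" "norm x = 1" "m \<ge> 0" "a (a x) = - (m\<^sup>2) *\<^sub>R x"
    "\<And>y. y \<in> S \<Longrightarrow> norm (a y) \<le> m * norm y"
proof -
  note lin = so_V_linear[OF a]
  have L: "linear (\<lambda>x. - a (a x))"
    using linear_compose_neg[OF linear_compose[OF lin lin]] by (simp add: o_def)
  obtain x c where x: "x \<in> S" "norm x = 1" "- a (a x) = c *\<^sub>R x"
    "\<And>y. y \<in> S \<Longrightarrow> y \<bullet> - a (a y) \<le> c * (y \<bullet> y)"
    by (rule symmetric_eigenvector[OF L S _ _ nz])
      (use inv S in \<open>auto simp: subspace_neg so_V_skew[OF a]\<close>)
  have na: "y \<bullet> - a (a y) = (norm (a y))\<^sup>2" for y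
    by (simp add: so_V_skew[OF a] dot_square_norm[symmetric] inner_commute)
  have "c = (norm (a x))\<^sup>2"
    using na[of x] x(2,3) by (simp add: dot_square_norm)
  then have c: "c \<ge> 0" by simp
  show ?thesis
  proof (rule that[OF x(1,2), of "sqrt c"])
    show "a (a x) = - ((sqrt c)\<^sup>2) *\<^sub>R x" using x(3) c by (simp add: minus_equation_iff)
    show "norm (a y) \<le> sqrt c * norm y" if "y \<in> S" for y
    proof (rule power2_le_imp_le)
      show "(norm (a y))\<^sup>2 \<le> (sqrt c * norm y)\<^sup>2"
        using x(4)[OF that] c unfolding na by (simp add: power_mult_distrib dot_square_norm)
    qed (use c in simp)
  qed (use c in simp)
qed

lemma skew_bottom_eigenvector:
  fixes a :: "'a::euclidean_space \<Rightarrow> 'a"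
  assumes a: "so_V a" and S: "subspace S" and inv: "\<And>x. x \<in> S \<Longrightarrow> a x \<in> S"
    and nz: "z \<in> S" "z \<noteq> 0"
  obtains x m where "x \<in> S" "norm x = 1" "m \<ge> 0" "a (a x) = - (m\<^sup>2) *\<^sub>R x"
    "\<And>y. y \<in> S \<Longrightarrow> m * norm y \<le> norm (a y)"
proof -
  note lin = so_V_linear[OF a]
  have L: "linear (\<lambda>x. a (a x))"
    using linear_compose[OF lin lin] by (simp add: o_def)
  obtain x c where x: "x \<in> S" "norm x = 1" "a (a x) = c *\<^sub>R x"
    "\<And>y. y \<in> S \<Longrightarrow> y \<bullet> a (a y) \<le> c * (y \<bullet> y)"
    by (rule symmetric_eigenvector[OF L S _ _ nz])
      (use inv S in \<open>auto simp: subspace_neg so_V_skew[OF a]\<close>)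
  have na: "y \<bullet> a (a y) = - (norm (a y))\<^sup>2" for y
    using so_V_skew[OF a, of y "a y"] by (simp add: dot_square_norm[symmetric])
  have "- c = (norm (a x))\<^sup>2"
    using na[of x] x(2,3) by (simp add: dot_square_norm)
  then have c: "- c \<ge> 0" by simp
  show ?thesis
  proof (rule that[OF x(1,2), of "sqrt (- c)"])
    show "a (a x) = - ((sqrt (- c))\<^sup>2) *\<^sub>R x" using x(3) c by simp
    show "sqrt (- c) * norm y \<le> norm (a y)" if "y \<in> S" for y
    proof (rule power2_le_imp_le)
      show "(sqrt (- c) * norm y)\<^sup>2 \<le> (norm (a y))\<^sup>2"
        using x(4)[OF that] c by (simp add: na power_mult_distrib dot_square_norm)
    qed simp
  qed (use c in simp)
qed

lemma skew_square_zero: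
  assumes "so_V a" "a (a x) = 0" shows "a x = 0"
  using so_V_skew[OF assms(1), of x "a x"] assms(2) by simp

text \<open>Real substitute for a common weight vector of two commuting operators. On an eigenspace
  of a^2 with eigenvalue -m^2 the product a b is symmetric; if a b y = c y, then applying
  \<open>a\<close> gives c a y = -m^2 b y.\<close>

lemma commuting_skew_kernel:
  fixes a b :: "'a::euclidean_space \<Rightarrow> 'a"
  assumes a: "so_V a" and b: "so_V b" and S: "subspace S"
    and ia: "\<And>x. x \<in> S \<Longrightarrow> a x \<in> S" and ib: "\<And>x. x \<in> S \<Longrightarrow> b x \<in> S"
    and com: "\<And>x. x \<in> S \<Longrightarrow> a (b x) = b (a x)"
    and nz: "z \<in> S" "z \<noteq> 0"
  obtains p q x where "(p, q) \<noteq> (0, 0)" "x \<in> S" "x \<noteq> 0" "p *\<^sub>R a x + q *\<^sub>R b x = 0"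
proof -
  note la = so_V_linear[OF a] and lb = so_V_linear[OF b]
  obtain x m where x: "x \<in> S" "norm x = 1" "m \<ge> 0" "a (a x) = - (m\<^sup>2) *\<^sub>R x"
    by (rule skew_top_eigenvector[OF a S ia nz])
  show ?thesis
  proof (cases "m = 0")
    case True
    then have "a x = 0" using x skew_square_zero[OF a] by simp
    then show ?thesis using that[of 1 0 x] x by force
  next
    case False
    define F where "F = {y \<in> S. a (a y) = - (m\<^sup>2) *\<^sub>R y}"
    have F: "subspace F"
      using S by (auto simp: F_def subspace_def linear_add[OF la] linear_scale[OF la] linear_0[OF la]
          scaleR_right_distrib)
    have L: "linear (\<lambda>y. a (b y))" using linear_compose[OF lb la] by (simp add: o_def)
    have "x \<in> F" "x \<noteq> 0" using x by (auto simp: F_def)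
    then obtain y c where y: "y \<in> F" "norm y = 1" "a (b y) = c *\<^sub>R y"
    proof (rule symmetric_eigenvector[OF L F, rotated 2])
      show "a (b y) \<in> F" if "y \<in> F" for y
        using that ia ib com by (simp add: F_def linear_scale[OF la] linear_scale[OF lb] linear_neg[OF lb] linear_neg[OF la])
      show "a (b u) \<bullet> v = u \<bullet> a (b v)" if "u \<in> F" "v \<in> F" for u v
        using that com by (simp add: F_def so_V_skew[OF a] so_V_skew[OF b])
    qed
    have "c *\<^sub>R a y + m\<^sup>2 *\<^sub>R b y = 0"
    proof -
      have "c *\<^sub>R a y = a (a (b y))" by (simp add: y linear_scale[OF la])
      also have "\<dots> = b (a (a y))" using com[of y] com[of "a y"] y ia by (auto simp: F_def)
      also have "\<dots> = - (m\<^sup>2) *\<^sub>R b y" using y by (simp add: F_def linear_scale[OF lb] linear_neg[OF lb])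
      finally show ?thesis by simp
    qed
    then show ?thesis using that[of c "m\<^sup>2" y] y False by (force simp: F_def)
  qed
qed

lemma orthogonal_decomposition:
  fixes S :: "'a::euclidean_space set"
  assumes "subspace S"
  obtains y z where "x = y + z" "y \<in> S" "\<And>w. w \<in> S \<Longrightarrow> z \<bullet> w = 0"
  using orthogonal_subspace_decomp_exists[of S x] assms
  by (metis orthogonal_def span_eq_iff inner_commute)

lemma skew_kernel_range_decomposition:
  fixes a :: "'a::euclidean_space \<Rightarrow> 'a"
  assumes a: "so_V a" and S: "subspace S" and inv: "\<And>x. x \<in> S \<Longrightarrow> a x \<in> S" and x: "x \<in> S"
  obtains c y where "x = c + a y" "c \<in> S" "y \<in> S" "a c = 0"
proof -
  have "subspace (a ` S)" by (intro linear_subspace_image so_V_linear a S)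
  then obtain r c where rc: "x = r + c" "r \<in> a ` S" "\<And>w. w \<in> a ` S \<Longrightarrow> c \<bullet> w = 0"
    using orthogonal_decomposition[of "a ` S" x] by blast
  then obtain y where y: "y \<in> S" "r = a y" by blast
  have cS: "c \<in> S"
    using rc y x inv S by (metis add_diff_cancel_left' subspace_diff)
  have "a c \<bullet> a c = 0" using rc(3)[of "a (a c)"] cS inv so_V_skew[OF a, of c "a c"] by auto
  then show ?thesis using that[of c y] rc y cS by (simp add: add.commute)
qed

lemma orthogonal_projection_exists:
  fixes S :: "'a::euclidean_space set"
  assumes "subspace S"
  obtains \<pi> where "linear \<pi>" "\<And>x. \<pi> x \<in> S" "\<And>x. x \<in> S \<Longrightarrow> \<pi> x = x"
    "\<And>x y. \<pi> x \<bullet> y = x \<bullet> \<pi> y" "\<And>x w. w \<in> S \<Longrightarrow> (x - \<pi> x) \<bullet> w = 0"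
proof -
  obtain B where B: "B \<subseteq> S" "pairwise orthogonal B" "\<And>x. x \<in> B \<Longrightarrow> norm x = 1" "span B = S" "independent B"
    using orthonormal_basis_subspace[OF assms] by metis
  have fin: "finite B" using B(5) by (simp add: independent_imp_finite)
  define \<pi> where "\<pi> x = (\<Sum>b\<in>B. (x \<bullet> b) *\<^sub>R b)" for x
  have lin: "linear \<pi>"
    by (rule linearI) (auto simp: \<pi>_def inner_add_left scaleR_left_distrib sum.distrib scaleR_sum_right)
  have inS: "\<pi> x \<in> S" for x
    unfolding \<pi>_def by (intro subspace_sum subspace_scale assms) (use B(1) in auto)
  have fixB: "\<pi> c = c" if "c \<in> B" for c
  proof -
    have "\<pi> c = (\<Sum>b\<in>B. if b = c then c else 0)"
      unfolding \<pi>_def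
    proof (rule sum.cong)
      fix b assume "b \<in> B"
      then show "(c \<bullet> b) *\<^sub>R b = (if b = c then c else 0)"
        using B(2,3) that by (auto simp: pairwise_def orthogonal_def dot_square_norm)
    qed simp
    then show ?thesis using that fin by simp
  qed
  have fixS: "\<pi> x = x" if "x \<in> S" for x
  proof -
    have "x \<in> span B" using that B(4) by simp
    then show ?thesis
      using linear_eq_on_span[OF lin linear_ident, of B x] fixB by auto
  qed
  have sym: "\<pi> x \<bullet> y = x \<bullet> \<pi> y" for x y
    by (simp add: \<pi>_def inner_sum_left inner_sum_right inner_commute mult.commute)
  have "(x - \<pi> x) \<bullet> w = 0" if "w \<in> S" for x w
    using sym[of x w] fixS[OF that] by (simp add: inner_diff_left)
  then show ?thesis using that lin inS fixS sym by blast
qed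

section \<open>Bilinear maps as a euclidean space\<close>

text \<open>The vector type constructor needs a finite index type; the standard basis of
  \<open>'a\<close> supplies one of the right size.\<close>

typedef (overloaded) 'a basis_index = "Basis :: 'a::euclidean_space set"
  using nonempty_Basis by (simp add: ex_in_conv)

instance basis_index :: (euclidean_space) finite
proof
  have "(UNIV :: 'a basis_index set) = Abs_basis_index ` Basis"
    using Abs_basis_index_cases by auto
  then show "finite (UNIV :: 'a basis_index set)" by (rule ssubst) (rule finite_imageI[OF finite_Basis])
qed

type_synonym 'a tensor = "('a ^ 'a basis_index) ^ 'a basis_index"

text \<open>Bilinear maps of \<open>'a\<close> into itself, stored as arrays of values on the standard basis. In
  contrast to functions they form a euclidean space.\<close>

definition ap :: "'a::euclidean_space tensor \<Rightarrow> 'a \<Rightarrow> 'a \<Rightarrow> 'a" where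
  "ap t x y = (\<Sum>i\<in>UNIV. \<Sum>j\<in>UNIV. ((x \<bullet> Rep_basis_index i) * (y \<bullet> Rep_basis_index j)) *\<^sub>R (t $ i $ j))"

definition enc :: "('a::euclidean_space \<Rightarrow> 'a \<Rightarrow> 'a) \<Rightarrow> 'a tensor" where
  "enc f = (\<chi> i j. f (Rep_basis_index i) (Rep_basis_index j))"

lemma bij_Rep_basis_index: "bij_betw (Rep_basis_index :: 'a::euclidean_space basis_index \<Rightarrow> 'a) UNIV Basis"
  unfolding bij_betw_def
  by (intro conjI injI type_definition.Rep_range[OF type_definition_basis_index])
    (rule Rep_basis_index_inject[THEN iffD1])

lemma sum_basis_index:
  "(\<Sum>i\<in>UNIV. f (Rep_basis_index i)) = (\<Sum>b\<in>(Basis :: 'a::euclidean_space set). f b)"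
  by (rule sum.reindex_bij_betw[OF bij_Rep_basis_index])

lemma ap_basis: "ap t (Rep_basis_index i) (Rep_basis_index j) = t $ i $ j"
proof -
  have *: "Rep_basis_index k \<bullet> Rep_basis_index l = (if l = k then 1 else 0)" for k l :: "'a basis_index"
    using Rep_basis_index[of k] Rep_basis_index[of l] by (auto simp: inner_Basis Rep_basis_index_inject)
  have "ap t (Rep_basis_index i) (Rep_basis_index j)
     = (\<Sum>k\<in>UNIV. \<Sum>l\<in>UNIV. if l = j then if k = i then t $ i $ j else 0 else 0)"
    unfolding ap_def * by (intro sum.cong refl) auto
  then show ?thesis by simp
qed

lemma tensor_eqI: "(\<And>x y. ap t x y = ap t' x y) \<Longrightarrow> t = t'"
  by (simp add: vec_eq_iff ap_basis[symmetric])

lemma ap_bilinear: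
  "linear (\<lambda>t. ap t x y)" "linear (\<lambda>x. ap t x y)" "linear (ap t x)"
  by (auto intro!: linearI simp: ap_def sum.distrib scaleR_right_distrib scaleR_left_distrib
      inner_add_left distrib_left distrib_right scaleR_sum_right mult_ac)

lemmas ap_simps [simp] =
  linear_add[OF ap_bilinear(1)] linear_diff[OF ap_bilinear(1)] linear_neg[OF ap_bilinear(1)]
  linear_scale[OF ap_bilinear(1)] linear_0[OF ap_bilinear(1)]
  linear_add[OF ap_bilinear(2)] linear_diff[OF ap_bilinear(2)] linear_neg[OF ap_bilinear(2)]
  linear_scale[OF ap_bilinear(2)] linear_0[OF ap_bilinear(2)]
  linear_add[OF ap_bilinear(3)] linear_diff[OF ap_bilinear(3)] linear_neg[OF ap_bilinear(3)]
  linear_scale[OF ap_bilinear(3)] linear_0[OF ap_bilinear(3)]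

lemma linear_sum_basis: "linear f \<Longrightarrow> f x = (\<Sum>b\<in>Basis. (x \<bullet> b) *\<^sub>R f b)"
  for f :: "'a::euclidean_space \<Rightarrow> 'b::real_vector"
  by (metis (no_types, lifting) euclidean_representation linear_scale linear_sum sum.cong)

lemma ap_enc:
  assumes "\<And>y. linear (\<lambda>x. f x y)" "\<And>x. linear (f x)"
  shows "ap (enc f) x y = f x y"
proof -
  have "ap (enc f) x y = (\<Sum>i\<in>Basis. \<Sum>j\<in>Basis. ((x \<bullet> i) * (y \<bullet> j)) *\<^sub>R f i j)"
    unfolding ap_def enc_def vec_lambda_beta by (simp only: sum_basis_index[symmetric])
  also have "\<dots> = (\<Sum>i\<in>Basis. (x \<bullet> i) *\<^sub>R f i y)"
    by (intro sum.cong refl) (simp add: linear_sum_basis[OF assms(2), of _ y] scaleR_sum_right)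
  also have "\<dots> = f x y" by (rule linear_sum_basis[OF assms(1), symmetric])
  finally show ?thesis .
qed

lemma inner_tensor: "t \<bullet> t' = (\<Sum>i\<in>Basis. \<Sum>j\<in>Basis. ap t i j \<bullet> ap t' i j)"
  by (simp add: inner_vec_def ap_basis[symmetric] sum_basis_index[symmetric])

text \<open>The matrix of \<open>A\<close> in the standard basis is skew, so exchanging the two
  summation indices moves \<open>A\<close> across with a sign.\<close>

lemma sum_basis_skew:
  fixes f g :: "'a::euclidean_space \<Rightarrow> 'b::euclidean_space"
  assumes "linear f" "linear g" "so_V A"
  shows "(\<Sum>b\<in>Basis. f (A b) \<bullet> g b) = - (\<Sum>b\<in>Basis. f b \<bullet> g (A b))"
proof -
  have "(\<Sum>b\<in>Basis. f (A b) \<bullet> g b) = (\<Sum>b\<in>Basis. \<Sum>c\<in>Basis. (A b \<bullet> c) * (f c \<bullet> g b))"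
    by (intro sum.cong refl, subst linear_sum_basis[OF assms(1)]) (simp add: inner_sum_left)
  also have "\<dots> = (\<Sum>c\<in>Basis. \<Sum>b\<in>Basis. (A b \<bullet> c) * (f c \<bullet> g b))" by (rule sum.swap)
  also have "\<dots> = (\<Sum>c\<in>Basis. \<Sum>b\<in>Basis. - (A c \<bullet> b) * (f c \<bullet> g b))"
  proof -
    have "A b \<bullet> c = - (A c \<bullet> b)" for b c using so_V_skew[OF assms(3), of b c] by (simp add: inner_commute)
    then show ?thesis by (intro sum.cong refl arg_cong2[where f = "(*)"])
  qed
  also have "\<dots> = - (\<Sum>c\<in>Basis. \<Sum>b\<in>Basis. (A c \<bullet> b) * (f c \<bullet> g b))"
    by (simp add: sum_negf)
  also have "(\<Sum>c\<in>Basis. \<Sum>b\<in>Basis. (A c \<bullet> b) * (f c \<bullet> g b)) = (\<Sum>c\<in>Basis. f c \<bullet> g (A c))"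
    by (intro sum.cong refl, subst (2) linear_sum_basis[OF assms(2)]) (simp add: inner_sum_right)
  finally show ?thesis .
qed

text \<open>The natural infinitesimal action of an endomorphism on bilinear maps; for linear
  \<open>A\<close>, \<open>act A t = 0\<close> says that \<open>A\<close> is a derivation of the
  product \<open>ap t\<close>.\<close>

definition act :: "('a::euclidean_space \<Rightarrow> 'a) \<Rightarrow> 'a tensor \<Rightarrow> 'a tensor" where
  "act A t = enc (\<lambda>x y. A (ap t x y) - ap t (A x) y - ap t x (A y))"

lemma ap_act: "linear A \<Longrightarrow> ap (act A t) x y = A (ap t x y) - ap t (A x) y - ap t x (A y)"
  unfolding act_def
  by (rule ap_enc) (auto intro!: linearI simp: linear_add linear_scale linear_diff algebra_simps)

lemma linear_act: "linear A \<Longrightarrow> linear (act A)"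
  by (rule linearI) (auto intro!: tensor_eqI simp: ap_act linear_add linear_scale algebra_simps)

lemma linear_lie_br: "linear A \<Longrightarrow> linear B \<Longrightarrow> linear (lie_br A B)"
  unfolding lie_br_def by (rule linearI) (auto simp: linear_add linear_scale algebra_simps)

lemma act_lie_br:
  assumes "linear A" "linear B"
  shows "act (lie_br A B) t = act A (act B t) - act B (act A t)"
proof (rule tensor_eqI)
  fix x y
  show "ap (act (lie_br A B) t) x y = ap (act A (act B t) - act B (act A t)) x y"
    unfolding ap_act[OF linear_lie_br[OF assms]] ap_simps(2) ap_act[OF assms(1)] ap_act[OF assms(2)]
    unfolding lie_br_def linear_diff[OF assms(1)] linear_diff[OF assms(2)] ap_simps(7,12)
    by (simp only: algebra_simps)
qed

lemma act_add:
  assumes "linear A" "linear B"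
  shows "act (\<lambda>x. A x + B x) t = act A t + act B t"
proof -
  have "linear (\<lambda>x. A x + B x)" using assms by (rule linear_compose_add)
  from ap_act[OF this] show ?thesis
    by (intro tensor_eqI) (simp add: ap_act[OF assms(1)] ap_act[OF assms(2)])
qed

lemma act_scale:
  assumes "linear A"
  shows "act (\<lambda>x. c *\<^sub>R A x) t = c *\<^sub>R act A t"
proof -
  have "linear (\<lambda>x. c *\<^sub>R A x)" using assms by (rule linear_compose_scale_right)
  from ap_act[OF this] show ?thesis
    by (intro tensor_eqI) (simp add: ap_act[OF assms] scaleR_diff_right)
qed

lemma act_0 [simp]: "act (\<lambda>x. 0) t = 0"
  by (intro tensor_eqI) (simp add: ap_act[OF linear_zero])

lemma so_V_act:
  assumes A: "so_V A"
  shows "so_V (act A)"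
  unfolding so_V_def
proof (intro conjI allI)
  note lA = so_V_linear[OF A]
  show "linear (act A)" by (rule linear_act[OF lA])
  fix t t' :: "'a tensor"
  have 1: "(\<Sum>i\<in>Basis. \<Sum>j\<in>Basis. A (ap t i j) \<bullet> ap t' i j) = - (\<Sum>i\<in>Basis. \<Sum>j\<in>Basis. ap t i j \<bullet> A (ap t' i j))"
    by (simp only: so_V_skew[OF A, of "ap t i j" "ap t' i j" for i j] sum_negf)
  have 2: "(\<Sum>i\<in>Basis. \<Sum>j\<in>Basis. ap t i (A j) \<bullet> ap t' i j) = - (\<Sum>i\<in>Basis. \<Sum>j\<in>Basis. ap t i j \<bullet> ap t' i (A j))"
    by (simp add: sum_basis_skew[OF ap_bilinear(3) ap_bilinear(3) A] sum_negf)
  have 3: "(\<Sum>i\<in>Basis. \<Sum>j\<in>Basis. ap t (A i) j \<bullet> ap t' i j) = - (\<Sum>i\<in>Basis. \<Sum>j\<in>Basis. ap t i j \<bullet> ap t' (A i) j)"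
    by (subst (1 2) sum.swap) (simp add: sum_basis_skew[OF ap_bilinear(2) ap_bilinear(2) A] sum_negf)
  show "act A t \<bullet> t' = - (t \<bullet> act A t')"
    unfolding inner_tensor ap_act[OF lA] inner_diff_left inner_diff_right sum_subtractf
    using 1 2 3 by simp
qed

text \<open>Invariance of the trace form, the basis of the Killing form arguments below.\<close>

lemma frob_lie_br:
  assumes "so_V A" "so_V B" "so_V C"
  shows "frob (lie_br A B) C = frob A (lie_br B C)"
proof -
  have "(\<Sum>b\<in>Basis. A (B b) \<bullet> C b) = - (\<Sum>b\<in>Basis. A b \<bullet> C (B b))"
    using assms by (intro sum_basis_skew so_V_linear)
  moreover have "(\<Sum>b\<in>Basis. B (A b) \<bullet> C b) = - (\<Sum>b\<in>Basis. A b \<bullet> B (C b))"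
    by (simp only: so_V_skew[OF assms(2), of "A b" "C b" for b] sum_negf)
  ultimately show ?thesis
    by (simp add: frob_def lie_br_def inner_diff_left inner_diff_right sum_subtractf)
qed

lemma frob_commute: "frob A B = frob B A"
  by (simp add: frob_def inner_commute)

lemma frob_diff: "frob (\<lambda>x. A x - B x) C = frob A C - frob B C"
  by (simp add: frob_def inner_diff_left sum_subtractf)

section \<open>Tensors of maximal kernel dimension\<close>

definition ker :: "'a::euclidean_space tensor \<Rightarrow> 'a set" where
  "ker t = {x. \<forall>y. ap t x y = 0}"

lemma subspace_ker: "subspace (ker t)"
  by (auto simp: ker_def subspace_def)

lemma eq_neg_self_imp_0:
  fixes x :: "'a::real_vector"
  assumes "x = - x"
  shows "x = 0"
proof -
  have "2 *\<^sub>R x = x + x" by (rule scaleR_2)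
  also have "\<dots> = 0" using assms by (metis add.right_inverse)
  finally show ?thesis by simp
qed

section \<open>The skew-symmetric prolongation of G and the action of G on it\<close>

locale lie_so =
  fixes G :: "('a::euclidean_space \<Rightarrow> 'a) set"
  assumes G: "lie_subalgebra_so G"
begin

lemma G_so: "A \<in> G \<Longrightarrow> so_V A"
  and G_zero: "(\<lambda>_. 0) \<in> G"
  and G_add: "A \<in> G \<Longrightarrow> B \<in> G \<Longrightarrow> (\<lambda>x. A x + B x) \<in> G"
  and G_scale: "A \<in> G \<Longrightarrow> (\<lambda>x. c *\<^sub>R A x) \<in> G"
  and G_br: "A \<in> G \<Longrightarrow> B \<in> G \<Longrightarrow> lie_br A B \<in> G"
  using G by (auto simp: lie_subalgebra_so_def endo_subspace_def)

lemmas G_linear = so_V_linear[OF G_so] and G_skew = so_V_skew[OF G_so]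

lemma G_diff: "A \<in> G \<Longrightarrow> B \<in> G \<Longrightarrow> (\<lambda>x. A x - B x) \<in> G"
  using G_add[OF _ G_scale[of B "-1"], of A] by simp

lemma G_sum:
  assumes "\<And>i. i \<in> I \<Longrightarrow> A i \<in> G"
  shows "(\<lambda>x. \<Sum>i\<in>I. A i x) \<in> G"
  using assms
proof (induction I rule: infinite_finite_induct)
  case (insert i I)
  then show ?case using G_add[of "A i" "\<lambda>x. \<Sum>i\<in>I. A i x"] by simp
qed (simp_all add: G_zero)

text \<open>Each \<open>ap t x\<close> lies in \<open>G\<close> and is skew-symmetric, so skewness
  in the two arguments makes the inner product of \<open>ap t x y\<close> with z alternating in x,
  y, z. This is the prolongation on the whole space, with values raised to vectors.\<close>

definition L :: "'a tensor set" where
  "L = {t. (\<forall>x. ap t x \<in> G) \<and> (\<forall>x y. ap t x y = - ap t y x)}"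

lemma LI: "(\<And>x. ap t x \<in> G) \<Longrightarrow> (\<And>x y. ap t x y = - ap t y x) \<Longrightarrow> t \<in> L"
  unfolding L_def by blast

lemma L_G: "t \<in> L \<Longrightarrow> ap t x \<in> G"
  unfolding L_def by blast

lemma L_swap: "t \<in> L \<Longrightarrow> ap t x y = - ap t y x"
  unfolding L_def by blast

lemma L_self: "t \<in> L \<Longrightarrow> ap t x x = 0"
  by (rule eq_neg_self_imp_0[OF L_swap])

lemma L_skew: "t \<in> L \<Longrightarrow> ap t x y \<bullet> z = - (y \<bullet> ap t x z)"
  using G_skew[OF L_G] .

lemma subspace_L: "subspace L"
proof -
  have "ap (t + t') x = (\<lambda>y. ap t x y + ap t' x y)" "ap (c *\<^sub>R t) x = (\<lambda>y. c *\<^sub>R ap t x y)"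
    "ap 0 x = (\<lambda>_. 0)" for t t' :: "'a tensor" and c x
    by auto
  note ap = this
  show ?thesis
  proof (rule subspaceI; rule LI)
    fix t t' c x y
    assume t: "t \<in> L"
    show "ap (c *\<^sub>R t) x \<in> G" unfolding ap by (intro G_scale L_G t)
    show "ap (c *\<^sub>R t) x y = - ap (c *\<^sub>R t) y x" using L_swap[OF t, of x y] by simp
    assume t': "t' \<in> L"
    show "ap (t + t') x \<in> G" unfolding ap by (intro G_add L_G t t')
    show "ap (t + t') x y = - ap (t + t') y x" using L_swap[OF t, of x y] L_swap[OF t', of x y] by simp
  qed (auto simp: ap G_zero)
qed

lemma ap_act_G:
  assumes "A \<in> G"
  shows "ap (act A t) x = (\<lambda>y. lie_br A (ap t x) y - ap t (A x) y)"
  by (auto simp: ap_act[OF G_linear[OF assms]] lie_br_def)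

lemma act_L:
  assumes "A \<in> G" "t \<in> L"
  shows "act A t \<in> L"
proof (rule LI)
  show "ap (act A t) x \<in> G" for x
    unfolding ap_act_G[OF assms(1)] by (intro G_diff G_br L_G assms)
  show "ap (act A t) x y = - ap (act A t) y x" for x y
    unfolding ap_act[OF G_linear[OF assms(1)]]
    using L_swap[OF assms(2), of x y] L_swap[OF assms(2), of "A x" y] L_swap[OF assms(2), of x "A y"]
    by (simp add: linear_neg[OF G_linear[OF assms(1)]])
qed

end

section \<open>The Lie algebra carried by a tensor of maximal kernel\<close>

locale minimal_tensor = lie_so G for G :: "('a::euclidean_space \<Rightarrow> 'a) set" +
  fixes T :: "'a tensor"
  assumes T_L: "T \<in> L" and T_nz: "T \<noteq> 0"
    and minimal: "\<And>t. t \<in> L \<Longrightarrow> t \<noteq> 0 \<Longrightarrow> dim (ker t) \<le> dim (ker T)"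
begin

abbreviation br where "br \<equiv> ap T"

definition K :: "'a set" where "K = ker T"

definition s :: "'a set" where "s = {x. \<forall>z\<in>K. x \<bullet> z = 0}"

definition Ls :: "'a tensor set" where "Ls = {t \<in> L. K \<subseteq> ker t}"

lemma subspace_K: "subspace K" and subspace_s: "subspace s" and subspace_Ls: "subspace Ls"
  using subspace_ker subspace_L
  by (auto simp: K_def s_def Ls_def subspace_def ker_def inner_add_left subset_eq)

lemma Ls_L: "t \<in> Ls \<Longrightarrow> t \<in> L"
  by (simp add: Ls_def)

lemma T_Ls: "T \<in> Ls"
  by (simp add: Ls_def T_L K_def)

lemma Ls_ker: "t \<in> Ls \<Longrightarrow> t \<noteq> 0 \<Longrightarrow> ker t = K"
  using subspace_dim_equal[OF subspace_ker subspace_ker, of T t] minimal[of t]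
  by (simp add: Ls_def K_def)

text \<open>A nonzero member of \<open>Ls\<close> would have a kernel strictly larger than
  \<open>K\<close>. Maximality is mostly used in this form: exhibit one vector outside
  \<open>K\<close> that contracts a tensor to zero.\<close>

lemma nondegenerate:
  assumes "t \<in> Ls" "x \<notin> K" "\<And>y. ap t x y = 0"
  shows "t = 0"
  using Ls_ker[OF assms(1)] assms(2,3) by (auto simp: ker_def)

lemma s_K: "x \<in> s \<Longrightarrow> x \<in> K \<Longrightarrow> x = 0"
  by (auto simp: s_def)

lemma s_K_decomposition:
  obtains y z where "x = y + z" "y \<in> s" "z \<in> K"
proof -
  obtain y z where "x = y + z" "y \<in> K" "\<And>w. w \<in> K \<Longrightarrow> z \<bullet> w = 0"
    using orthogonal_decomposition[OF subspace_K] by metis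
  then show ?thesis using that[of z y] by (simp add: s_def add.commute)
qed

lemma Ls_K: "t \<in> Ls \<Longrightarrow> z \<in> K \<Longrightarrow> ap t z y = 0" "t \<in> Ls \<Longrightarrow> z \<in> K \<Longrightarrow> ap t y z = 0"
proof -
  show *: "ap t z y = 0" if "t \<in> Ls" "z \<in> K" for y
    using that by (auto simp: Ls_def ker_def)
  show "ap t y z = 0" if "t \<in> Ls" "z \<in> K"
    using *[OF that, of y] L_swap[OF Ls_L[OF that(1)], of y z] by simp
qed

lemma Ls_values: "t \<in> Ls \<Longrightarrow> ap t x y \<in> s"
  by (auto simp: s_def L_skew[OF Ls_L] Ls_K)

lemma act_Ls:
  assumes "t \<in> Ls" "t' \<in> Ls"
  shows "act (ap t x) t' \<in> Ls"
  using assms act_L[OF L_G[OF Ls_L] Ls_L]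
  by (auto simp: Ls_def ker_def[of "act _ _"] ap_act[OF ap_bilinear(3)] Ls_K[unfolded Ls_def])

text \<open>Contracted with \<open>x\<close> and \<open>y\<close>, the two actions give t(x, t'(x,
  y)) - t'(x, t(x, y)) and its negative, because t(x, x) = t'(x, x) = 0. So \<open>x\<close>
  annihilates their sum. Taking t = t' yields the Jacobi identity; the polarised form serves to
  compare \<open>T\<close> with a second tensor.\<close>

lemma act_swap:
  assumes t: "t \<in> Ls" "t' \<in> Ls"
  shows "act (ap t x) t' = - act (ap t' x) t"
proof -
  have "act (ap t x) t' + act (ap t' x) t = 0"
  proof (cases "x \<in> K")
    case True
    then have "ap t x = (\<lambda>_. 0)" "ap t' x = (\<lambda>_. 0)" using Ls_K t by auto
    then show ?thesis by simp
  next
    case False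
    show ?thesis
    proof (rule nondegenerate[OF _ False])
      show "act (ap t x) t' + act (ap t' x) t \<in> Ls"
        by (intro subspace_add subspace_Ls act_Ls t)
      show "ap (act (ap t x) t' + act (ap t' x) t) x y = 0" for y
        by (simp add: ap_act[OF ap_bilinear(3)] L_self t Ls_L)
    qed
  qed
  then show ?thesis by (rule eq_neg_iff_add_eq_0[THEN iffD2])
qed

lemma act_self: "t \<in> Ls \<Longrightarrow> act (ap t x) t = 0"
  by (rule eq_neg_self_imp_0[OF act_swap])

lemma jacobi: "t \<in> Ls \<Longrightarrow> ap t x (ap t y z) = ap t (ap t x y) z + ap t y (ap t x z)"
  using act_self[of t x] ap_act[OF ap_bilinear(3), of t x t y z] by (simp add: algebra_simps)

lemma lie_br_ap: "t \<in> Ls \<Longrightarrow> lie_br (ap t x) (ap t y) = ap t (ap t x y)"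
  using jacobi[of t x y] by (simp add: lie_br_def fun_eq_iff)

lemma minimal_tensor_Ls: "t \<in> Ls \<Longrightarrow> t \<noteq> 0 \<Longrightarrow> minimal_tensor G t"
  using Ls_ker[of t] minimal by unfold_locales (auto simp: Ls_L K_def)

text \<open>If \<open>W\<close> were a proper ideal with orthogonal projection \<open>\<pi>\<close>, then \<open>x \<mapsto> br (\<pi> x)\<close> would be a
  tensor with a larger kernel.\<close>

lemma ideal_eq_s:
  assumes W: "subspace W" "W \<subseteq> s" "w0 \<in> W" "w0 \<noteq> 0" and ideal: "\<And>x w. w \<in> W \<Longrightarrow> br x w \<in> W"
  shows "W = s"
proof (rule ccontr)
  assume "W \<noteq> s"
  then obtain x where x: "x \<in> s" "x \<notin> W" using W(2) by blast
  obtain \<pi> where \<pi>: "linear \<pi>" "\<And>x. \<pi> x \<in> W" "\<And>x. x \<in> W \<Longrightarrow> \<pi> x = x"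
    "\<And>x y. \<pi> x \<bullet> y = x \<bullet> \<pi> y" "\<And>x w. w \<in> W \<Longrightarrow> (x - \<pi> x) \<bullet> w = 0"
    using orthogonal_projection_exists[OF W(1)] by metis
  define t where "t = enc (\<lambda>x y. br (\<pi> x) y)"
  have t: "ap t x y = br (\<pi> x) y" for x y
    unfolding t_def
    by (rule ap_enc) (auto intro!: linearI simp: linear_add[OF \<pi>(1)] linear_scale[OF \<pi>(1)])
  \<comment> \<open>Skewness turns the square of the norm of [w, u] into the negative of the product
    of \<open>u\<close> with [w, [w, u]], which lies in \<open>W\<close>.\<close>
  have orth: "br w u = 0" if w: "w \<in> W" and u: "\<And>v. v \<in> W \<Longrightarrow> u \<bullet> v = 0" for w u
  proof -
    have "br w u \<in> W" using ideal[OF w, of u] L_swap[OF T_L, of w u] W(1) by (simp add: subspace_neg)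
    then have "u \<bullet> br w (br w u) = 0" using u ideal by blast
    then show ?thesis using L_skew[OF T_L, of w u "br w u"] by simp
  qed
  have proj: "br (\<pi> x) y = br (\<pi> x) (\<pi> y)" for x y
    using orth[OF \<pi>(2), of "y - \<pi> y" x] \<pi>(5) by simp
  have "t \<in> L"
  proof (rule LI)
    have "ap t x = br (\<pi> x)" for x using t by auto
    then show "ap t x \<in> G" for x using L_G[OF T_L] by simp
    show "ap t x y = - ap t y x" for x y
      using proj[of x y] proj[of y x] L_swap[OF T_L, of "\<pi> x" "\<pi> y"] by (simp add: t)
  qed
  moreover have "K \<subseteq> ker t"
  proof
    fix z assume "z \<in> K"
    then have "\<pi> z \<bullet> \<pi> z = 0"
      using \<pi>(2)[of z] \<pi>(3)[OF \<pi>(2), of z] \<pi>(4)[of z "\<pi> z"] W(2)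
      by (auto simp: s_def inner_commute)
    then show "z \<in> ker t" by (simp add: ker_def t)
  qed
  ultimately have "t \<in> Ls" by (simp add: Ls_def)
  moreover have "x - \<pi> x \<notin> K"
    using x W \<pi>(2)[of x] s_K[of "x - \<pi> x"] subspace_diff[OF subspace_s] by auto
  moreover have "ap t (x - \<pi> x) y = 0" for y
    using \<pi>(3)[OF \<pi>(2)] by (simp add: t linear_diff[OF \<pi>(1)])
  ultimately have "t = 0" by (rule nondegenerate)
  then have "br w0 y = 0" for y using t[of w0 y] \<pi>(3)[OF W(3)] by simp
  then have "w0 \<in> K" by (simp add: K_def ker_def)
  then show False using s_K W by blast
qed

lemma br_nonzero: "x \<in> s \<Longrightarrow> x \<noteq> 0 \<Longrightarrow> \<exists>y. br x y \<noteq> 0"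
  using s_K[of x] by (auto simp: K_def ker_def)

lemma br_values_nonzero: obtains x y where "br x y \<noteq> 0"
  using T_nz tensor_eqI[of T 0] by auto

text \<open>The brackets span a nonzero ideal. That \<open>s\<close> is perfect is what later forces
  operators commuting with \<open>s\<close> to be symmetric.\<close>

lemma span_br: "span {br x y |x y. True} = s"
proof -
  obtain x y where xy: "br x y \<noteq> 0" by (rule br_values_nonzero)
  have "{br x y |x y. True} \<subseteq> s" using Ls_values[OF T_Ls] by auto
  then have sub: "span {br x y |x y. True} \<subseteq> s" using subspace_s by (simp add: span_minimal)
  show ?thesis by (rule ideal_eq_s[OF _ sub _ xy]) (auto intro: span_base)
qed

section \<open>Trace form, inner derivations and commutant of s\<close>

lemma frob_br_invariant:
  assumes "t \<in> Ls"
  shows "frob (ap t (ap t z x)) (ap t y) = - frob (ap t x) (ap t (ap t z y))"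
proof -
  note so = G_so[OF L_G[OF Ls_L[OF assms]]]
  have "ap t z x = - ap t x z" by (rule L_swap[OF Ls_L[OF assms]])
  then have "frob (ap t (ap t z x)) (ap t y) = - frob (ap t (ap t x z)) (ap t y)"
    by (simp add: frob_def sum_negf)
  also have "\<dots> = - frob (lie_br (ap t x) (ap t z)) (ap t y)" by (simp only: lie_br_ap[OF assms])
  also have "\<dots> = - frob (ap t x) (ap t (ap t z y))" by (simp only: frob_lie_br[OF so so so], simp only: lie_br_ap[OF assms])
  finally show ?thesis .
qed

text \<open>\<open>R\<close> is the Casimir operator with the sign that makes it nonnegative. It is
  symmetric and commutes with every \<open>br z\<close>, so an eigenspace in \<open>s\<close> is an
  ideal and hence all of \<open>s\<close>.\<close>

lemma frob_T_scalar: "\<exists>c. \<forall>x\<in>s. \<forall>y\<in>s. frob (br x) (br y) = c * (x \<bullet> y)"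
proof -
  define R where "R x = - (\<Sum>b\<in>Basis. br b (br b x))" for x
  have lin: "linear R"
    by (rule linearI) (auto simp: R_def sum.distrib scaleR_sum_right sum_negf)
  have R: "R x \<bullet> y = frob (br x) (br y)" for x y
  proof -
    have "frob (br x) (br y) = (\<Sum>b\<in>Basis. br b x \<bullet> br b y)"
      unfolding frob_def
    proof (intro sum.cong refl)
      show "br x b \<bullet> br y b = br b x \<bullet> br b y" for b
        using L_swap[OF T_L, of x b] L_swap[OF T_L, of y b] by simp
    qed
    also have "\<dots> = R x \<bullet> y"
    proof -
      have "br b x \<bullet> br b y = - (br b (br b x) \<bullet> y)" for b using L_skew[OF T_L, of b "br b x" y] by simp
      then show ?thesis by (simp add: R_def inner_sum_left sum_negf)
    qed
    finally show ?thesis by simp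
  qed
  have comm: "R (br z x) = br z (R x)" for z x
  proof -
    have "R (br z x) \<bullet> y = br z (R x) \<bullet> y" for y
      using frob_br_invariant[OF T_Ls, of z x y] by (simp add: R L_skew[OF T_L])
    then show ?thesis by (metis inner_commute vector_eq_ldot)
  qed
  have Rs: "R x \<in> s" for x
    unfolding R_def by (intro subspace_neg subspace_sum subspace_s Ls_values T_Ls)
  obtain x1 y1 where "br x1 y1 \<noteq> 0" by (rule br_values_nonzero)
  then obtain x c where x: "x \<in> s" "norm x = 1" "R x = c *\<^sub>R x"
    using symmetric_eigenvector[OF lin subspace_s Rs _ Ls_values[OF T_Ls], of x1 y1]
    by (metis R frob_commute inner_commute)
  have "{x \<in> s. R x = c *\<^sub>R x} = s"
  proof (rule ideal_eq_s)
    show "subspace {x \<in> s. R x = c *\<^sub>R x}"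
      using subspace_s
      by (auto simp: subspace_def linear_add[OF lin] linear_scale[OF lin] linear_0[OF lin] scaleR_right_distrib)
    show "x \<in> {x \<in> s. R x = c *\<^sub>R x}" "x \<noteq> 0" using x by auto
  qed (auto simp: comm Ls_values T_Ls)
  then have "frob (br x) (br y) = c * (x \<bullet> y)" if "x \<in> s" for x y
  proof -
    have "R x = c *\<^sub>R x" using that \<open>_ = s\<close> by blast
    then show ?thesis using R[of x y] by simp
  qed
  then show ?thesis by blast
qed

lemma frob_Ls_scalar:
  assumes "t \<in> Ls"
  shows "\<exists>c. \<forall>x\<in>s. \<forall>y\<in>s. frob (ap t x) (ap t y) = c * (x \<bullet> y)"
proof (cases "t = 0")
  case True
  then have "frob (ap t x) (ap t y) = 0 * (x \<bullet> y)" for x y by (simp add: frob_def)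
  then show ?thesis by blast
next
  case False
  interpret t: minimal_tensor G t by (rule minimal_tensor_Ls[OF assms False])
  have "t.s = s" using Ls_ker[OF assms False] by (simp add: t.s_def s_def t.K_def)
  then show ?thesis using t.frob_T_scalar by simp
qed

text \<open>Tracing the scalar relation determines the scalar: \<open>d\<close> is the trace of the
  projection onto \<open>s\<close>, that is its dimension. Since \<open>d\<close> does not depend on
  \<open>t\<close>, the relation can be polarised in \<open>t\<close>.\<close>

lemma frob_conformal:
  obtains d where "d > 0" "\<And>t x y. t \<in> Ls \<Longrightarrow> x \<in> s \<Longrightarrow> y \<in> s \<Longrightarrow> frob (ap t x) (ap t y) = (t \<bullet> t) / d * (x \<bullet> y)"
proof -
  obtain \<pi> where \<pi>: "linear \<pi>" "\<And>x. \<pi> x \<in> s" "\<And>x. x \<in> s \<Longrightarrow> \<pi> x = x"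
    "\<And>x y. \<pi> x \<bullet> y = x \<bullet> \<pi> y" "\<And>x w. w \<in> s \<Longrightarrow> (x - \<pi> x) \<bullet> w = 0"
    using orthogonal_projection_exists[OF subspace_s] by metis
  define d where "d = (\<Sum>b\<in>Basis. \<pi> b \<bullet> \<pi> b)"
  have K: "x - \<pi> x \<in> K" for x
  proof -
    obtain y z where yz: "x = y + z" "y \<in> s" "z \<in> K" by (rule s_K_decomposition)
    have "z - \<pi> z \<in> K" if "z \<in> K" for z
    proof -
      have "\<pi> z \<bullet> \<pi> z = 0"
        using \<pi>(2)[of z] \<pi>(3)[OF \<pi>(2), of z] \<pi>(4)[of z "\<pi> z"] that by (auto simp: s_def inner_commute)
      then show ?thesis using that by simp
    qed
    then show ?thesis using yz by (simp add: linear_add[OF \<pi>(1)] \<pi>(3))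
  qed
  have tt: "t \<bullet> t = c * d" if t: "t \<in> Ls" and c: "\<forall>x\<in>s. \<forall>y\<in>s. frob (ap t x) (ap t y) = c * (x \<bullet> y)" for t c
  proof -
    have "ap t b = ap t (\<pi> b)" for b
      using Ls_K(1)[OF t K[of b]] by auto
    then have "t \<bullet> t = (\<Sum>b\<in>Basis. frob (ap t (\<pi> b)) (ap t (\<pi> b)))"
      by (simp add: inner_tensor frob_def)
    then show ?thesis using c \<pi>(2) by (simp add: d_def sum_distrib_left)
  qed
  have "d \<ge> 0" by (simp add: d_def sum_nonneg)
  moreover have "d \<noteq> 0"
  proof
    assume "d = 0"
    then have "T \<bullet> T = 0" using tt[OF T_Ls] frob_T_scalar by fastforce
    then show False using T_nz by simp
  qed
  ultimately have d: "d > 0" by simp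
  show ?thesis
  proof (rule that[OF d])
    fix t x y assume t: "t \<in> Ls" and xy: "x \<in> s" "y \<in> s"
    obtain c where c: "\<forall>x\<in>s. \<forall>y\<in>s. frob (ap t x) (ap t y) = c * (x \<bullet> y)"
      using frob_Ls_scalar[OF t] by blast
    then show "frob (ap t x) (ap t y) = (t \<bullet> t) / d * (x \<bullet> y)" using xy tt[OF t c] d by simp
  qed
qed

lemma frob_br:
  obtains k where "k > 0" "\<And>x y. x \<in> s \<Longrightarrow> y \<in> s \<Longrightarrow> frob (br x) (br y) = k * (x \<bullet> y)"
proof -
  obtain d where d: "d > 0" "\<And>t x y. t \<in> Ls \<Longrightarrow> x \<in> s \<Longrightarrow> y \<in> s \<Longrightarrow> frob (ap t x) (ap t y) = (t \<bullet> t) / d * (x \<bullet> y)"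
    using frob_conformal by blast
  show ?thesis by (rule that[of "T \<bullet> T / d"]) (use d T_nz T_Ls in auto)
qed

text \<open>Polarisation of \<open>frob_conformal\<close> at \<open>T + Q\<close>: the squared norm
  of the tensor is additive there, so the mixed term must vanish.\<close>

lemma frob_orthogonal_tensor:
  assumes Q: "Q \<in> Ls" "Q \<bullet> T = 0" and x: "x \<in> s"
  shows "frob (ap Q x) (br x) = 0"
proof -
  obtain d where d: "d > 0" "\<And>t x y. t \<in> Ls \<Longrightarrow> x \<in> s \<Longrightarrow> y \<in> s \<Longrightarrow> frob (ap t x) (ap t y) = (t \<bullet> t) / d * (x \<bullet> y)"
    using frob_conformal by blast
  have "frob (ap (T + Q) x) (ap (T + Q) x)
      = frob (br x) (br x) + frob (ap Q x) (ap Q x) + 2 * frob (ap Q x) (br x)"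
    by (simp add: frob_def inner_add_left inner_add_right sum.distrib inner_commute
        sum_distrib_left)
  moreover have "(T + Q) \<bullet> (T + Q) = T \<bullet> T + Q \<bullet> Q"
    using Q(2) by (simp add: inner_add_left inner_add_right inner_commute)
  moreover have "T + Q \<in> Ls" by (intro subspace_add subspace_Ls T_Ls Q)
  ultimately show ?thesis
    using d(2)[OF _ x x, of T] d(2)[OF _ x x, of Q] d(2)[OF _ x x, of "T + Q"] Q T_Ls
    by (simp add: add_divide_distrib distrib_right)
qed

text \<open>The Killing form argument. Let \<open>y\<close> represent the functional x ->
  \<open>frob D (br x)\<close>; then E = D - \<open>br y\<close> is trace-orthogonal to all
  \<open>br x\<close>. Because \<open>br (E x)\<close> is the commutator of \<open>E\<close> and
  \<open>br x\<close>, invariance turns the squared norm of \<open>br (E x)\<close> into the pairing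
  of \<open>E\<close> with an inner derivation, which is zero.\<close>

lemma derivation_inner:
  assumes D: "so_V D" "\<And>x. D x \<in> s" "\<And>z. z \<in> K \<Longrightarrow> D z = 0" and der: "act D T = 0"
  obtains y where "y \<in> s" "D = br y"
proof -
  obtain k where k: "k > 0" "\<And>x y. x \<in> s \<Longrightarrow> y \<in> s \<Longrightarrow> frob (br x) (br y) = k * (x \<bullet> y)"
    using frob_br by blast
  define y where "y = (1 / k) *\<^sub>R (\<Sum>b\<in>Basis. frob D (br b) *\<^sub>R b)"
  have lin: "linear (\<lambda>x. frob D (br x))"
    by (rule linearI) (auto simp: frob_def inner_add_right sum.distrib sum_distrib_left)
  have y: "k * (y \<bullet> x) = frob D (br x)" for x
    using k(1) linear_sum_basis[OF lin, of x]
    by (simp add: y_def inner_sum_left inner_commute[of x] mult.commute)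
  have "frob D (br z) = 0" if "z \<in> K" for z using Ls_K(1)[OF T_Ls that] by (simp add: frob_def)
  then have "y \<bullet> z = 0" if "z \<in> K" for z using y[of z] k(1) that by simp
  then have ys: "y \<in> s" by (simp add: s_def)
  define E where "E x = D x - br y x" for x
  have lD: "linear D" by (rule so_V_linear[OF D(1)])
  have lE: "linear E" unfolding E_def by (intro linear_compose_sub lD ap_bilinear)
  have soE: "so_V E"
    using lE D(1) so_V_skew[OF D(1)] L_skew[OF T_L]
    by (simp add: so_V_def E_def inner_diff_left inner_diff_right)
  have E0: "frob E (br x) = 0" if "x \<in> s" for x
  proof -
    have "E = (\<lambda>x. D x - br y x)" by (auto simp: E_def)
    then show ?thesis using y[of x] k(2)[OF ys that] by (simp add: frob_diff)
  qed
  have brE: "br (E x) = lie_br E (br x)" for x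
  proof
    fix w
    have "D (br x w) = br (D x) w + br x (D w)"
      using ap_act[OF lD, of T x w] der by (simp add: algebra_simps)
    then show "br (E x) w = lie_br E (br x) w"
      by (simp add: E_def lie_br_def jacobi[OF T_Ls, of y x w])
  qed
  have Es: "E x \<in> s" for x
    unfolding E_def by (intro subspace_diff subspace_s D Ls_values T_Ls)
  have "E x = 0" for x
  proof -
    have "k * (E x \<bullet> E x) = frob (br (E x)) (br (E x))" using k(2) Es by simp
    also have "\<dots> = frob (lie_br E (br x)) (br (E x))" by (simp only: brE)
    also have "\<dots> = frob E (br (br x (E x)))"
      by (simp add: frob_lie_br soE G_so L_G T_L lie_br_ap T_Ls)
    also have "\<dots> = 0" by (intro E0 Ls_values T_Ls)
    finally show ?thesis using k(1) by simp
  qed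
  then have "D = br y" by (auto simp: E_def)
  then show ?thesis using that ys by blast
qed

text \<open>Invariance of the inner product and the freedom to move \<open>N\<close> between the two
  factors of a bracket make \<open>N\<close> symmetric against brackets, and these span
  \<open>s\<close>. A symmetric operator has an eigenspace, which is then an ideal.\<close>

lemma commutant_scalar:
  assumes N: "linear N" "\<And>x. x \<in> s \<Longrightarrow> N x \<in> s"
    and comm: "\<And>x y. x \<in> s \<Longrightarrow> y \<in> s \<Longrightarrow> N (br x y) = br x (N y)"
  obtains c where "\<And>x. x \<in> s \<Longrightarrow> N x = c *\<^sub>R x"
proof -
  note sw = L_swap[OF T_L] and sk = L_skew[OF T_L]
  \<comment> \<open>\<open>comm\<close> is assumed only for arguments in \<open>s\<close>, so other
    arguments of \<open>br\<close> are first replaced by their components in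
    \<open>s\<close>.\<close>
  have red: "\<exists>x'\<in>s. \<forall>y. br x y = br x' y" for x
  proof -
    obtain y z where "x = y + z" "y \<in> s" "z \<in> K" by (rule s_K_decomposition)
    then show ?thesis by (auto intro!: bexI[of _ y] simp: Ls_K(1)[OF T_Ls])
  qed
  have sym1: "N x \<bullet> br y z = x \<bullet> N (br y z)" if "x \<in> s" "y \<in> s" "z \<in> s" for x y z
  proof -
    have "x \<bullet> N (br y z) = - (x \<bullet> br z (N y))"
      using comm[of z y] that sw[of y z] by (simp add: linear_neg[OF N(1)])
    also have "\<dots> = x \<bullet> br (N y) z" using sw[of z "N y"] by simp
    also have "\<dots> = - (br (N y) x \<bullet> z)" using sk[of "N y" x z] by simp
    also have "\<dots> = N (br x y) \<bullet> z" using sw[of "N y" x] comm[of x y] that by simp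
    also have "\<dots> = - (br y (N x) \<bullet> z)"
      using comm[of y x] that sw[of x y] by (simp add: linear_neg[OF N(1)])
    also have "\<dots> = N x \<bullet> br y z" using sk[of y "N x" z] by simp
    finally show ?thesis by simp
  qed
  have sym2: "N x \<bullet> br y z = x \<bullet> N (br y z)" if x: "x \<in> s" for x y z
  proof -
    obtain y' where y': "y' \<in> s" "\<And>w. br y w = br y' w" using red[of y] by auto
    obtain z' where z': "z' \<in> s" "\<And>w. br z w = br z' w" using red[of z] by auto
    have "br y z = br y' z'" using y'(2)[of z] sw[of y' z] sw[of y' z'] z'(2)[of y'] by simp
    then show ?thesis using sym1[OF x y'(1) z'(1)] by simp
  qed
  have "N x \<bullet> y = x \<bullet> N y" if x: "x \<in> s" and y: "y \<in> s" for x y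
  proof -
    have "y \<in> span {br x y |x y. True}" using y span_br by simp
    then show ?thesis
    proof (rule span_induct)
      show "subspace {y. N x \<bullet> y = x \<bullet> N y}"
        by (auto simp: subspace_def inner_add_right linear_add[OF N(1)] linear_scale[OF N(1)] linear_0[OF N(1)])
    qed (use sym2[OF x] in auto)
  qed
  note sym = this
  obtain x1 y1 where "br x1 y1 \<noteq> 0" by (rule br_values_nonzero)
  then obtain x c where x: "x \<in> s" "norm x = 1" "N x = c *\<^sub>R x"
    using symmetric_eigenvector[OF N(1) subspace_s N(2) sym Ls_values[OF T_Ls], of x1 y1] by metis
  have "{x \<in> s. N x = c *\<^sub>R x} = s"
  proof (rule ideal_eq_s)
    show "subspace {x \<in> s. N x = c *\<^sub>R x}"
      using subspace_s
      by (auto simp: subspace_def linear_add[OF N(1)] linear_scale[OF N(1)] linear_0[OF N(1)] scaleR_right_distrib)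
    show "x \<in> {x \<in> s. N x = c *\<^sub>R x}" "x \<noteq> 0" using x by auto
    show "br x w \<in> {x \<in> s. N x = c *\<^sub>R x}" if w: "w \<in> {x \<in> s. N x = c *\<^sub>R x}" for x w
    proof -
      obtain x' where "x' \<in> s" "br x w = br x' w" using red[of x] by auto
      then show ?thesis using w comm[of x' w] Ls_values[OF T_Ls, of x w] by simp
    qed
  qed auto
  then show ?thesis using that[of c] by blast
qed

end

section \<open>Rank one\<close>

text \<open>The bivector of x and y as an endomorphism; by \<open>lie_br_rot\<close>, bracketing
  with a skew map acts on it by the Leibniz rule.\<close>

definition rot :: "'a::euclidean_space \<Rightarrow> 'a \<Rightarrow> 'a \<Rightarrow> 'a" where
  "rot x y w = (x \<bullet> w) *\<^sub>R y - (y \<bullet> w) *\<^sub>R x"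

lemma linear_rot: "linear (rot x y)"
  by (rule linearI) (auto simp: rot_def inner_add_right algebra_simps)

lemma so_V_rot: "so_V (rot x y)"
  unfolding so_V_def
  by (intro conjI allI linear_rot)
    (simp add: rot_def inner_diff_left inner_diff_right inner_commute mult.commute)

lemma rot_add: "rot (x + x') y w = rot x y w + rot x' y w" "rot x (y + y') w = rot x y w + rot x y' w"
  and rot_scale: "rot (c *\<^sub>R x) y w = c *\<^sub>R rot x y w" "rot x (c *\<^sub>R y) w = c *\<^sub>R rot x y w"
  and rot_0: "rot 0 y w = 0" "rot x 0 w = 0"
  and rot_self: "rot x x w = 0"
  and rot_swap: "rot x y w = - rot y x w"
  by (simp_all add: rot_def inner_add_left algebra_simps)

lemma lie_br_rot:
  assumes "so_V A"
  shows "lie_br A (rot x y) w = rot (A x) y w + rot x (A y) w"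
  using so_V_skew[OF assms, of x w] so_V_skew[OF assms, of y w]
  by (simp add: lie_br_def rot_def linear_diff[OF so_V_linear[OF assms]]
      linear_scale[OF so_V_linear[OF assms]] algebra_simps)

lemma ex_orthogonal_unit_vector:
  fixes U :: "'a::euclidean_space set"
  assumes "subspace U" "finite S" "S \<subseteq> U" "card S < dim U"
  obtains v where "v \<in> U" "norm v = 1" "\<And>x. x \<in> S \<Longrightarrow> x \<bullet> v = 0"
proof -
  have "span S \<subseteq> U" using assms by (simp add: span_minimal)
  then have "dim {y \<in> U. \<forall>x\<in>span S. orthogonal x y} + dim (span S) = dim U"
    by (intro dim_subspace_orthogonal_to_vectors assms subspace_span)
  moreover have "dim (span S) \<le> card S" using assms by (simp add: dim_le_card')
  ultimately have "dim {y \<in> U. \<forall>x\<in>span S. orthogonal x y} \<noteq> 0" using assms(4) by linarith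
  then obtain y where y: "y \<in> U" "\<forall>x\<in>span S. orthogonal x y" "y \<noteq> 0"
    by (auto simp: dim_eq_0)
  show ?thesis
    by (rule that[of "(1 / norm y) *\<^sub>R y"])
      (use y assms(1) in \<open>auto simp: subspace_scale orthogonal_def span_base\<close>)
qed

lemma ex_max_dim:
  fixes f :: "'b \<Rightarrow> 'a::euclidean_space set"
  assumes "P x"
  shows "\<exists>x. P x \<and> (\<forall>y. P y \<longrightarrow> dim (f y) \<le> dim (f x))"
proof (rule Lattices_Big.ex_has_greatest_nat)
  show "\<forall>y. P y \<longrightarrow> dim (f y) < DIM('a) + 1"
    using dim_subset_UNIV[of "f _"] by (simp add: less_Suc_eq_le)
qed (rule assms)

section \<open>Orthogonal blocks contained in G\<close>

context lie_so
begin

text \<open>The new space is \<open>U\<close> plus the line through \<open>b\<close>, the component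
  of \<open>A u\<close> normal to \<open>U\<close>. Bracketing \<open>A\<close> with
  \<open>rot x y\<close> and removing the part inside \<open>U\<close> leaves rot (B x) y + rot x (B
  y) in \<open>G\<close>, from which a rotation of \<open>U\<close> isolates rot b w. Dimension
  three leaves room for a unit vector of \<open>U\<close> orthogonal to both \<open>u\<close> and
  \<open>w\<close>.\<close>

lemma so_block_invariant:
  assumes U: "subspace U" "3 \<le> dim U" and rot: "\<And>x y. x \<in> U \<Longrightarrow> y \<in> U \<Longrightarrow> rot x y \<in> G"
    and A: "A \<in> G" and u: "u \<in> U" "A u \<notin> U"
  shows "\<exists>U'. subspace U' \<and> dim U < dim U' \<and> (\<forall>x\<in>U'. \<forall>y\<in>U'. rot x y \<in> G)"
proof -
  obtain \<pi> where \<pi>: "linear \<pi>" "\<And>x. \<pi> x \<in> U" "\<And>x. x \<in> U \<Longrightarrow> \<pi> x = x"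
    "\<And>x y. \<pi> x \<bullet> y = x \<bullet> \<pi> y" "\<And>x w. w \<in> U \<Longrightarrow> (x - \<pi> x) \<bullet> w = 0"
    using orthogonal_projection_exists[OF U(1)] by metis
  define B where "B x = A x - \<pi> (A x)" for x
  have B: "x \<bullet> B y = 0" if "x \<in> U" for x y
    using \<pi>(5)[OF that] by (simp add: B_def inner_commute)
  have C: "(\<lambda>w. rot (B x) y w + rot x (B y) w) \<in> G" if "x \<in> U" "y \<in> U" for x y
  proof -
    have "(\<lambda>w. rot (B x) y w + rot x (B y) w)
        = (\<lambda>w. lie_br A (rot x y) w - (rot (\<pi> (A x)) y w + rot x (\<pi> (A y)) w))"
      unfolding lie_br_rot[OF G_so[OF A]]
      by (simp add: B_def rot_def inner_diff_left algebra_simps)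
    moreover have "\<dots> \<in> G" by (intro G_diff G_add G_br A rot that \<pi>(2))
    ultimately show ?thesis by simp
  qed
  define b where "b = B u"
  have b_U: "x \<bullet> b = 0" if "x \<in> U" for x using B that by (simp add: b_def)
  have b_notin: "b \<notin> U"
  proof
    assume "b \<in> U"
    then have "A u = \<pi> (A u)" using b_U[of b] by (simp add: b_def B_def)
    then show False using \<pi>(2)[of "A u"] u(2) by simp
  qed
  have rot_b_orth: "rot b w \<in> G" if w: "w \<in> U" "w \<bullet> u = 0" for w
  proof -
    have "card {u, w} \<le> 2" by (simp add: card_insert_if)
    then have "card {u, w} < dim U" using U(2) by linarith
    moreover have "finite {u, w}" "{u, w} \<subseteq> U" using u(1) w(1) by auto
    ultimately obtain v where v: "v \<in> U" "norm v = 1" and v': "\<And>x. x \<in> {u, w} \<Longrightarrow> x \<bullet> v = 0"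
      using ex_orthogonal_unit_vector[OF U(1), of "{u, w}"] by metis
    have v'': "u \<bullet> v = 0" "w \<bullet> v = 0" using v'[of u] v'[of w] by simp_all
    \<comment> \<open>\<open>R\<close> sends \<open>v\<close> to \<open>w\<close> and kills
      \<open>u\<close>, \<open>b\<close> and \<open>B v\<close>, so bracketing with rot b v + rot u
      (B v) leaves exactly rot b w.\<close>
    define R where "R = rot v w"
    have R: "R u = 0" "R v = w" "R b = 0" "R (B v) = 0"
      using v v'' w b_U[of v] b_U[of w] B[of v v] B[of w v]
      by (simp_all add: R_def rot_def inner_commute dot_square_norm)
    have "lie_br R (\<lambda>z. rot b v z + rot u (B v) z) \<in> G"
      unfolding R_def b_def by (intro G_br rot C v w u)
    moreover have "lie_br R (\<lambda>z. rot b v z + rot u (B v) z) = rot b w"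
    proof
      fix z
      have "lie_br R (\<lambda>z. rot b v z + rot u (B v) z) z = lie_br R (rot b v) z + lie_br R (rot u (B v)) z"
        by (simp add: lie_br_def R_def linear_add[OF linear_rot])
      also have "\<dots> = rot b w z"
        unfolding lie_br_rot[OF so_V_rot[of v w], folded R_def] by (simp add: R rot_0)
      finally show "lie_br R (\<lambda>z. rot b v z + rot u (B v) z) z = rot b w z" .
    qed
    ultimately show ?thesis by simp
  qed
  have u_nz: "u \<noteq> 0" using u linear_0[OF G_linear[OF A]] by auto
  have rot_b_u: "rot b u \<in> G"
  proof -
    have "card {u} < dim U" using U(2) by simp
    moreover have "finite {u}" "{u} \<subseteq> U" using u(1) by auto
    ultimately obtain w where w: "w \<in> U" "norm w = 1" and w': "\<And>x. x \<in> {u} \<Longrightarrow> x \<bullet> w = 0"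
      using ex_orthogonal_unit_vector[OF U(1), of "{u}"] by metis
    have w'': "u \<bullet> w = 0" using w' by simp
    \<comment> \<open>The direction \<open>u\<close> was excluded so far; rot b u is recovered by
      turning \<open>w\<close> into \<open>u\<close>.\<close>
    have "lie_br (rot w u) (rot b w) \<in> G"
      by (intro G_br rot rot_b_orth w u) (use w'' in \<open>simp add: inner_commute\<close>)
    moreover have "lie_br (rot w u) (rot b w) = rot b u"
    proof
      fix z
      have "rot w u b = 0" "rot w u w = u"
        using w w'' b_U[OF u(1)] b_U[OF w(1)] by (simp_all add: rot_def inner_commute dot_square_norm)
      then show "lie_br (rot w u) (rot b w) z = rot b u z"
        unfolding lie_br_rot[OF so_V_rot] by (simp add: rot_0)
    qed
    ultimately show ?thesis by simp
  qed
  have rot_b: "rot b x \<in> G" if x: "x \<in> U" for x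
  proof -
    define c where "c = (x \<bullet> u) / (u \<bullet> u)"
    have "rot b (x - c *\<^sub>R u) \<in> G"
      by (rule rot_b_orth) (use x u U u_nz in \<open>auto simp: c_def subspace_diff subspace_scale inner_diff_left\<close>)
    then have "(\<lambda>w. rot b (x - c *\<^sub>R u) w + c *\<^sub>R rot b u w) \<in> G"
      by (intro G_add G_scale rot_b_u)
    moreover have "(\<lambda>w. rot b (x - c *\<^sub>R u) w + c *\<^sub>R rot b u w) = rot b x"
      by (rule ext) (simp add: rot_def inner_diff_left algebra_simps)
    ultimately show ?thesis by simp
  qed
  have sU: "span U = U" using U(1) by simp
  have "dim U < dim (span (insert b U))"
    using b_notin by (simp add: dim_insert sU)
  moreover have "rot p q \<in> G" if pq: "p \<in> span (insert b U)" "q \<in> span (insert b U)" for p q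
  proof -
    obtain c where c: "p - c *\<^sub>R b \<in> U" using pq(1) unfolding span_insert sU by blast
    obtain d where d: "q - d *\<^sub>R b \<in> U" using pq(2) unfolding span_insert sU by blast
    define x y where "x = p - c *\<^sub>R b" and "y = q - d *\<^sub>R b"
    have "(\<lambda>w. rot x y w + (c *\<^sub>R rot b y w - d *\<^sub>R rot b x w)) \<in> G"
      using c d by (intro G_add G_diff G_scale rot rot_b) (auto simp: x_def y_def)
    moreover have "(\<lambda>w. rot x y w + (c *\<^sub>R rot b y w - d *\<^sub>R rot b x w)) = rot p q"
    proof
      fix w
      have pq: "p = x + c *\<^sub>R b" "q = y + d *\<^sub>R b" by (simp_all add: x_def y_def)
      show "rot x y w + (c *\<^sub>R rot b y w - d *\<^sub>R rot b x w) = rot p q w"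
        unfolding pq rot_add rot_scale rot_self using rot_swap[of x b w] by simp
    qed
    ultimately show ?thesis by simp
  qed
  ultimately show ?thesis using subspace_span by blast
qed

lemma invariant_so_block:
  assumes "subspace U0" "3 \<le> dim U0" "\<And>x y. x \<in> U0 \<Longrightarrow> y \<in> U0 \<Longrightarrow> rot x y \<in> G"
  obtains U where "subspace U" "3 \<le> dim U" "\<And>x y. x \<in> U \<Longrightarrow> y \<in> U \<Longrightarrow> rot x y \<in> G"
    "\<And>A x. A \<in> G \<Longrightarrow> x \<in> U \<Longrightarrow> A x \<in> U"
proof -
  define P where "P U \<longleftrightarrow> subspace U \<and> 3 \<le> dim U \<and> (\<forall>x\<in>U. \<forall>y\<in>U. rot x y \<in> G)" for U
  have "P U0" using assms by (simp add: P_def)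
  from ex_max_dim[of P, OF this, of "\<lambda>U. U"]  obtain U where U: "P U" "\<And>U'. P U' \<Longrightarrow> dim U' \<le> dim U" by metis
  have "A x \<in> U" if "A \<in> G" "x \<in> U" for A x
  proof (rule ccontr)
    assume "A x \<notin> U"
    then obtain U' where "subspace U'" "dim U < dim U'" "\<forall>x\<in>U'. \<forall>y\<in>U'. rot x y \<in> G"
      using so_block_invariant[of U A x] U(1) \<open>A \<in> G\<close> \<open>x \<in> U\<close> by (auto simp: P_def)
    moreover from this have "P U'" using U(1) by (simp add: P_def)
    ultimately show False using U(2)[of U'] by simp
  qed
  then show ?thesis using that[of U] U(1) by (simp add: P_def)
qed

end

context minimal_tensor
begin

lemma T_self [simp]: "br x x = 0"
  by (rule L_self[OF T_L])

lemma br_swap: "br x y = - br y x"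
  by (rule L_swap[OF T_L])

lemma br_skew: "br x y \<bullet> z = - (y \<bullet> br x z)"
  by (rule L_skew[OF T_L])

lemma br_jacobi: "br x (br y z) = br (br x y) z + br y (br x z)"
  by (rule jacobi[OF T_Ls])

lemma br_s: "br x y \<in> s"
  by (rule Ls_values[OF T_Ls])

lemma so_V_br: "so_V (br x)"
  by (rule G_so[OF L_G[OF T_L]])

lemma br_G: "br x \<in> G"
  by (rule L_G[OF T_L])

text \<open>Taking the smallest eigenvalue of \<open>br u\<close>, the lowering operator of the \<open>so(3)\<close> spanned by
  \<open>u\<close>, \<open>e1\<close>, \<open>e2\<close> kills the bottom eigenvectors \<open>f1\<close>, \<open>f2\<close> on the complement, which contradicts
  their weight being positive.\<close>

lemma rank_one:
  assumes u: "u \<in> s" "norm u = 1" and c: "\<And>x. x \<in> s \<Longrightarrow> br u x = 0 \<Longrightarrow> \<exists>c. x = c *\<^sub>R u"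
  shows "3 \<le> dim s" "\<And>x y. x \<in> s \<Longrightarrow> y \<in> s \<Longrightarrow> rot x y \<in> G"
proof -
  have uu: "u \<bullet> u = 1" using u by (simp add: dot_square_norm)
  define N0 where "N0 = {x \<in> s. x \<bullet> u = 0}"
  have N0: "subspace N0" using subspace_s by (auto simp: N0_def subspace_def inner_add_left)
  have N0_inv: "br u x \<in> N0" for x using br_skew[of u x u] by (simp add: N0_def br_s)
  have "u \<noteq> 0" using u(2) by auto
  then obtain y where "br u y \<noteq> 0" using br_nonzero[OF u(1)] by blast
  then obtain e1 a where e1: "e1 \<in> N0" "norm e1 = 1" "a \<ge> 0" "br u (br u e1) = - (a\<^sup>2) *\<^sub>R e1"
    and amin: "\<And>y. y \<in> N0 \<Longrightarrow> a * norm y \<le> norm (br u y)"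
    using skew_bottom_eigenvector[OF so_V_br[of u] N0 N0_inv N0_inv[of y]] by metis
  have a: "a > 0"
  proof (rule ccontr)
    assume "\<not> a > 0"
    then have "br u e1 = 0" using e1 skew_square_zero[OF so_V_br] by simp
    then obtain c where "e1 = c *\<^sub>R u" using c[of e1] e1(1) by (auto simp: N0_def)
    then show False using e1(1,2) uu by (auto simp: N0_def)
  qed
  define e2 where "e2 = (1 / a) *\<^sub>R br u e1"
  have ue1: "br u e1 = a *\<^sub>R e2" using a by (simp add: e2_def)
  have ue2: "br u e2 = - a *\<^sub>R e1" using a e1(4) by (simp add: e2_def power2_eq_square)
  have e2s: "e2 \<in> N0" unfolding e2_def by (intro subspace_scale N0 N0_inv)
  have ons: "e1 \<bullet> e1 = 1" "e1 \<bullet> u = 0" "e2 \<bullet> u = 0" "u \<bullet> e1 = 0" "u \<bullet> e2 = 0"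
    using e1 e2s by (auto simp: N0_def dot_square_norm inner_commute)
  have e22: "e2 \<bullet> e2 = 1"
  proof -
    have "a * (e2 \<bullet> e2) = br u e1 \<bullet> e2" by (simp add: ue1)
    also have "\<dots> = a" using br_skew[of u e1 e2] by (simp add: ue2 ons)
    finally show ?thesis using a by simp
  qed
  have e12: "e1 \<bullet> e2 = 0" "e2 \<bullet> e1 = 0"
    using br_skew[of u e1 e1] a by (auto simp: ue1 inner_commute)
  \<comment> \<open>The bracket of the root pair has weight zero, so it centralises \<open>u\<close>
    and is a multiple of it; pairing with \<open>u\<close> will give the factor
    \<open>a\<close>.\<close>
  have "br u (br e1 e2) = 0" using br_jacobi[of u e1 e2] by (simp add: ue1 ue2)
  then obtain k where k: "br e1 e2 = k *\<^sub>R u" using c[OF br_s] by blast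
  have "k = br e1 e2 \<bullet> u" by (simp add: k uu)
  also have "\<dots> = e2 \<bullet> br u e1" using br_skew[of e1 e2 u] br_swap[of e1 u] by simp
  finally have ee: "br e1 e2 = a *\<^sub>R u" using k by (simp add: ue1 e22)
  have e1u: "br e1 u = - a *\<^sub>R e2" using br_swap[of e1 u] ue1 by simp
  have e2u: "br e2 u = a *\<^sub>R e1" using br_swap[of e2 u] ue2 by simp
  have e21: "br e2 e1 = - a *\<^sub>R u" using br_swap[of e2 e1] ee by simp
  define N where "N = {x \<in> s. x \<bullet> u = 0 \<and> x \<bullet> e1 = 0 \<and> x \<bullet> e2 = 0}"
  have N: "subspace N" using subspace_s by (auto simp: N_def subspace_def inner_add_left)
  have N_inv: "br u x \<in> N" "br e1 x \<in> N" "br e2 x \<in> N" if "x \<in> N" for x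
    using that by (auto simp: N_def br_s br_skew[of _ x] ue1 ue2 ee e1u e2u e21)
  have "N = {0}"
  proof (rule ccontr)
    assume "N \<noteq> {0}"
    then obtain z where z: "z \<in> N" "z \<noteq> 0" using subspace_0[OF N] by blast
    obtain f1 b where f1: "f1 \<in> N" "norm f1 = 1" "b \<ge> 0" "br u (br u f1) = - (b\<^sup>2) *\<^sub>R f1"
      and bmin: "\<And>y. y \<in> N \<Longrightarrow> b * norm y \<le> norm (br u y)"
      using skew_bottom_eigenvector[OF so_V_br[of u] N N_inv(1) z] by metis
    have "(norm (br u f1))\<^sup>2 = b\<^sup>2"
      using br_skew[of u f1 "br u f1"] f1 by (simp add: dot_square_norm)
    then have "norm (br u f1) = b" using f1(3) by (simp add: power2_eq_iff_nonneg)
    then have b: "a \<le> b" using amin[of f1] f1 by (simp add: N_def N0_def)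
    define f2 where "f2 = (1 / b) *\<^sub>R br u f1"
    have uf1: "br u f1 = b *\<^sub>R f2" using a b by (simp add: f2_def)
    have uf2: "br u f2 = - b *\<^sub>R f1" using a b f1(4) by (simp add: f2_def power2_eq_square)
    have f2: "f2 \<in> N" unfolding f2_def by (intro subspace_scale N N_inv f1)
    \<comment> \<open>With f = f1 - i f2 and e' = e1 + i e2 one has [e', f] = p + i q. Here
      \<open>u\<close> rotates with speed b - a < b, less than the smallest eigenvalue on
      \<open>N\<close> permits.\<close>
    define p q where "p = br e1 f1 + br e2 f2" and "q = br e2 f1 - br e1 f2"
    have pq: "p \<in> N" "q \<in> N"
      unfolding p_def q_def by (intro subspace_add subspace_diff N N_inv f1 f2)+
    have "br u p = (a - b) *\<^sub>R q" "br u q = (b - a) *\<^sub>R p"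
      unfolding p_def q_def ap_simps br_jacobi[of u] ue1 ue2 uf1 uf2 by (simp_all add: algebra_simps)
    then have est: "b * norm p \<le> (b - a) * norm q" "b * norm q \<le> (b - a) * norm p"
      using bmin[OF pq(1)] bmin[OF pq(2)] b abs_of_nonneg[of "b - a"] abs_minus_commute[of a b] by simp_all
    have "b * (norm p + norm q) \<le> (b - a) * (norm p + norm q)"
      using est by (simp add: distrib_left)
    then have "a * (norm p + norm q) \<le> 0" by (simp add: algebra_simps)
    then have "norm p + norm q \<le> 0" using a by (simp add: mult_le_0_iff)
    then have "norm p = 0" "norm q = 0" using norm_ge_zero[of p] norm_ge_zero[of q] by linarith+
    then have "p = 0" "q = 0" by simp_all
    then have rel: "br e2 f1 = br e1 f2" "br e1 f1 = - br e2 f2"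
      by (auto simp: p_def q_def eq_neg_iff_add_eq_0)
    \<comment> \<open>The relation [e1, e2] = a u, applied to \<open>f1\<close> and paired with
      \<open>f2\<close>, equates a positive number with minus a sum of squares.\<close>
    have "br (br e1 e2) f1 \<bullet> f2 = a * b * (f2 \<bullet> f2)" by (simp add: ee uf1)
    moreover have "br (br e1 e2) f1 = br e1 (br e2 f1) - br e2 (br e1 f1)"
      using br_jacobi[of e1 e2 f1] by simp
    moreover have "br e1 (br e2 f1) \<bullet> f2 = - (br e1 f2 \<bullet> br e1 f2)"
      using br_skew[of e1 "br e2 f1" f2] by (simp add: rel)
    moreover have "br e2 (br e1 f1) \<bullet> f2 = br e2 f2 \<bullet> br e2 f2"
      using br_skew[of e2 "br e1 f1" f2] by (simp add: rel)
    moreover have "br e1 f2 \<bullet> br e1 f2 \<ge> 0" "br e2 f2 \<bullet> br e2 f2 \<ge> 0" by (rule inner_ge_zero)+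
    ultimately have "a * b * (f2 \<bullet> f2) \<le> 0"
      by (simp add: inner_diff_left del: inner_ge_zero)
    moreover have "f2 \<noteq> 0" using uf2 f1(2) a b by auto
    then have "f2 \<bullet> f2 > 0" by simp
    then have "a * b * (f2 \<bullet> f2) > 0" using a b by simp
    ultimately show False by linarith
  qed
  then have expand: "x = (x \<bullet> u) *\<^sub>R u + (x \<bullet> e1) *\<^sub>R e1 + (x \<bullet> e2) *\<^sub>R e2" if "x \<in> s" for x
  proof -
    have "x - ((x \<bullet> u) *\<^sub>R u + (x \<bullet> e1) *\<^sub>R e1 + (x \<bullet> e2) *\<^sub>R e2) \<in> N"
      using that u e1(1) e2s subspace_s
      by (auto simp: N_def N0_def inner_diff_left inner_add_left uu ons e22 e12
          intro!: subspace_diff subspace_add subspace_scale)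
    then show ?thesis using \<open>N = {0}\<close> by simp
  qed
  have rots: "rot e1 e2 \<in> G" "rot e2 u \<in> G" "rot u e1 \<in> G"
  proof -
    have *: "rot x y \<in> G" if "\<And>w. br z w = a *\<^sub>R rot x y w" for x y z
    proof -
      have "(\<lambda>w. (1 / a) *\<^sub>R br z w) \<in> G" by (intro G_scale br_G)
      moreover have "(\<lambda>w. (1 / a) *\<^sub>R br z w) = rot x y" using a that by auto
      ultimately show ?thesis by simp
    qed
    have "br u w = a *\<^sub>R rot e1 e2 w" for w
      using expand[OF br_s[of u w]] br_skew[of u w u] br_skew[of u w e1] br_skew[of u w e2]
      by (simp add: ue1 ue2 rot_def inner_commute[of w] algebra_simps)
    then show "rot e1 e2 \<in> G" by (rule *)
    have "br e1 w = a *\<^sub>R rot e2 u w" for w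
      using expand[OF br_s[of e1 w]] br_skew[of e1 w u] br_skew[of e1 w e1] br_skew[of e1 w e2]
      by (simp add: e1u ee rot_def inner_commute[of w] algebra_simps)
    then show "rot e2 u \<in> G" by (rule *)
    have "br e2 w = a *\<^sub>R rot u e1 w" for w
      using expand[OF br_s[of e2 w]] br_skew[of e2 w u] br_skew[of e2 w e1] br_skew[of e2 w e2]
      by (simp add: e2u e21 rot_def inner_commute[of w] algebra_simps)
    then show "rot u e1 \<in> G" by (rule *)
  qed
  show "rot x y \<in> G" if "x \<in> s" "y \<in> s" for x y
  proof -
    define x0 x1 x2 y0 y1 y2 where d: "x0 = x \<bullet> u" "x1 = x \<bullet> e1" "x2 = x \<bullet> e2" "y0 = y \<bullet> u" "y1 = y \<bullet> e1" "y2 = y \<bullet> e2"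
    have xy: "x = x0 *\<^sub>R u + x1 *\<^sub>R e1 + x2 *\<^sub>R e2" "y = y0 *\<^sub>R u + y1 *\<^sub>R e1 + y2 *\<^sub>R e2"
      using expand[OF that(1)] expand[OF that(2)] by (simp_all add: d)
    have "(\<lambda>w. (x1 * y2 - x2 * y1) *\<^sub>R rot e1 e2 w + ((x2 * y0 - x0 * y2) *\<^sub>R rot e2 u w
        + (x0 * y1 - x1 * y0) *\<^sub>R rot u e1 w)) \<in> G"
      by (intro G_add G_scale rots)
    moreover have "(\<lambda>w. (x1 * y2 - x2 * y1) *\<^sub>R rot e1 e2 w + ((x2 * y0 - x0 * y2) *\<^sub>R rot e2 u w
        + (x0 * y1 - x1 * y0) *\<^sub>R rot u e1 w)) = rot x y"
    proof
      fix w
      show "(x1 * y2 - x2 * y1) *\<^sub>R rot e1 e2 w + ((x2 * y0 - x0 * y2) *\<^sub>R rot e2 u w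
        + (x0 * y1 - x1 * y0) *\<^sub>R rot u e1 w) = rot x y w"
        unfolding xy rot_add rot_scale rot_self
        unfolding rot_swap[of e2 e1] rot_swap[of u e2] rot_swap[of e1 u]
        by (simp add: algebra_simps)
    qed
    ultimately show ?thesis by simp
  qed
  show "3 \<le> dim s"
  proof -
    have ne: "u \<noteq> e1" "u \<noteq> e2" "e1 \<noteq> e2" "u \<noteq> 0" "e1 \<noteq> 0" "e2 \<noteq> 0" using ons uu e12 e22 by auto
    have "pairwise orthogonal {u, e1, e2}" using ons e12 by (auto simp: pairwise_def orthogonal_def)
    then have "independent {u, e1, e2}" using ne by (intro pairwise_orthogonal_independent) auto
    moreover have "{u, e1, e2} \<subseteq> s" using u e1(1) e2s by (auto simp: N0_def)
    ultimately have "card {u, e1, e2} \<le> dim s" by (intro independent_card_le_dim)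
    then show ?thesis using ne by simp
  qed
qed

end

section \<open>Root spaces of a second tensor\<close>

context minimal_tensor
begin

lemma br_inject: "x \<in> s \<Longrightarrow> y \<in> s \<Longrightarrow> br x = br y \<Longrightarrow> x = y"
  using s_K[of "x - y"] subspace_diff[OF subspace_s, of x y] by (auto simp: K_def ker_def)

lemma ap_act_br: "ap (act (br x) t) y z = br x (ap t y z) - ap t (br x y) z - ap t y (br x z)"
  by (rule ap_act[OF ap_bilinear(3)])

lemma act_br_lin: "act (br (x + y)) t = act (br x) t + act (br y) t"
  "act (br (c *\<^sub>R x)) t = c *\<^sub>R act (br x) t" "act (br (x - y)) t = act (br x) t - act (br y) t"
  "act (br (- x)) t = - act (br x) t"
  by (auto intro!: tensor_eqI simp: ap_act_br algebra_simps)

lemma linear_act_br: "linear (act (br x))"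
  by (intro linear_act ap_bilinear)

lemmas act_br_lin2 = linear_add[OF linear_act_br] linear_diff[OF linear_act_br]
  linear_scale[OF linear_act_br] linear_0[OF linear_act_br] linear_neg[OF linear_act_br]

lemma act_br_br: "act (br x) (act (br y) t) = act (br (br x y)) t + act (br y) (act (br x) t)"
  using act_lie_br[OF ap_bilinear(3) ap_bilinear(3), of T x T y t] by (simp add: lie_br_ap[OF T_Ls])

lemma act_br_Ls: "t \<in> Ls \<Longrightarrow> act (br x) t \<in> Ls"
  by (rule act_Ls[OF T_Ls])

text \<open>By \<open>act_swap\<close>, invariance of \<open>t\<close> under \<open>x\<close> means
  that the contraction of \<open>t\<close> with \<open>x\<close> is a derivation of
  \<open>T\<close>.\<close>

lemma invariant_contraction_inner:
  assumes "t \<in> Ls" "act (br x) t = 0"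
  obtains y where "y \<in> s" "ap t x = br y"
proof -
  have "act (ap t x) T = 0" using act_swap[OF assms(1) T_Ls, of x] assms(2) by simp
  then show ?thesis
    using derivation_inner[of "ap t x"] that G_so[OF L_G[OF Ls_L[OF assms(1)]]] Ls_values[OF assms(1)]
      Ls_K(2)[OF assms(1)] by blast
qed

text \<open>Contraction with \<open>w\<close> commutes with the action of \<open>x\<close> when
  [x, w] = 0, so the element representing the contraction inherits the weight of the tensor.\<close>

lemma contraction_weight:
  assumes "ap t w = br z" "ap t' w = br z'" "act (br x) t = c *\<^sub>R t'" "br x w = 0" "z \<in> s" "z' \<in> s"
  shows "br x z = c *\<^sub>R z'"
proof (rule br_inject)
  show "br (br x z) = br (c *\<^sub>R z')"
  proof
    fix b
    have "br x (br z b) - br z (br x b) = c *\<^sub>R br z' b"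
      using ap_act_br[of x t w b] assms(1-4) by simp
    then show "br (br x z) b = br (c *\<^sub>R z') b" using br_jacobi[of x z b] by simp
  qed
qed (use assms subspace_s in \<open>auto simp: br_s subspace_scale\<close>)

end

text \<open>The situation of a hypothetical second tensor \<open>Q\<close> in rank at least two: \<open>u\<close> and \<open>v\<close> lie in a
  maximal torus fixing \<open>Q\<close>, and \<open>e1 - i e2\<close> is a root vector for a longest root, whose coroot is
  proportional to \<open>u\<close>.\<close>

locale second_tensor = minimal_tensor G T for G :: "('a::euclidean_space \<Rightarrow> 'a) set" and T +
  fixes Q u v e1 e2 l m0
  assumes Q: "Q \<in> Ls" and in_s: "u \<in> s" "v \<in> s" "e1 \<in> s" "e2 \<in> s"
    and ue: "br u e1 = l *\<^sub>R e2" "br u e2 = - l *\<^sub>R e1" and ve: "br v e1 = 0" "br v e2 = 0"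
    and ee: "br e1 e2 = l *\<^sub>R u" and uv: "br u v = 0"
    and Q_u: "ap Q u = br v" and inv_Q: "act (br u) Q = 0" "act (br v) Q = 0"
    and indep: "\<And>a b. a *\<^sub>R u + b *\<^sub>R v = 0 \<Longrightarrow> a = 0 \<and> b = 0"
    and bound: "\<And>x. x \<in> s \<Longrightarrow> norm (br u (br v x)) \<le> m0 * norm (br v x)"
    and m0: "0 < m0" "m0 < l"
begin

text \<open>Says that h1 - i h2 is a common eigenvector, with eigenvalue i m for \<open>br u\<close>
  and i n for \<open>br v\<close>.\<close>

definition weight_pair where
  "weight_pair h1 h2 m n \<longleftrightarrow> h1 \<in> s \<and> h2 \<in> s \<and> br u h1 = m *\<^sub>R h2 \<and> br u h2 = - m *\<^sub>R h1
    \<and> br v h1 = n *\<^sub>R h2 \<and> br v h2 = - n *\<^sub>R h1"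

text \<open>For n nonzero both members lie in the image of \<open>br v\<close>, where
  \<open>m0\<close> bounds \<open>br u\<close>. This is how the extremality of \<open>m0\<close>
  enters.\<close>

lemma weight_pair_vanish:
  assumes "weight_pair z1 z2 a n" "n \<noteq> 0" "a > m0"
  shows "z1 = 0" "z2 = 0"
proof -
  note z = assms(1)[unfolded weight_pair_def]
  have "br v ((- 1 / n) *\<^sub>R z2) = z1" "br v ((1 / n) *\<^sub>R z1) = z2"
    using z assms(2) by simp_all
  then have "norm (br u z1) \<le> m0 * norm z1" "norm (br u z2) \<le> m0 * norm z2"
    using bound[of "(- 1 / n) *\<^sub>R z2"] bound[of "(1 / n) *\<^sub>R z1"] z subspace_s
    by (simp_all only: subspace_scale)
  then have "a * norm z2 \<le> m0 * norm z1" "a * norm z1 \<le> m0 * norm z2"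
    using z m0 assms(3) by simp_all
  then have "(a - m0) * (norm z1 + norm z2) \<le> 0" by (simp add: algebra_simps)
  then have "norm z1 + norm z2 \<le> 0" using assms(3) by (simp add: mult_le_0_iff)
  then have "norm z1 = 0" "norm z2 = 0" using norm_ge_zero[of z1] norm_ge_zero[of z2] by linarith+
  then show "z1 = 0" "z2 = 0" by simp_all
qed

text \<open>Q1 - i Q2 is \<open>Q\<close> acted on by the root vector e1 - i e2; since
  \<open>Q\<close> is invariant under \<open>u\<close> and \<open>v\<close>, its weight is (l,
  0).\<close>

definition Q1 where "Q1 = act (br e1) Q"
definition Q2 where "Q2 = act (br e2) Q"

lemma Q12_Ls: "Q1 \<in> Ls" "Q2 \<in> Ls"
  by (simp_all add: Q1_def Q2_def act_br_Ls Q)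

lemma weight_Q12: "act (br u) Q1 = l *\<^sub>R Q2" "act (br u) Q2 = - l *\<^sub>R Q1"
  "act (br v) Q1 = 0" "act (br v) Q2 = 0"
  using act_br_br[of u e1 Q] act_br_br[of u e2 Q] act_br_br[of v e1 Q] act_br_br[of v e2 Q]
    act_br_lin(2)[of l e2 Q] act_br_lin(2)[of "- l" e1 Q] act_br_lin(2)[of 0 u Q]
  by (simp_all add: Q1_def Q2_def ue ve inv_Q act_br_lin2 del: scaleR_minus_left)

section \<open>Acting on Q with a root vector and a second weight vector\<close>

context
  fixes h1 h2 m n
  assumes h: "weight_pair h1 h2 m n" and n: "n \<noteq> 0" and lm: "l + m > m0"
begin

lemma h_u: "br u h1 = m *\<^sub>R h2" "br u h2 = - m *\<^sub>R h1"
  and h_v: "br v h1 = n *\<^sub>R h2" "br v h2 = - n *\<^sub>R h1"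
  using h by (auto simp: weight_pair_def)

text \<open>For e = e1 - i e2 and h = h1 - i h2 this is [e, h] = 0: the weight (l + m, n) is beyond
  the bound.\<close>

lemma e_h_commute: "br e1 h1 = br e2 h2" "br e1 h2 = - br e2 h1"
proof -
  have "weight_pair (br e1 h1 - br e2 h2) (br e1 h2 + br e2 h1) (l + m) n"
    unfolding weight_pair_def ap_simps br_jacobi[of u] br_jacobi[of v] h_u h_v ue ve
    by (auto simp: algebra_simps intro!: subspace_add subspace_diff subspace_s br_s)
  note weight_pair_vanish[OF this n lm]
  then show "br e1 h1 = br e2 h2" "br e1 h2 = - br e2 h1"
    by (simp_all add: eq_neg_iff_add_eq_0)
qed

text \<open>P1 - i P2 is h1 - i h2 acting on Q1 - i Q2.\<close>

definition P1 where "P1 = act (br h1) Q1 - act (br h2) Q2"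
definition P2 where "P2 = act (br h1) Q2 + act (br h2) Q1"

lemma P12_zero: "P1 = 0" "P2 = 0"
proof -
  \<comment> \<open>The combination of \<open>u\<close> and \<open>v\<close> on which the weight (l
    + m, n) vanishes. Hence \<open>P1\<close> and \<open>P2\<close> are invariant under
    \<open>w\<close>, their contractions with \<open>w\<close> are inner, and the representing
    elements have the forbidden weight.\<close>
  define w where "w = n *\<^sub>R u - (l + m) *\<^sub>R v"
  have P_Ls: "P1 \<in> Ls" "P2 \<in> Ls"
    unfolding P1_def P2_def by (intro subspace_add subspace_diff subspace_Ls act_br_Ls Q12_Ls)+
  have P_u: "act (br u) P1 = (l + m) *\<^sub>R P2" "act (br u) P2 = (- (l + m)) *\<^sub>R P1"
    unfolding P1_def P2_def act_br_lin2 act_br_br[of u] h_u weight_Q12 act_br_lin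
    by (simp_all add: algebra_simps)
  have P_v: "act (br v) P1 = n *\<^sub>R P2" "act (br v) P2 = (- n) *\<^sub>R P1"
    unfolding P1_def P2_def act_br_lin2 act_br_br[of v] h_v weight_Q12 act_br_lin
    by (simp_all add: algebra_simps)
  have "act (br w) P1 = 0" "act (br w) P2 = 0"
    unfolding w_def act_br_lin P_u P_v by (simp_all add: algebra_simps)
  then obtain z1 z2 where z: "z1 \<in> s" "ap P1 w = br z1" "z2 \<in> s" "ap P2 w = br z2"
    using invariant_contraction_inner[OF P_Ls(1)] invariant_contraction_inner[OF P_Ls(2)] by metis
  have w: "br u w = 0" "br v w = 0" using uv br_swap[of v u] by (simp_all add: w_def)
  have "weight_pair z1 z2 (l + m) n"
    unfolding weight_pair_def
    using contraction_weight[OF z(2,4) P_u(1) w(1) z(1,3)] contraction_weight[OF z(4,2) P_u(2) w(1) z(3,1)]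
      contraction_weight[OF z(2,4) P_v(1) w(2) z(1,3)] contraction_weight[OF z(4,2) P_v(2) w(2) z(3,1)] z
    by simp
  note weight_pair_vanish[OF this n lm]
  then have "ap P1 w y = 0" "ap P2 w y = 0" for y using z by simp_all
  moreover have "w \<notin> K"
  proof
    assume "w \<in> K"
    moreover have "w \<in> s" unfolding w_def by (intro subspace_diff subspace_scale subspace_s in_s)
    ultimately have "w = 0" using s_K by blast
    moreover have "n *\<^sub>R u + (- (l + m)) *\<^sub>R v = w"
      unfolding w_def scaleR_minus_left by simp
    ultimately show False using indep n by metis
  qed
  ultimately show "P1 = 0" "P2 = 0" using nondegenerate P_Ls by blast+
qed

text \<open>O1 - i O2 is Q1 - i Q2 contracted with h1 - i h2.\<close>

definition O1 where "O1 x = ap Q1 h1 x - ap Q2 h2 x"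
definition O2 where "O2 x = ap Q1 h2 x + ap Q2 h1 x"

text \<open>By \<open>act_swap\<close> these endomorphisms act on \<open>T\<close> as -P1 and -P2,
  that is by zero. So they are inner derivations, again given by elements of the forbidden weight (l
  + m, n).\<close>

lemma O12_zero: "O1 x = 0" "O2 x = 0"
proof -
  have O_fun: "O1 = (\<lambda>x. ap Q1 h1 x - ap Q2 h2 x)" "O2 = (\<lambda>x. ap Q1 h2 x + ap Q2 h1 x)"
    by (auto simp: O1_def O2_def)
  have O_so: "so_V O1" "so_V O2"
    unfolding O_fun by (intro G_so G_diff G_add L_G Ls_L Q12_Ls)+
  have O_s: "O1 x \<in> s" "O2 x \<in> s" for x
    unfolding O1_def O2_def by (intro subspace_add subspace_diff subspace_s Ls_values Q12_Ls)+
  have O_K: "O1 z = 0" "O2 z = 0" if "z \<in> K" for z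
    using that by (simp_all add: O1_def O2_def Ls_K Q12_Ls)
  have "act O1 T = act (ap Q1 h1) T - act (ap Q2 h2) T" "act O2 T = act (ap Q1 h2) T + act (ap Q2 h1) T"
    using O_so by (auto intro!: tensor_eqI simp: ap_act[OF so_V_linear] ap_act[OF ap_bilinear(3)] O1_def O2_def algebra_simps)
  then have "act O1 T = - P1" "act O2 T = - P2"
    using act_swap[OF Q12_Ls(1) T_Ls] act_swap[OF Q12_Ls(2) T_Ls] by (simp_all add: P1_def P2_def)
  then have "act O1 T = 0" "act O2 T = 0" by (simp_all add: P12_zero)
  then obtain z1 z2 where z: "z1 \<in> s" "O1 = br z1" "z2 \<in> s" "O2 = br z2"
    using derivation_inner[OF O_so(1) O_s(1) O_K(1)] derivation_inner[OF O_so(2) O_s(2) O_K(2)] by metis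
  have uO: "br u (ap Q1 a x) = ap Q1 a (br u x) + l *\<^sub>R ap Q2 a x + ap Q1 (br u a) x"
    "br u (ap Q2 a x) = ap Q2 a (br u x) - l *\<^sub>R ap Q1 a x + ap Q2 (br u a) x" for a x
    using ap_act_br[of u Q1 a x] ap_act_br[of u Q2 a x] by (simp_all add: weight_Q12 algebra_simps)
  have vO: "br v (ap Q1 a x) = ap Q1 a (br v x) + ap Q1 (br v a) x"
    "br v (ap Q2 a x) = ap Q2 a (br v x) + ap Q2 (br v a) x" for a x
    using ap_act_br[of v Q1 a x] ap_act_br[of v Q2 a x] by (simp_all add: weight_Q12 algebra_simps)
  have *: "br x z = c *\<^sub>R z'" if "z \<in> s" "z' \<in> s" "\<And>b. br x (br z b) = br z (br x b) + c *\<^sub>R br z' b" for x z z' c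
  proof (rule br_inject)
    show "br (br x z) = br (c *\<^sub>R z')"
      using that(3) br_jacobi[of x z] by (intro ext) simp
  qed (use that subspace_s in \<open>auto simp: br_s subspace_scale\<close>)
  have "weight_pair z1 z2 (l + m) n"
    unfolding weight_pair_def
  proof (intro conjI z *)
    show "br u (br z1 b) = br z1 (br u b) + (l + m) *\<^sub>R br z2 b" for b
      unfolding z(2,4)[symmetric] O1_def O2_def ap_simps uO h_u by (simp add: algebra_simps)
    show "br u (br z2 b) = br z2 (br u b) + (- (l + m)) *\<^sub>R br z1 b" for b
      unfolding z(2,4)[symmetric] O1_def O2_def ap_simps uO h_u by (simp add: algebra_simps)
    show "br v (br z1 b) = br z1 (br v b) + n *\<^sub>R br z2 b" for b
      unfolding z(2,4)[symmetric] O1_def O2_def ap_simps vO h_v by (simp add: algebra_simps)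
    show "br v (br z2 b) = br z2 (br v b) + (- n) *\<^sub>R br z1 b" for b
      unfolding z(2,4)[symmetric] O1_def O2_def ap_simps vO h_v by (simp add: algebra_simps)
  qed
  note weight_pair_vanish[OF this n lm]
  then show "O1 x = 0" "O2 x = 0" using z by simp_all
qed

text \<open>With e = e1 - i e2 and its conjugate e', this reads [e, Q(e', h)] = -2 l n h. It is the
  vanishing of O1 - i O2 at e', expanded with [e, h] = 0, [e, e'] = 2 i l u and Q(u, h) = [v, h] = i
  n h.\<close>

lemma raising_after_lowering:
  defines "r1 \<equiv> ap Q e1 h1 + ap Q e2 h2" and "r2 \<equiv> ap Q e1 h2 - ap Q e2 h1"
  shows "br e1 r1 - br e2 r2 = - (2 * l * n) *\<^sub>R h1" "br e1 r2 + br e2 r1 = - (2 * l * n) *\<^sub>R h2"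
proof -
  note sw = L_swap[OF Ls_L[OF Q]]
  have "ap Q h2 u = n *\<^sub>R h1" "ap Q h1 u = - n *\<^sub>R h2"
    using sw[of h2 u] sw[of h1 u] by (simp_all add: Q_u h_v)
  note Qhu = this
  have e21: "br e2 e1 = - l *\<^sub>R u" using br_swap[of e2 e1] ee by simp
  have r1: "r1 = - (ap Q h1 e1 + ap Q h2 e2)" and r2: "r2 = ap Q h1 e2 - ap Q h2 e1"
    using sw[of e1 h1] sw[of e2 h2] sw[of e1 h2] sw[of e2 h1] by (simp_all add: r1_def r2_def)
  have "O1 e1 + O2 e2 = - br e1 r1 + br e2 r2 - (l *\<^sub>R ap Q h2 u + l *\<^sub>R ap Q h2 u)"
    unfolding O1_def O2_def Q1_def Q2_def ap_act_br ee e21 e_h_commute r1 r2 T_self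
    by (simp add: algebra_simps)
  moreover have "O1 e2 - O2 e1 = br e1 r2 + br e2 r1 - (l *\<^sub>R ap Q h1 u + l *\<^sub>R ap Q h1 u)"
    unfolding O1_def O2_def Q1_def Q2_def ap_act_br ee e21 e_h_commute r1 r2 T_self
    by (simp add: algebra_simps)
  ultimately show "br e1 r1 - br e2 r2 = - (2 * l * n) *\<^sub>R h1" "br e1 r2 + br e2 r1 = - (2 * l * n) *\<^sub>R h2"
    unfolding O12_zero Qhu mult_2 distrib_right scaleR_left_distrib scaleR_minus_left
    by (simp_all add: algebra_simps) (metis add.assoc eq_neg_iff_add_eq_0)
qed

end

text \<open>With \<open>e = e1 - i e2\<close>, \<open>f = f1 - i f2\<close> and \<open>p = [e*, f]\<close>, the real part of the hermitian
  product of \<open>Q(e*, f)\<close> and \<open>p\<close> is computed from the action on \<open>f\<close> and from the action on \<open>p*\<close>;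
  the results have opposite signs.\<close>

lemma no_extremal_weight_pair:
  assumes f: "weight_pair f1 f2 m0 n" "n \<noteq> 0" "f1 \<noteq> 0"
  shows False
proof -
  have l: "l > 0" using m0 by simp
  have lm: "l + m0 > m0" using l by simp
  note fw = f(1)[unfolded weight_pair_def]
  note ef = e_h_commute[OF f(1,2) lm]
  define p1 p2 where "p1 = br e1 f1 + br e2 f2" and "p2 = br e1 f2 - br e2 f1"
  \<comment> \<open>The pair describes the conjugate of p1 - i p2, whence the sign of
    \<open>p2\<close>. Its weight l - m0 is positive since m0 < l, which makes
    \<open>raising_after_lowering\<close> applicable to it as well.\<close>
  have p: "weight_pair p1 (- p2) (l - m0) (- n)"
    unfolding weight_pair_def p1_def p2_def ap_simps br_jacobi[of u] br_jacobi[of v] ue ve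
    using fw by (auto simp: algebra_simps intro!: subspace_add subspace_diff subspace_s br_s)
  have lm': "l + (l - m0) > m0" using m0 by simp
  define r1 r2 where "r1 = ap Q e1 f1 + ap Q e2 f2" and "r2 = ap Q e1 f2 - ap Q e2 f1"
  define q1 q2 where "q1 = ap Q e1 p1 + ap Q e2 (- p2)" and "q2 = ap Q e1 (- p2) - ap Q e2 p1"
  define k where "k = 2 * l"
  have R: "br e1 r1 - br e2 r2 = - (k * n) *\<^sub>R f1" "br e1 r2 + br e2 r1 = - (k * n) *\<^sub>R f2"
    using raising_after_lowering[OF f(1,2) lm] by (simp_all add: r1_def r2_def k_def)
  have q: "br e1 q1 - br e2 q2 = (k * n) *\<^sub>R p1" "br e1 q2 + br e2 q1 = - (k * n) *\<^sub>R p2"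
    using raising_after_lowering[OF p _ lm'] f(2) by (simp_all add: q1_def q2_def k_def)
  \<comment> \<open>As [e, f] = 0, the Jacobi identity reduces [e, [e', f]] to [[e, e'], f] = 2 i l
    [u, f], which equals -2 l m0 f.\<close>
  have P: "br e1 p1 - br e2 p2 = - (k * m0) *\<^sub>R f1" "br e1 p2 + br e2 p1 = - (k * m0) *\<^sub>R f2"
  proof -
    have 1: "br e1 (br e2 x) - br e2 (br e1 x) = l *\<^sub>R br u x" for x
      using br_jacobi[of e1 e2 x] by (simp add: ee)
    have "p1 = 2 *\<^sub>R br e2 f2" "p1 = 2 *\<^sub>R br e1 f1" "p2 = 2 *\<^sub>R br e1 f2" "p2 = - 2 *\<^sub>R br e2 f1"
      using ef by (simp_all add: p1_def p2_def scaleR_2)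
    note pe = this
    have "br e1 p1 = 2 *\<^sub>R br e1 (br e2 f2)" "br e2 p2 = 2 *\<^sub>R br e2 (br e1 f2)"
      by (subst pe(1), simp, subst pe(3), simp)
    moreover have "br e1 p2 = - 2 *\<^sub>R br e1 (br e2 f1)" "br e2 p1 = 2 *\<^sub>R br e2 (br e1 f1)"
      by (subst pe(4), simp, subst pe(2), simp)
    ultimately have "br e1 p1 - br e2 p2 = 2 *\<^sub>R (br e1 (br e2 f2) - br e2 (br e1 f2))"
      "br e1 p2 + br e2 p1 = - 2 *\<^sub>R (br e1 (br e2 f1) - br e2 (br e1 f1))"
      by (simp_all add: scaleR_diff_right)
    then show "br e1 p1 - br e2 p2 = - (k * m0) *\<^sub>R f1" "br e1 p2 + br e2 p1 = - (k * m0) *\<^sub>R f2"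
      unfolding 1 using fw by (simp_all add: k_def)
  qed
  note sk = br_skew and Qsk = L_skew[OF Ls_L[OF Q]]
  define X where "X = r1 \<bullet> p1 + r2 \<bullet> p2"
  have X1: "X = k * n * (f1 \<bullet> f1 + f2 \<bullet> f2)"
  proof -
    have "X = - ((br e1 r1 - br e2 r2) \<bullet> f1) - (br e1 r2 + br e2 r1) \<bullet> f2"
      using sk[of e1 r1 f1] sk[of e2 r2 f1] sk[of e1 r2 f2] sk[of e2 r1 f2]
      by (simp add: X_def p1_def p2_def inner_add_left inner_add_right inner_diff_left inner_diff_right)
    then show ?thesis unfolding R by (simp add: algebra_simps)
  qed
  have X2: "n * (p1 \<bullet> p1 + p2 \<bullet> p2) = - m0 * X" if "k > 0"
  proof -
    have "k * n * (p1 \<bullet> p1 + p2 \<bullet> p2) = (br e1 q1 - br e2 q2) \<bullet> p1 - (br e1 q2 + br e2 q1) \<bullet> p2"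
      unfolding q by (simp add: algebra_simps)
    also have "\<dots> = - (q1 \<bullet> (br e1 p1 - br e2 p2)) + q2 \<bullet> (br e1 p2 + br e2 p1)"
      using sk[of e1 q1 p1] sk[of e2 q2 p1] sk[of e1 q2 p2] sk[of e2 q1 p2]
      by (simp add: inner_add_left inner_add_right inner_diff_left inner_diff_right)
    also have "\<dots> = k * m0 * (q1 \<bullet> f1 - q2 \<bullet> f2)" unfolding P by (simp add: algebra_simps)
    also have "q1 \<bullet> f1 - q2 \<bullet> f2 = - X"
      using Qsk[of e1 p1 f1] Qsk[of e2 p2 f1] Qsk[of e1 p2 f2] Qsk[of e2 p1 f2]
      by (simp add: X_def q1_def q2_def r1_def r2_def inner_add_left inner_add_right inner_diff_left
          inner_diff_right inner_commute[of _ p1] inner_commute[of _ p2])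
    finally have "k * (n * (p1 \<bullet> p1 + p2 \<bullet> p2)) = k * (- m0 * X)" by (simp add: mult.assoc)
    moreover have "k \<noteq> 0" using that by simp
    ultimately show ?thesis using mult_left_cancel[of k] by blast
  qed
  have X3: "p1 \<bullet> p1 + p2 \<bullet> p2 = k * m0 * (f1 \<bullet> f1 + f2 \<bullet> f2)"
  proof -
    have "p1 \<bullet> p1 + p2 \<bullet> p2 = - ((br e1 p1 - br e2 p2) \<bullet> f1) - (br e1 p2 + br e2 p1) \<bullet> f2"
      using sk[of e1 p1 f1] sk[of e2 p2 f1] sk[of e1 p2 f2] sk[of e2 p1 f2]
      unfolding p1_def p2_def
      by (simp add: inner_add_left inner_add_right inner_diff_left inner_diff_right)
    then show ?thesis unfolding P by (simp add: algebra_simps)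
  qed
  have k: "k > 0" using l by (simp add: k_def)
  define F where "F = f1 \<bullet> f1 + f2 \<bullet> f2"
  have F: "F > 0" using f(3) by (simp add: F_def add_pos_nonneg)
  have "n * (k * m0 * F) = - m0 * (k * n * F)"
    using X2[OF k] unfolding X3 X1 F_def .
  then have "2 * (k * m0 * F * n) = 0" by (simp add: algebra_simps)
  then show False using k F m0 f(2) by simp
qed

end

section \<open>Uniqueness in rank two\<close>

context minimal_tensor
begin

text \<open>No nonzero element of \<open>s\<close> has a one-dimensional centraliser in
  \<open>s\<close>; the negation supplies the hypothesis of \<open>rank_one\<close>.\<close>

definition rank_two :: bool where
  "rank_two \<longleftrightarrow> (\<forall>u\<in>s. u \<noteq> 0 \<longrightarrow> (\<exists>x\<in>s. br u x = 0 \<and> (\<forall>c. x \<noteq> c *\<^sub>R u)))"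

lemma s_nonzero: obtains u where "u \<in> s" "u \<noteq> 0"
  using br_values_nonzero br_s by metis

lemma br_nonzero_s:
  assumes "u \<in> s" "u \<noteq> 0"
  obtains y where "y \<in> s" "br u y \<noteq> 0"
proof -
  obtain x where x: "br u x \<noteq> 0" using br_nonzero[OF assms] by blast
  obtain y z where "x = y + z" "y \<in> s" "z \<in> K" by (rule s_K_decomposition)
  then show ?thesis using that[of y] x Ls_K(2)[OF T_Ls, of z u] by simp
qed

text \<open>Produces a singular element: the centraliser of \<open>H\<close> contains the
  noncommuting \<open>u\<close> and \<open>x\<close>. \<open>H\<close> is a combination of two
  commuting elements that kills a vector in the image of \<open>br u\<close>; there
  \<open>br u\<close> is injective.\<close>

lemma rank_two_commuting:
  assumes rank_two
  obtains H u x where "H \<in> s" "u \<in> s" "x \<in> s" "H \<noteq> 0" "br u H = 0" "br H x = 0" "br u x \<noteq> 0"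
proof -
  obtain u where u: "u \<in> s" "u \<noteq> 0" by (rule s_nonzero)
  then obtain h where h: "h \<in> s" "br u h = 0" "\<And>c. h \<noteq> c *\<^sub>R u"
    using assms by (auto simp: rank_two_def)
  define S where "S = br u ` s"
  have S: "subspace S" unfolding S_def by (intro linear_subspace_image ap_bilinear subspace_s)
  obtain y where y: "y \<in> s" "br u y \<noteq> 0" by (rule br_nonzero_s[OF u])
  have com: "br u (br h z) = br h (br u z)" for z
    using br_jacobi[of u h z] h by simp
  have "br u z \<in> S" "br h z \<in> S" if z: "z \<in> S" for z
  proof -
    obtain a where a: "a \<in> s" "z = br u a" using z by (auto simp: S_def)
    show "br u z \<in> S" by (simp add: S_def a br_s)
    show "br h z \<in> S" unfolding S_def a(2) com[symmetric] by (intro imageI br_s)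
  qed
  moreover have "br u y \<in> S" using y by (simp add: S_def)
  ultimately obtain p q x where x: "(p, q) \<noteq> (0, 0)" "x \<in> S" "x \<noteq> 0" "p *\<^sub>R br u x + q *\<^sub>R br h x = 0"
    using commuting_skew_kernel[OF so_V_br[of u] so_V_br[of h] S _ _ com _ y(2)] by metis
  have ux: "br u x \<noteq> 0"
    using x(2,3) skew_square_zero[OF so_V_br] by (force simp: S_def)
  then have q: "q \<noteq> 0" using x(1,4) by auto
  show ?thesis
  proof (rule that[of "p *\<^sub>R u + q *\<^sub>R h" u x])
    show "p *\<^sub>R u + q *\<^sub>R h \<noteq> 0"
    proof
      assume "p *\<^sub>R u + q *\<^sub>R h = 0"
      then have "q *\<^sub>R h = (- p) *\<^sub>R u" by (simp add: eq_neg_iff_add_eq_0 add.commute)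
      then have "(1 / q) *\<^sub>R (q *\<^sub>R h) = (1 / q) *\<^sub>R ((- p) *\<^sub>R u)" by (rule arg_cong)
      then have "h = (- p / q) *\<^sub>R u" using q by simp
      then show False using h(3) by blast
    qed
  qed (use u h x ux subspace_s in \<open>auto simp: S_def br_s subspace_add subspace_scale\<close>)
qed

section \<open>Maximal tori, longest roots and invariant tensors\<close>

lemma abelian_insert:
  assumes t: "subspace t" "t \<subseteq> s" "\<And>a b. a \<in> t \<Longrightarrow> b \<in> t \<Longrightarrow> br a b = 0"
    and x: "x \<in> s" "\<And>w. w \<in> t \<Longrightarrow> br w x = 0"
  shows "span (insert x t) \<subseteq> s" "\<And>a b. a \<in> span (insert x t) \<Longrightarrow> b \<in> span (insert x t) \<Longrightarrow> br a b = 0"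
proof -
  show "span (insert x t) \<subseteq> s" using t(2) x(1) subspace_s by (simp add: span_minimal)
  have st: "span t = t" by (rule span_eq_iff[THEN iffD2, OF t(1)])
  fix a b assume ab: "a \<in> span (insert x t)" "b \<in> span (insert x t)"
  obtain c where c: "a - c *\<^sub>R x \<in> t"
    using span_breakdown_eq[THEN iffD1, OF ab(1)] st by auto
  obtain d where d: "b - d *\<^sub>R x \<in> t"
    using span_breakdown_eq[THEN iffD1, OF ab(2)] st by auto
  have "br ((a - c *\<^sub>R x) + c *\<^sub>R x) ((b - d *\<^sub>R x) + d *\<^sub>R x) = 0"
    using t(3)[OF c d] x(2)[OF c] x(2)[OF d] br_swap[of x "b - d *\<^sub>R x"]
    by (simp only: ap_simps T_self) simp
  then show "br a b = 0" by simp
qed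

lemma maximal_torus:
  assumes "H \<in> s" "y \<in> s" "br H y = 0"
  obtains t where "subspace t" "t \<subseteq> s" "H \<in> t" "y \<in> t" "\<And>a b. a \<in> t \<Longrightarrow> b \<in> t \<Longrightarrow> br a b = 0"
    "\<And>x. x \<in> s \<Longrightarrow> (\<And>w. w \<in> t \<Longrightarrow> br w x = 0) \<Longrightarrow> x \<in> t"
proof -
  define P where "P t \<longleftrightarrow> subspace t \<and> t \<subseteq> s \<and> H \<in> t \<and> y \<in> t \<and> (\<forall>a\<in>t. \<forall>b\<in>t. br a b = 0)" for t
  have H: "span {H} \<subseteq> s" "\<And>a b. a \<in> span {H} \<Longrightarrow> b \<in> span {H} \<Longrightarrow> br a b = 0"
    "\<And>w. w \<in> span {H} \<Longrightarrow> br w y = 0"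
    using assms subspace_s by (auto simp: span_singleton subspace_scale)
  have "P (span (insert y (span {H})))"
    using abelian_insert[OF subspace_span H(1,2) assms(2) H(3)]
    unfolding P_def by (meson insertCI insertI1 span_base subspace_span)
  from ex_max_dim[of P, OF this, of "\<lambda>t. t"]
  obtain t where t: "P t" "\<And>t'. P t' \<Longrightarrow> dim t' \<le> dim t" by metis
  have "x \<in> t" if x: "x \<in> s" "\<And>w. w \<in> t \<Longrightarrow> br w x = 0" for x
  proof (rule ccontr)
    assume nx: "x \<notin> t"
    have st: "span t = t" using t(1) by (simp add: P_def)
    have t': "subspace t" "t \<subseteq> s" "\<And>a b. a \<in> t \<Longrightarrow> b \<in> t \<Longrightarrow> br a b = 0" "H \<in> t" "y \<in> t"
      using t(1) unfolding P_def by blast+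
    have "P (span (insert x t))"
      unfolding P_def using abelian_insert[OF t'(1,2,3) x] t'(4,5)
      by (meson insertCI span_base subspace_span)
    then have "dim (span (insert x t)) \<le> dim t" by (rule t(2))
    moreover have "dim (insert x t) = dim t + 1" using nx by (simp add: dim_insert st)
    ultimately show False by simp
  qed
  then show ?thesis using that[of t] t(1) by (simp add: P_def)
qed

text \<open>Maximise the norm of [w, x] over unit vectors w in \<open>t\<close> and x in
  \<open>s\<close>. The maximum \<open>l\<close> is the length of a longest root, and
  \<open>u\<close> is its direction.\<close>

lemma top_root:
  assumes t: "subspace t" "t \<subseteq> s" and H: "H \<in> t" "H \<noteq> 0"
  obtains u e l where "u \<in> t" "norm u = 1" "e \<in> s" "norm e = 1" "l > 0"
    "br u (br u e) = - (l\<^sup>2) *\<^sub>R e"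
    "\<And>w x. w \<in> t \<Longrightarrow> x \<in> s \<Longrightarrow> norm (br w x) \<le> l * norm w * norm x"
proof -
  have "bilinear br" by (simp add: bilinear_def ap_bilinear)
  then have bb: "bounded_bilinear br" by (simp add: bilinear_conv_bounded_bilinear)
  define C where "C = (sphere 0 1 \<inter> t) \<times> (sphere 0 1 \<inter> s)"
  have unit: "(1 / norm x) *\<^sub>R x \<in> sphere 0 1 \<inter> W" if "x \<in> W" "x \<noteq> 0" "subspace W" for x :: 'a and W
    using that by (simp add: subspace_scale)
  have "compact C"
    unfolding C_def
    by (intro compact_Times compact_Int_closed compact_sphere closed_subspace t subspace_s)
  moreover have "((1 / norm H) *\<^sub>R H, (1 / norm H) *\<^sub>R H) \<in> C"
    unfolding C_def using unit[OF H t(1)] unit[of H s] H t(2) subspace_s by blast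
  then have "C \<noteq> {}" by blast
  moreover have "continuous_on C (\<lambda>p. norm (br (fst p) (snd p)))"
    by (intro continuous_on_norm bounded_bilinear.continuous_on[OF bb] continuous_on_fst continuous_on_snd continuous_on_id)
  ultimately obtain p where p: "p \<in> C" "\<And>q. q \<in> C \<Longrightarrow> norm (br (fst q) (snd q)) \<le> norm (br (fst p) (snd p))"
    using continuous_attains_sup[of C "\<lambda>p. norm (br (fst p) (snd p))"] by blast
  obtain u x0 where ux: "p = (u, x0)" by (cases p)
  have u: "u \<in> t" "norm u = 1" and x0: "x0 \<in> s" "norm x0 = 1" using p(1) by (auto simp: C_def ux)
  have us: "u \<in> s" "u \<noteq> 0" using u t(2) by auto
  obtain e l where e: "e \<in> s" "norm e = 1" "l \<ge> 0" "br u (br u e) = - (l\<^sup>2) *\<^sub>R e"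
    and l: "\<And>y. y \<in> s \<Longrightarrow> norm (br u y) \<le> l * norm y"
    using skew_top_eigenvector[OF so_V_br[of u] subspace_s br_s us] by metis
  have "norm (br u x0) \<le> l" using l[OF x0(1)] x0(2) by simp
  then have bound1: "norm (br w x) \<le> l" if "w \<in> t" "norm w = 1" "x \<in> s" "norm x = 1" for w x
    using p(2)[of "(w, x)"] that by (simp add: C_def ux)
  have bound: "norm (br w x) \<le> l * norm w * norm x" if w: "w \<in> t" and x: "x \<in> s" for w x
  proof (cases "w = 0 \<or> x = 0")
    case False
    then have "norm (br ((1 / norm w) *\<^sub>R w) ((1 / norm x) *\<^sub>R x)) \<le> l"
      using unit[OF w _ t(1)] unit[OF x _ subspace_s] by (intro bound1) auto
    then show ?thesis using False by (simp add: field_simps)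
  qed auto
  have "l \<noteq> 0"
  proof
    assume "l = 0"
    then have "br u y = 0" if "y \<in> s" for y using l[OF that] by simp
    then show False using br_nonzero_s[OF us] by metis
  qed
  then show ?thesis using that[OF u e(1,2) _ e(4) bound] e(3) by simp
qed

text \<open>\<open>T\<close> is invariant under \<open>s\<close> and the action on tensors is skew,
  so the complement of \<open>T\<close> in \<open>Ls\<close> is a module. Two commuting independent
  elements have a combination with a kernel on it.\<close>

lemma invariant_tensor:
  assumes rank_two and Q0: "Q0 \<in> Ls" "Q0 \<bullet> T = 0" "Q0 \<noteq> 0"
  obtains Q H where "Q \<in> Ls" "Q \<bullet> T = 0" "Q \<noteq> 0" "H \<in> s" "H \<noteq> 0" "act (br H) Q = 0"
proof -
  obtain u where u: "u \<in> s" "u \<noteq> 0" by (rule s_nonzero)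
  then obtain h where h: "h \<in> s" "br u h = 0" "\<And>c. h \<noteq> c *\<^sub>R u"
    using assms(1) by (auto simp: rank_two_def)
  define E where "E = {t \<in> Ls. t \<bullet> T = 0}"
  have E: "subspace E" using subspace_Ls by (auto simp: E_def subspace_def inner_add_left)
  have inv: "act (br x) t \<in> E" if "t \<in> E" for x t
    using that so_V_skew[OF so_V_act[OF so_V_br], of x t T] by (simp add: E_def act_br_Ls act_self T_Ls)
  have com: "act (br u) (act (br h) t) = act (br h) (act (br u) t)" for t
    using act_br_br[of u h t] act_br_lin(2)[of 0 u t] h by simp
  have "Q0 \<in> E" using Q0 by (simp add: E_def)
  then obtain p q Q where Q: "(p, q) \<noteq> (0, 0)" "Q \<in> E" "Q \<noteq> 0"
    "p *\<^sub>R act (br u) Q + q *\<^sub>R act (br h) Q = 0"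
    using commuting_skew_kernel[OF so_V_act[OF so_V_br[of u]] so_V_act[OF so_V_br[of h]] E inv inv com _ Q0(3)]
    by metis
  show ?thesis
  proof (rule that[of Q "p *\<^sub>R u + q *\<^sub>R h"])
    show "p *\<^sub>R u + q *\<^sub>R h \<noteq> 0"
    proof
      assume eq: "p *\<^sub>R u + q *\<^sub>R h = 0"
      then have q: "q \<noteq> 0" using Q(1) u by auto
      have "q *\<^sub>R h = (- p) *\<^sub>R u" using eq by (simp add: eq_neg_iff_add_eq_0 add.commute)
      then have "(1 / q) *\<^sub>R (q *\<^sub>R h) = (1 / q) *\<^sub>R ((- p) *\<^sub>R u)" by (rule arg_cong)
      then have "h = (- p / q) *\<^sub>R u" using q by simp
      then show False using h(3) by blast
    qed
    show "act (br (p *\<^sub>R u + q *\<^sub>R h)) Q = 0" using Q(4) by (simp only: act_br_lin)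
  qed (use Q u h subspace_s in \<open>auto simp: E_def subspace_add subspace_scale\<close>)
qed

text \<open>Constructs the data of \<open>second_tensor\<close> from a hypothetical tensor: a torus
  fixing \<open>Q\<close>, a longest root in it, and the element \<open>v\<close> representing the
  contraction of \<open>Q\<close> with the root direction. An extremal weight that does not vanish
  on \<open>v\<close> then gives the contradiction.\<close>

lemma rank_two_unique:
  assumes rank_two and Q0: "Q0 \<in> Ls" "Q0 \<bullet> T = 0"
  shows "Q0 = 0"
proof (rule ccontr)
  assume "Q0 \<noteq> 0"
  then obtain Q H where Q: "Q \<in> Ls" "Q \<bullet> T = 0" "Q \<noteq> 0" and H: "H \<in> s" "H \<noteq> 0" "act (br H) Q = 0"
    using invariant_tensor[OF assms] by metis
  obtain y where y: "y \<in> s" "ap Q H = br y" by (rule invariant_contraction_inner[OF Q(1) H(3)])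
  have "br y H = 0" using y(2) L_self[OF Ls_L[OF Q(1)], of H] by simp
  then have "br H y = 0" using br_swap[of H y] by simp
  then obtain t where t: "subspace t" "t \<subseteq> s" "H \<in> t" "y \<in> t" "\<And>a b. a \<in> t \<Longrightarrow> b \<in> t \<Longrightarrow> br a b = 0"
    and tmax: "\<And>x. x \<in> s \<Longrightarrow> (\<And>w. w \<in> t \<Longrightarrow> br w x = 0) \<Longrightarrow> x \<in> t"
    using maximal_torus[OF H(1) y(1)] by metis
  \<comment> \<open>The torus contains \<open>y\<close> as well as \<open>H\<close>, so the
    contraction of w.Q with \<open>H\<close> is \<open>br [w, y]\<close> = 0.\<close>
  have inv: "act (br w) Q = 0" if w: "w \<in> t" for w
  proof (rule nondegenerate[OF act_br_Ls[OF Q(1)]])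
    show "H \<notin> K" using H s_K by blast
    show "ap (act (br w) Q) H z = 0" for z
      using ap_act_br[of w Q H z] y(2) t(5)[OF w t(3)] t(5)[OF w t(4)] br_jacobi[of w y z] by simp
  qed
  obtain u e1 l where u: "u \<in> t" "norm u = 1" and e1: "e1 \<in> s" "norm e1 = 1" and l: "l > 0"
    and uue: "br u (br u e1) = - (l\<^sup>2) *\<^sub>R e1"
    and lbound: "\<And>w x. w \<in> t \<Longrightarrow> x \<in> s \<Longrightarrow> norm (br w x) \<le> l * norm w * norm x"
    using top_root[OF t(1,2,3) H(2)] by metis
  have us: "u \<in> s" and u0: "u \<noteq> 0" and uu: "u \<bullet> u = 1" using u t(2) by (auto simp: dot_square_norm)
  have comm: "br a (br b z) = br b (br a z)" if "a \<in> t" "b \<in> t" for a b z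
    using br_jacobi[of a b z] t(5)[OF that] by simp
  \<comment> \<open>Stationarity of the maximum of |[w, x]| when \<open>u\<close> is varied inside
    the torus, orthogonally to \<open>u\<close>.\<close>
  have first_order: "br u x \<bullet> br w x = 0"
    if x: "x \<in> s" "br u (br u x) = - (l\<^sup>2) *\<^sub>R x" and w: "w \<in> t" "w \<bullet> u = 0" for x w
  proof (rule quadratic_nonpos_imp_zero[where B = "br w x \<bullet> br w x - l\<^sup>2 * (w \<bullet> w) * (x \<bullet> x)"])
    fix \<tau> :: real
    have ux: "br u x \<bullet> br u x = l\<^sup>2 * (x \<bullet> x)" using br_skew[of u x "br u x"] x(2) by simp
    have "norm (br (u + \<tau> *\<^sub>R w) x) \<le> l * norm (u + \<tau> *\<^sub>R w) * norm x"
      using t(1) u(1) w x by (intro lbound) (auto simp: subspace_add subspace_scale)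
    then have "(norm (br (u + \<tau> *\<^sub>R w) x))\<^sup>2 \<le> (l * norm (u + \<tau> *\<^sub>R w) * norm x)\<^sup>2"
      by (rule power_mono) simp
    also have "\<dots> = l\<^sup>2 * (norm (u + \<tau> *\<^sub>R w))\<^sup>2 * (x \<bullet> x)"
      by (simp only: power_mult_distrib power2_norm_eq_inner[of x])
    also have "(norm (u + \<tau> *\<^sub>R w))\<^sup>2 = 1 + \<tau>\<^sup>2 * (w \<bullet> w)"
      unfolding power2_norm_eq_inner using w(2)
      by (simp add: inner_add_left inner_add_right uu inner_commute[of u w] power2_eq_square)
    also have "(norm (br (u + \<tau> *\<^sub>R w) x))\<^sup>2
        = l\<^sup>2 * (x \<bullet> x) + 2 * \<tau> * (br u x \<bullet> br w x) + \<tau>\<^sup>2 * (br w x \<bullet> br w x)"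
      unfolding power2_norm_eq_inner
      by (simp add: inner_add_left inner_add_right ux inner_commute[of "br w x" "br u x"]
          power2_eq_square distrib_left)
    finally show "2 * \<tau> * (br u x \<bullet> br w x) + \<tau>\<^sup>2 * (br w x \<bullet> br w x - l\<^sup>2 * (w \<bullet> w) * (x \<bullet> x)) \<le> 0"
      by (simp add: algebra_simps)
  qed
  \<comment> \<open>Polarise \<open>first_order\<close>: g = [u, [w, x]] lies in the same eigenspace
    as \<open>x\<close>, and the mixed term of x + g is -2 |g|^2. So the longest root vanishes on
    the part of the torus orthogonal to \<open>u\<close>.\<close>
  have killed: "br w x = 0"
    if x: "x \<in> s" "br u (br u x) = - (l\<^sup>2) *\<^sub>R x" and w: "w \<in> t" "w \<bullet> u = 0" for x w
  proof -
    define g where "g = br u (br w x)"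
    have g: "g \<in> s" "br u (br u g) = - (l\<^sup>2) *\<^sub>R g"
      using comm[OF u(1) w(1)] x(2) by (simp_all add: g_def br_s)
    have "br u (x + g) \<bullet> br w (x + g) = 0"
      using x g subspace_s w by (intro first_order) (auto simp: subspace_add scaleR_right_distrib)
    then have "br u x \<bullet> br w g + br u g \<bullet> br w x = 0"
      using first_order[OF x w] first_order[OF g w] by (simp add: inner_add_left inner_add_right)
    moreover have "br u x \<bullet> br w g = - (g \<bullet> g)"
      using br_skew[of w g "br u x"] comm[OF u(1) w(1), of x] by (simp add: g_def inner_commute)
    moreover have "br u g \<bullet> br w x = - (g \<bullet> g)"
      using br_skew[of u g "br w x"] by (simp add: g_def)
    ultimately have "g = 0" by simp
    moreover have "br u g = - (l\<^sup>2) *\<^sub>R br w x"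
      using comm[OF u(1) w(1)] x(2) by (simp add: g_def)
    ultimately show ?thesis using l by simp
  qed
  define e2 where "e2 = (1 / l) *\<^sub>R br u e1"
  have ue: "br u e1 = l *\<^sub>R e2" "br u e2 = - l *\<^sub>R e1"
    using l uue by (simp_all add: e2_def power2_eq_square)
  have e2s: "e2 \<in> s" unfolding e2_def by (intro subspace_scale subspace_s br_s)
  have e22: "e2 \<bullet> e2 = 1"
  proof -
    have "l * (e2 \<bullet> e2) = l"
      using br_skew[of u e1 e2] e1(2) by (simp add: ue dot_square_norm)
    then show ?thesis using l by simp
  qed
  have we: "br w e1 = (l * (w \<bullet> u)) *\<^sub>R e2" "br w e2 = - (l * (w \<bullet> u)) *\<^sub>R e1" if w: "w \<in> t" for w
  proof -
    define w' where "w' = w - (w \<bullet> u) *\<^sub>R u"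
    have w': "w' \<in> t" "w' \<bullet> u = 0"
      using w u t(1) by (auto simp: w'_def subspace_diff subspace_scale inner_diff_left uu)
    have "br w' e1 = 0" by (rule killed[OF e1(1) uue w'])
    moreover from this have "br w' e2 = 0" using comm[OF w'(1) u(1), of e1] by (simp add: e2_def)
    moreover have "w = w' + (w \<bullet> u) *\<^sub>R u" by (simp add: w'_def)
    ultimately show "br w e1 = (l * (w \<bullet> u)) *\<^sub>R e2" "br w e2 = - (l * (w \<bullet> u)) *\<^sub>R e1"
      by (metis (no_types, lifting) ap_simps(6,9) add_0 ue(1) scaleR_scaleR mult.commute)
        (metis (no_types, lifting) \<open>br w' e2 = 0\<close> \<open>w = w' + (w \<bullet> u) *\<^sub>R u\<close> ap_simps(6,9) add_0 ue(2) scaleR_scaleR mult.commute mult_minus_right)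
  qed
  \<comment> \<open>The bracket is centralised by \<open>t\<close>, hence lies in \<open>t\<close>
    by maximality; pairing it with all of \<open>t\<close> identifies it with l u.\<close>
  have ee: "br e1 e2 = l *\<^sub>R u"
  proof -
    have "br w (br e1 e2) = 0" if "w \<in> t" for w
      using br_jacobi[of w e1 e2] by (simp add: we[OF that])
    then have "br e1 e2 \<in> t" using tmax br_s by blast
    then have d: "br e1 e2 - l *\<^sub>R u \<in> t" using t(1) u by (simp add: subspace_diff subspace_scale)
    have "(br e1 e2 - l *\<^sub>R u) \<bullet> w = 0" if w: "w \<in> t" for w
      using br_skew[of e1 e2 w] br_swap[of e1 w] we(1)[OF w] e22 by (simp add: inner_diff_left inner_commute[of u])
    from this[OF d] show ?thesis by simp
  qed
  obtain v where v: "v \<in> s" "ap Q u = br v" by (rule invariant_contraction_inner[OF Q(1) inv[OF u(1)]])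
  have vt: "v \<in> t"
  proof (rule tmax[OF v(1)])
    fix w assume w: "w \<in> t"
    have "br (br w v) z = 0" for z
      using ap_act_br[of w Q u z] inv[OF w] v(2) t(5)[OF w u(1)] br_jacobi[of w v z] by simp
    then have "br w v \<in> K" by (simp add: K_def ker_def)
    then show "br w v = 0" using s_K br_s by blast
  qed
  have v0: "v \<noteq> 0"
  proof
    assume "v = 0"
    then have "ap Q u z = 0" for z using v(2) by simp
    then show False using nondegenerate[OF Q(1), of u] s_K[OF us] u0 Q(3) by blast
  qed
  \<comment> \<open>Orthogonality of \<open>Q\<close> to \<open>T\<close> enters here, through the
    trace of \<open>br v\<close> against \<open>br u\<close>.\<close>
  have vu: "v \<bullet> u = 0"
  proof -
    obtain k where k: "k > 0" "\<And>x y. x \<in> s \<Longrightarrow> y \<in> s \<Longrightarrow> frob (br x) (br y) = k * (x \<bullet> y)"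
      using frob_br by blast
    show ?thesis using frob_orthogonal_tensor[OF Q(1,2) us] k(2)[OF v(1) us] k(1) by (simp add: v(2))
  qed
  have ve: "br v e1 = 0" "br v e2 = 0" using we[OF vt] vu by simp_all
  \<comment> \<open>The image of \<open>br v\<close> collects the weights that do not vanish on
    \<open>v\<close>; \<open>m0\<close> will be the largest value of \<open>u\<close> among
    them.\<close>
  define M where "M = br v ` s"
  have M: "subspace M" unfolding M_def by (intro linear_subspace_image ap_bilinear subspace_s)
  have uM: "br u x \<in> M" if "x \<in> M" for x
    using that comm[OF u(1) vt] by (auto simp: M_def br_s)
  have vM: "br v x \<in> M" for x
  proof -
    obtain y z where "x = y + z" "y \<in> s" "z \<in> K" by (rule s_K_decomposition)
    then show ?thesis by (simp add: M_def Ls_K T_Ls)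
  qed
  obtain x0 where x0: "x0 \<in> s" "br v x0 \<noteq> 0" by (rule br_nonzero_s[OF v(1) v0])
  obtain f0 m0 where f0: "f0 \<in> M" "norm f0 = 1" "m0 \<ge> 0" "br u (br u f0) = - (m0\<^sup>2) *\<^sub>R f0"
    and mbound: "\<And>y. y \<in> M \<Longrightarrow> norm (br u y) \<le> m0 * norm y"
    using skew_top_eigenvector[OF so_V_br[of u] M uM vM x0(2)] by metis
  have Ms: "M \<subseteq> s" by (auto simp: M_def br_s)
  have "m0 \<noteq> 0"
  proof
    assume m: "m0 = 0"
    \<comment> \<open>If \<open>u\<close> killed the image of \<open>br v\<close>, this set would be
      an ideal containing \<open>u\<close>, hence all of \<open>s\<close>, and \<open>v\<close>
      would be central.\<close>
    define C where "C = {z \<in> s. br v z = 0 \<and> (\<forall>x. br z (br v x) = 0)}"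
    have "C = s"
    proof (rule ideal_eq_s)
      show "subspace C" using subspace_s by (auto simp: C_def subspace_def)
      show "C \<subseteq> s" by (auto simp: C_def)
      show "u \<in> C" "u \<noteq> 0" using us u0 mbound[OF vM] m t(5)[OF vt u(1)] by (auto simp: C_def)
      fix x z assume z: "z \<in> C"
      obtain x' k where x': "x = x' + k" "x' \<in> s" "k \<in> K" by (rule s_K_decomposition)
      obtain c y where cy: "x' = c + br v y" "c \<in> s" "y \<in> s" "br v c = 0"
        using skew_kernel_range_decomposition[OF so_V_br[of v] subspace_s br_s x'(2)] by metis
      have "br z (br v y) = 0" using z by (simp add: C_def)
      then have "br (br v y) z = 0" using br_swap[of "br v y" z] by simp
      then have xz: "br x z = br c z" using x' cy by (simp add: Ls_K T_Ls)
      have "br v (br c z) = 0" using br_jacobi[of v c z] z cy by (simp add: C_def)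
      moreover have "br (br c z) (br v w) = 0" for w
      proof -
        have "br v (br c w) = br c (br v w)" using br_jacobi[of v c w] cy by simp
        then have "br z (br c (br v w)) = 0" using z by (metis (mono_tags, lifting) C_def mem_Collect_eq)
        then show ?thesis using br_jacobi[of c z "br v w"] z by (simp add: C_def)
      qed
      ultimately show "br x z \<in> C" by (simp add: xz C_def br_s)
    qed
    then have "br v x0 = 0" using x0(1) by (auto simp: C_def)
    then show False using x0 by simp
  qed
  then have m0: "m0 > 0" using f0(3) by simp
  \<comment> \<open>If m0 = l, then \<open>f0\<close> is a top vector, so \<open>killed\<close>
    gives [v, f0] = 0; but \<open>br v\<close> is injective on its image.\<close>
  have m0l: "m0 < l"
  proof (rule ccontr)
    assume "\<not> m0 < l"
    moreover have "norm (br u f0) = m0"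
    proof -
      have "(norm (br u f0))\<^sup>2 = m0\<^sup>2"
        using br_skew[of u f0 "br u f0"] f0 by (simp add: dot_square_norm)
      then show ?thesis using f0(3) by (simp add: power2_eq_iff_nonneg)
    qed
    moreover have "norm (br u f0) \<le> l" using lbound[OF u(1), of f0] f0 u Ms by auto
    ultimately have "m0 = l" by simp
    then have "br v f0 = 0" using killed[of f0 v] f0 vt vu Ms by auto
    then have "f0 = 0" using f0(1) skew_square_zero[OF so_V_br] by (auto simp: M_def)
    then show False using f0(2) by simp
  qed
  define S where "S = {x \<in> M. br u (br u x) = - (m0\<^sup>2) *\<^sub>R x}"
  have S: "subspace S" using M by (auto simp: S_def subspace_def scaleR_right_distrib)
  have Sinv: "br u x \<in> S" "br v x \<in> S" if "x \<in> S" for x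
    using that uM vM comm[OF u(1) vt] by (simp_all add: S_def)
  have "f0 \<in> S" "f0 \<noteq> 0" using f0 by (auto simp: S_def)
  then obtain p q f1 where f1: "(p, q) \<noteq> (0, 0)" "f1 \<in> S" "f1 \<noteq> 0" "p *\<^sub>R br u f1 + q *\<^sub>R br v f1 = 0"
    using commuting_skew_kernel[OF so_V_br[of u] so_V_br[of v] S Sinv comm[OF u(1) vt]] by metis
  have f1M: "f1 \<in> M" "br u (br u f1) = - (m0\<^sup>2) *\<^sub>R f1" using f1(2) by (auto simp: S_def)
  have uf1: "br u f1 \<noteq> 0" using f1M(2) f1(3) m0 by auto
  then have q: "q \<noteq> 0" using f1(1,4) by auto
  define f2 where "f2 = (1 / m0) *\<^sub>R br u f1"
  define n where "n = - p * m0 / q"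
  have uf: "br u f1 = m0 *\<^sub>R f2" "br u f2 = - m0 *\<^sub>R f1"
    using m0 f1M by (simp_all add: f2_def power2_eq_square)
  have vf1: "br v f1 = n *\<^sub>R f2"
  proof -
    have "q *\<^sub>R br v f1 = - (p *\<^sub>R br u f1)" using f1(4) by (simp add: eq_neg_iff_add_eq_0 add.commute)
    then have "(1 / q) *\<^sub>R (q *\<^sub>R br v f1) = (1 / q) *\<^sub>R (- (p *\<^sub>R br u f1))" by (rule arg_cong)
    then show ?thesis using q by (simp add: uf n_def)
  qed
  have vf2: "br v f2 = - n *\<^sub>R f1"
  proof -
    have "br v f2 = (1 / m0) *\<^sub>R br u (br v f1)" by (simp add: f2_def comm[OF u(1) vt])
    then show ?thesis using m0 by (simp add: vf1 uf)
  qed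
  have "br v f1 \<noteq> 0" using f1(3) f1M(1) skew_square_zero[OF so_V_br] by (auto simp: M_def)
  then have n: "n \<noteq> 0" using vf1 by auto
  interpret second_tensor G T Q u v e1 e2 l m0
  proof
    show "a = 0 \<and> b = 0" if ab: "a *\<^sub>R u + b *\<^sub>R v = 0" for a b
    proof -
      have "(a *\<^sub>R u + b *\<^sub>R v) \<bullet> u = a" "(a *\<^sub>R u + b *\<^sub>R v) \<bullet> v = b * (v \<bullet> v)"
        using vu uu by (simp_all add: inner_add_left inner_commute[of u v])
      then show ?thesis using ab v0 by simp
    qed
    show "norm (br u (br v x)) \<le> m0 * norm (br v x)" if "x \<in> s" for x by (rule mbound[OF vM])
  qed (use Q(1) us v e1 e2s ue ve ee t(5)[OF u(1) vt] inv u(1) vt m0 m0l in auto)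
  have "f1 \<in> s" "f2 \<in> s" using f1M(1) Ms subspace_s br_s by (auto simp: f2_def subspace_scale)
  then have "weight_pair f1 f2 m0 n" using uf vf1 vf2 by (simp add: weight_pair_def)
  then show False using no_extremal_weight_pair n f1(3) by blast
qed

end

section \<open>Invariance of the support\<close>

context minimal_tensor
begin

text \<open>Transports uniqueness to another minimal tensor, whose kernel need not be
  \<open>K\<close>.\<close>

lemma minimal_tensor_rank_two_unique:
  assumes "minimal_tensor G t" "minimal_tensor.rank_two t" "t' \<in> L" "ker t \<subseteq> ker t'" "t' \<bullet> t = 0"
  shows "t' = 0"
proof -
  interpret t: minimal_tensor G t by (rule assms(1))
  show ?thesis by (rule t.rank_two_unique[OF assms(2) _ assms(5)]) (use assms in \<open>auto simp: t.Ls_def t.K_def\<close>)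
qed

section \<open>The infinitesimal G-orbit of T as an s-module\<close>

definition orbit :: "'a tensor set" where
  "orbit = {act C T |C. C \<in> G}"

lemma subspace_orbit: "subspace orbit"
proof (rule subspaceI)
  show "0 \<in> orbit" using G_zero act_0[of T] by (force simp: orbit_def)
  fix t t' assume "t \<in> orbit" "t' \<in> orbit"
  then obtain C C' where C: "C \<in> G" "C' \<in> G" "t = act C T" "t' = act C' T" by (auto simp: orbit_def)
  then have "t + t' = act (\<lambda>x. C x + C' x) T" by (simp add: act_add G_linear)
  then show "t + t' \<in> orbit" using G_add[OF C(1,2)] by (auto simp: orbit_def)
next
  fix c t assume "t \<in> orbit"
  then obtain C where C: "C \<in> G" "t = act C T" by (auto simp: orbit_def)
  then have "c *\<^sub>R t = act (\<lambda>x. c *\<^sub>R C x) T" by (simp add: act_scale G_linear)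
  then show "c *\<^sub>R t \<in> orbit" using G_scale[OF C(1)] by (auto simp: orbit_def)
qed

lemma orbit_L: "t \<in> orbit \<Longrightarrow> t \<in> L"
  by (auto simp: orbit_def act_L T_L)

lemma orbit_orthogonal: "t \<in> orbit \<Longrightarrow> t \<bullet> T = 0"
proof -
  assume "t \<in> orbit"
  then obtain C where C: "C \<in> G" "t = act C T" by (auto simp: orbit_def)
  then show ?thesis using so_V_skew[OF so_V_act[OF G_so[OF C(1)]], of T T] by (simp add: inner_commute)
qed

lemma orbit_invariant: "t \<in> orbit \<Longrightarrow> act (br x) t \<in> orbit"
proof -
  assume "t \<in> orbit"
  then obtain C where C: "C \<in> G" "t = act C T" by (auto simp: orbit_def)
  have "act (lie_br (br x) C) T = act (br x) t - act C (act (br x) T)"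
    by (simp add: act_lie_br[OF ap_bilinear(3) G_linear[OF C(1)]] C(2))
  then have "act (br x) t = act (lie_br (br x) C) T"
    by (simp add: act_self T_Ls linear_0[OF linear_act[OF G_linear[OF C(1)]]])
  then show ?thesis using G_br[OF br_G C(1)] by (auto simp: orbit_def)
qed

text \<open>\<open>act_swap\<close> covers only tensors supported on \<open>s\<close>. Here
  equivariance takes its place: the contraction of C.T with \<open>w\<close> is [C, br w] - br (C
  w), and every \<open>br x\<close> annihilates \<open>T\<close>.\<close>

lemma orbit_swap:
  assumes "t \<in> orbit"
  shows "act (ap t w) T = - act (br w) t"
proof -
  obtain C where C: "C \<in> G" "t = act C T" using assms by (auto simp: orbit_def)
  note lC = G_linear[OF C(1)]
  have "ap t w = (\<lambda>y. lie_br C (br w) y + (-1) *\<^sub>R br (C w) y)"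
    unfolding C(2) ap_act_G[OF C(1)] by simp
  then have "act (ap t w) T = act (lie_br C (br w)) T + act (\<lambda>y. (-1) *\<^sub>R br (C w) y) T"
    by (simp only: act_add[OF linear_lie_br[OF lC ap_bilinear(3)] linear_compose_scale_right[OF ap_bilinear(3)]])
  also have "\<dots> = act (lie_br C (br w)) T - act (br (C w)) T"
    by (simp only: act_scale[OF ap_bilinear(3)]) simp
  also have "\<dots> = - act (br w) t"
    by (simp add: act_lie_br[OF lC ap_bilinear(3)] act_self T_Ls C(2) linear_0[OF linear_act[OF lC]])
  finally show ?thesis .
qed

lemma orbit_contraction_K:
  assumes "t \<in> orbit" "z \<in> K"
  obtains b where "b \<in> s" "ap t z = br b"
proof -
  obtain C where C: "C \<in> G" "t = act C T" using assms by (auto simp: orbit_def)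
  obtain b k where b: "- C z = b + k" "b \<in> s" "k \<in> K" by (rule s_K_decomposition)
  have "ap t z w = br b w" for w
  proof -
    have "ap t z w = br (- C z) w"
      by (simp add: C(2) ap_act[OF G_linear[OF C(1)]] Ls_K(1)[OF T_Ls assms(2)] linear_0[OF G_linear[OF C(1)]])
    then show ?thesis by (simp only: b(1) ap_simps Ls_K(1)[OF T_Ls b(3)]) simp
  qed
  then show ?thesis using that b(2) by blast
qed

text \<open>\<open>F\<close> embeds \<open>s\<close> equivariantly into \<open>orbit\<close>,
  normalised by contraction with \<open>z1\<close>; \<open>K0\<close> is a hyperplane of
  \<open>K\<close> annihilated by the whole copy.\<close>

definition adjoint_copy :: "('a \<Rightarrow> 'a tensor) \<Rightarrow> 'a \<Rightarrow> 'a set \<Rightarrow> bool" where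
  "adjoint_copy F z1 K0 \<longleftrightarrow> (\<forall>u. F u \<in> orbit) \<and> linear F \<and> (\<forall>x u. F (br x u) = act (br x) (F u))
    \<and> z1 \<in> K \<and> (\<forall>u. ap (F u) z1 = br u) \<and> subspace K0 \<and> K0 \<subseteq> K \<and> dim K = dim K0 + 1
    \<and> (\<forall>u. \<forall>z\<in>K0. \<forall>w. ap (F u) z w = 0) \<and> (\<forall>z\<in>K. \<exists>c. \<forall>u. ap (F u) z = (\<lambda>w. c *\<^sub>R br u w))"

text \<open>A minimal \<open>s\<close>-submodule of the orbit is a copy of \<open>s\<close>, and contracting it with the elements
  of \<open>K\<close> gives endomorphisms commuting with \<open>s\<close>, hence scalars.\<close>

lemma adjoint_submodule:
  assumes rank_two and A: "A \<in> G" and x: "x \<in> s" "A x \<notin> s"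
  shows "\<exists>F z1 K0. adjoint_copy F z1 K0"
proof -
  define P where "P M \<longleftrightarrow> subspace M \<and> M \<subseteq> orbit \<and> (\<forall>x. \<forall>t\<in>M. act (br x) t \<in> M) \<and> M \<noteq> {0}" for M
  \<comment> \<open>Such an element lies in \<open>Ls\<close> and is orthogonal to \<open>T\<close>,
    so uniqueness applies.\<close>
  have inj: "t = 0" if t: "t \<in> orbit" "\<And>z w. z \<in> K \<Longrightarrow> ap t z w = 0" for t
    using t by (intro rank_two_unique[OF assms(1)]) (auto simp: Ls_def ker_def orbit_L orbit_orthogonal)
  have "P orbit"
  proof -
    obtain z where z: "z \<in> K" "A x \<bullet> z \<noteq> 0" using x(2) by (auto simp: s_def)
    have Az: "x \<bullet> A z \<noteq> 0" using z(2) G_skew[OF A, of x z] by simp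
    have "A z \<notin> K" using Az x(1) by (auto simp: s_def)
    then obtain w where "br (A z) w \<noteq> 0" by (auto simp: K_def ker_def)
    then have "ap (act A T) z w \<noteq> 0"
      by (simp add: ap_act[OF G_linear[OF A]] Ls_K(1)[OF T_Ls z(1)] linear_0[OF G_linear[OF A]])
    then have "act A T \<noteq> 0" by auto
    moreover have "act A T \<in> orbit" using A by (auto simp: orbit_def)
    ultimately show ?thesis using subspace_orbit orbit_invariant by (auto simp: P_def)
  qed
  then have "\<exists>M. P M \<and> (\<forall>M'. P M' \<longrightarrow> dim M \<le> dim M')" by (rule ex_has_least_nat)
  then obtain M where M: "P M" "\<And>M'. P M' \<Longrightarrow> dim M \<le> dim M'" by metis
  have sM: "subspace M" and MO: "\<And>t. t \<in> M \<Longrightarrow> t \<in> orbit" and Minv: "\<And>x t. t \<in> M \<Longrightarrow> act (br x) t \<in> M"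
    and Mnz: "M \<noteq> {0}"
    using M(1) by (auto simp: P_def)
  obtain t1 where t1: "t1 \<in> M" "t1 \<noteq> 0" using Mnz subspace_0[OF sM] by blast
  obtain z1 w1 where z1: "z1 \<in> K" "ap t1 z1 w1 \<noteq> 0" using inj[OF MO[OF t1(1)]] t1(2) by blast
  have contr: "ap (act (br x) t) z w = br x (ap t z w) - ap t z (br x w)" if "z \<in> K" for x t z w
    using ap_act_br[of x t z w] Ls_K(2)[OF T_Ls that] by simp
  \<comment> \<open>The elements annihilated by \<open>z1\<close> form a proper submodule, which
    minimality of \<open>M\<close> forces to be zero.\<close>
  have uniq: "t = 0" if t: "t \<in> M" "\<And>w. ap t z1 w = 0" for t
  proof -
    define M0 where "M0 = {t \<in> M. \<forall>w. ap t z1 w = 0}"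
    have M0: "subspace M0" "M0 \<subseteq> M" "\<And>x t. t \<in> M0 \<Longrightarrow> act (br x) t \<in> M0"
      using sM Minv contr[OF z1(1)] by (auto simp: M0_def subspace_def)
    have "t1 \<notin> M0" using z1(2) by (auto simp: M0_def)
    then have "M0 \<noteq> M" using t1(1) by blast
    then have "\<not> dim M \<le> dim M0" using subspace_dim_equal[OF M0(1) sM M0(2)] by blast
    then have "\<not> P M0" using M(2) by blast
    then have "M0 = {0}" using M0 MO by (auto simp: P_def)
    then show ?thesis using t by (auto simp: M0_def)
  qed
  have ex: "\<exists>t. t \<in> M \<and> ap t z1 = br u" for u
  proof -
    define W where "W = {b \<in> s. \<exists>t\<in>M. ap t z1 = br b}"
    have "W = s"
    proof -
      obtain b1 where b1: "b1 \<in> s" "ap t1 z1 = br b1" by (rule orbit_contraction_K[OF MO[OF t1(1)] z1(1)])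
      show ?thesis
      proof (rule ideal_eq_s)
        show "subspace W"
        proof (rule subspaceI)
          show "0 \<in> W" using subspace_0[OF sM] subspace_0[OF subspace_s] by (force simp: W_def)
          fix a b assume "a \<in> W" "b \<in> W"
          then obtain t t' where t: "a \<in> s" "b \<in> s" "t \<in> M" "t' \<in> M" "ap t z1 = br a" "ap t' z1 = br b"
            by (auto simp: W_def)
          then have "ap (t + t') z1 = br (a + b)" by (auto simp: fun_eq_iff)
          then show "a + b \<in> W" using t subspace_add[OF sM] subspace_add[OF subspace_s] by (auto simp: W_def)
        next
          fix c a assume "a \<in> W"
          then obtain t where t: "a \<in> s" "t \<in> M" "ap t z1 = br a" by (auto simp: W_def)
          then have "ap (c *\<^sub>R t) z1 = br (c *\<^sub>R a)" by (auto simp: fun_eq_iff)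
          then show "c *\<^sub>R a \<in> W" using t subspace_scale[OF sM] subspace_scale[OF subspace_s] by (auto simp: W_def)
        qed
        show "W \<subseteq> s" by (auto simp: W_def)
        show "b1 \<in> W" using b1 t1(1) by (auto simp: W_def)
        show "b1 \<noteq> 0" using b1 z1(2) by auto
        fix x w assume "w \<in> W"
        then obtain t where t: "w \<in> s" "t \<in> M" "ap t z1 = br w" by (auto simp: W_def)
        have "ap (act (br x) t) z1 = br (br x w)"
          using contr[OF z1(1), of x t] br_jacobi[of x w] t(3) by (auto simp: fun_eq_iff)
        then show "br x w \<in> W" using Minv[OF t(2)] br_s by (auto simp: W_def)
      qed
    qed
    obtain a k where a: "u = a + k" "a \<in> s" "k \<in> K" by (rule s_K_decomposition)
    then have "br u = br a" by (auto simp: Ls_K(1)[OF T_Ls])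
    moreover have "a \<in> W" using a(2) \<open>W = s\<close> by simp
    ultimately show ?thesis by (auto simp: W_def)
  qed
  then obtain F where F: "\<And>u. F u \<in> M" "\<And>u. ap (F u) z1 = br u" by metis
  have F_eq: "F u = t" if "t \<in> M" "ap t z1 = br u" for t u
  proof -
    have "F u - t = 0"
      using F(1)[of u] F(2)[of u] that sM by (intro uniq) (auto simp: subspace_diff)
    then show ?thesis by simp
  qed
  have linF: "linear F"
  proof (rule linearI)
    show "F (a + b) = F a + F b" for a b
      using F sM by (intro F_eq) (auto simp: subspace_add fun_eq_iff)
    show "F (c *\<^sub>R a) = c *\<^sub>R F a" for c a
      using F sM by (intro F_eq) (auto simp: subspace_scale fun_eq_iff)
  qed
  have equiv: "F (br x u) = act (br x) (F u)" for x u
  proof (intro F_eq Minv F(1))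
    show "ap (act (br x) (F u)) z1 = br (br x u)"
      using contr[OF z1(1), of x "F u"] F(2)[of u] br_jacobi[of x u] by (auto simp: fun_eq_iff)
  qed
  have scalar: "\<exists>c. \<forall>u. ap (F u) z = (\<lambda>w. c *\<^sub>R br u w)" if z: "z \<in> K" for z
  proof -
    have "\<exists>b. b \<in> s \<and> ap (F u) z = br b" for u
      using orbit_contraction_K[OF MO[OF F(1)] z] by metis
    then obtain N where N: "\<And>u. N u \<in> s" "\<And>u. ap (F u) z = br (N u)" by metis
    have "linear N"
    proof (rule linearI)
      show "N (a + b) = N a + N b" for a b
        using N subspace_s
        by (intro br_inject) (auto simp: subspace_add fun_eq_iff linear_add[OF linF] simp flip: N(2))
      show "N (c *\<^sub>R a) = c *\<^sub>R N a" for c a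
        using N subspace_s
        by (intro br_inject) (auto simp: subspace_scale fun_eq_iff linear_scale[OF linF] simp flip: N(2))
    qed
    moreover have "N (br x u) = br x (N u)" for x u
    proof (rule br_inject)
      show "br (N (br x u)) = br (br x (N u))"
        using contr[OF z, of x "F u"] N(2)[of "br x u"] N(2)[of u] br_jacobi[of x "N u"]
        by (auto simp: fun_eq_iff equiv)
    qed (auto simp: N br_s)
    ultimately obtain c where c: "\<And>u. u \<in> s \<Longrightarrow> N u = c *\<^sub>R u"
      using commutant_scalar[of N] N(1) by metis
    have "ap (F u) z w = c *\<^sub>R br u w" for u w
    proof -
      obtain a k where a: "u = a + k" "a \<in> s" "k \<in> K" by (rule s_K_decomposition)
      have "F k = 0"
      proof (rule F_eq)
        show "ap 0 z1 = br k" using Ls_K(1)[OF T_Ls a(3)] by auto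
      qed (rule subspace_0[OF sM])
      then have "F u = F a" by (simp add: a(1) linear_add[OF linF])
      then show ?thesis using N(2)[of a] c[OF a(2)] a(1) Ls_K(1)[OF T_Ls a(3)] by simp
    qed
    then show ?thesis by blast
  qed
  define K0 where "K0 = {z \<in> K. \<forall>u w. ap (F u) z w = 0}"
  have K0: "subspace K0" "K0 \<subseteq> K" using subspace_K by (auto simp: K0_def subspace_def)
  have "K = span (insert z1 K0)"
  proof
    show "span (insert z1 K0) \<subseteq> K" using K0 z1(1) subspace_K by (simp add: span_minimal)
    show "K \<subseteq> span (insert z1 K0)"
    proof
      fix z assume z: "z \<in> K"
      obtain c where c: "\<forall>u. ap (F u) z = (\<lambda>w. c *\<^sub>R br u w)" using scalar[OF z] by blast
      then have "z - c *\<^sub>R z1 \<in> K0"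
        using z z1(1) subspace_K F(2) by (simp add: K0_def subspace_diff subspace_scale)
      then show "z \<in> span (insert z1 K0)" unfolding span_breakdown_eq by (blast intro: span_base)
    qed
  qed
  moreover have "z1 \<notin> K0"
  proof
    assume "z1 \<in> K0"
    then have "ap (F u) z1 w = 0" for u w by (simp add: K0_def)
    then have "br u w = 0" for u w by (simp only: F(2))
    then show False using br_values_nonzero by blast
  qed
  ultimately have dimK: "dim K = dim K0 + 1"
    by (simp add: dim_insert span_eq_iff[THEN iffD2, OF K0(1)])
  have "adjoint_copy F z1 K0"
    unfolding adjoint_copy_def
  proof (intro conjI allI ballI)
    show "ap (F u) z w = 0" if "z \<in> K0" for u z w using that by (simp add: K0_def)
  qed (rule MO[OF F(1)] linF equiv z1(1) F(2) K0 dimK scalar | assumption)+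
  then show ?thesis by blast
qed

text \<open>Otherwise the copy of \<open>s\<close> in the orbit contains \<open>F\<close> of [u, a]
  and of [u, [u, a]], with a common kernel subspace of dimension dim K. The first is then a minimal
  tensor in its own right, which is why \<open>uniq\<close> speaks of all of them, and uniqueness
  makes the second a multiple of it. So [u, a] is a real eigenvector of the skew map
  \<open>br u\<close>, with eigenvalue zero, a contradiction.\<close>

lemma invariant_support:
  assumes uniq: "\<And>t. minimal_tensor G t \<Longrightarrow> minimal_tensor.rank_two t"
    and A: "A \<in> G" and x: "x \<in> s"
  shows "A x \<in> s"
proof (rule ccontr)
  assume nx: "A x \<notin> s"
  have r2: rank_two by (rule uniq[OF minimal_tensor_axioms])
  obtain F z1 K0 where copy: "adjoint_copy F z1 K0"
    using adjoint_submodule[OF r2 A x nx] by blast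
  have F: "\<And>u. F u \<in> orbit" "linear F" and equiv: "\<And>x u. F (br x u) = act (br x) (F u)"
    and z1: "z1 \<in> K" "\<And>u. ap (F u) z1 = br u"
    and K0: "subspace K0" "K0 \<subseteq> K" "dim K = dim K0 + 1" "\<And>u z w. z \<in> K0 \<Longrightarrow> ap (F u) z w = 0"
    and scalar: "\<And>z. z \<in> K \<Longrightarrow> \<exists>c. \<forall>u. ap (F u) z = (\<lambda>w. c *\<^sub>R br u w)"
    using copy unfolding adjoint_copy_def by blast+
  have F0: "F 0 = 0" by (rule linear_0[OF F(2)])
  note FL = orbit_L[OF F(1)]
  obtain H u x where hux: "H \<in> s" "u \<in> s" "x \<in> s" "H \<noteq> 0" "br u H = 0" "br H x = 0" "br u x \<noteq> 0"
    by (rule rank_two_commuting[OF r2])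
  have Hu: "br H u = 0" using br_swap[of H u] hux by simp
  \<comment> \<open>As [H, u] = 0, equivariance makes \<open>F u\<close> invariant under
    \<open>H\<close>, and \<open>orbit_swap\<close> turns its contraction with \<open>H\<close> into
    a derivation.\<close>
  obtain y where y: "y \<in> s" "ap (F u) H = br y"
  proof (rule derivation_inner[of "ap (F u) H"])
    show so: "so_V (ap (F u) H)" by (rule G_so[OF L_G[OF FL]])
    show DK: "ap (F u) H z = 0" if z: "z \<in> K" for z
    proof -
      obtain c where "\<forall>u. ap (F u) z = (\<lambda>w. c *\<^sub>R br u w)" using scalar[OF z] by blast
      then show ?thesis using L_swap[OF FL, of u H z] hux(5) by simp
    qed
    show "ap (F u) H w \<in> s" for w
      by (auto simp: s_def L_skew[OF FL] DK)
    show "act (ap (F u) H) T = 0"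
      using orbit_swap[OF F(1), of u H] equiv[of H u] Hu F0 by simp
  qed
  have uy: "br u y = 0"
  proof -
    have "br (br u y) w = 0" for w
      using ap_act_br[of u "F u" H w] equiv[of u u] F0 y(2) hux(5) br_jacobi[of u y w] by simp
    then have "br u y \<in> K" by (simp add: K_def ker_def)
    then show ?thesis using s_K br_s by blast
  qed
  have yH: "br y H = 0" using y(2) L_self[OF FL, of u H] by simp
  have Hy: "br H y = 0" using br_swap[of H y] yH by simp
  define C where "C = {a \<in> s. br H a = 0}"
  have C: "subspace C" using subspace_s by (auto simp: C_def subspace_def)
  have Cinv: "br u a \<in> C" "br y a \<in> C" if "a \<in> C" for a
    using that br_jacobi[of H u a] br_jacobi[of H y a] Hu Hy by (simp_all add: C_def br_s)
  have com: "br u (br y a) = br y (br u a)" for a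
    using br_jacobi[of u y a] uy by simp
  define S where "S = br u ` C"
  have S: "subspace S" unfolding S_def by (intro linear_subspace_image ap_bilinear C)
  have Sinv: "br u a \<in> S" "br y a \<in> S" if a: "a \<in> S" for a
  proof -
    obtain c where c: "c \<in> C" "a = br u c" using a by (auto simp: S_def)
    show "br u a \<in> S" unfolding S_def c(2) by (intro imageI Cinv c)
    show "br y a \<in> S" unfolding S_def c(2) com[symmetric] by (intro imageI Cinv c)
  qed
  have "br u x \<in> S" using hux by (simp add: S_def C_def)
  then obtain p q a where a: "(p, q) \<noteq> (0, 0)" "a \<in> S" "a \<noteq> 0" "p *\<^sub>R br u a + q *\<^sub>R br y a = 0"
    using commuting_skew_kernel[OF so_V_br[of u] so_V_br[of y] S Sinv com _ hux(7)] by metis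
  have ua: "br u a \<noteq> 0" using a(2,3) skew_square_zero[OF so_V_br] by (auto simp: S_def)
  then have uua: "br u (br u a) \<noteq> 0" using skew_square_zero[OF so_V_br] by blast
  have q: "q \<noteq> 0" using ua a(1,4) by auto
  define \<eta> where "\<eta> = - p / q"
  have ya: "br y a = \<eta> *\<^sub>R br u a"
  proof -
    have "q *\<^sub>R br y a = - (p *\<^sub>R br u a)" using a(4) by (simp add: eq_neg_iff_add_eq_0 add.commute)
    then have "(1 / q) *\<^sub>R (q *\<^sub>R br y a) = (1 / q) *\<^sub>R (- (p *\<^sub>R br u a))" by (rule arg_cong)
    then show ?thesis using q by (simp add: \<eta>_def)
  qed
  have SC: "S \<subseteq> C" using Cinv by (auto simp: S_def)
  \<comment> \<open>For \<open>b\<close> as below, \<open>F\<close> of [u, b] contracts with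
    \<open>H\<close> to eta times \<open>br [u, b]\<close> and with \<open>z1\<close> to
    \<open>br [u, b]\<close>, so this combination lies in the kernel.\<close>
  define z0 where "z0 = H - \<eta> *\<^sub>R z1"
  have kill: "ap (F (br u b)) z0 w = 0" if b: "b \<in> C" "br y b = \<eta> *\<^sub>R br u b" for b w
  proof -
    have bH: "br b H = 0" using b(1) br_swap[of b H] by (simp add: C_def)
    have bu: "br b u = - br u b" "br b y = - br y b" by (rule br_swap)+
    have "ap (F (br b u)) H w = br (br b y) w"
      using ap_act_br[of b "F u" H w] equiv[of b u] y(2) bH br_jacobi[of b y w] by simp
    then have "ap (F (br u b)) H w = \<eta> *\<^sub>R br (br u b) w"
      unfolding bu linear_neg[OF F(2)] by (simp add: b(2))
    then show ?thesis by (simp add: z0_def z1(2))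
  qed
  define t1 t2 where "t1 = F (br u a)" and "t2 = F (br u (br u a))"
  have aC: "a \<in> C" using a(2) SC by blast
  have kill1: "ap t1 z0 w = 0" for w unfolding t1_def by (rule kill[OF aC ya])
  have kill2: "ap t2 z0 w = 0" for w
    unfolding t2_def by (rule kill) (use Cinv aC ya com[of a] in simp_all)
  have t12: "t1 \<in> L" "t2 \<in> L" by (simp_all add: t1_def t2_def FL)
  have "br u a \<in> s" by (rule br_s)
  then obtain w where "br (br u a) w \<noteq> 0" using br_nonzero ua by blast
  then have "ap t1 z1 w \<noteq> 0" unfolding t1_def z1(2) .
  then have t1nz: "t1 \<noteq> 0" by auto
  have z0K: "z0 \<notin> K"
  proof
    assume "z0 \<in> K"
    then have "z0 + \<eta> *\<^sub>R z1 \<in> K" using subspace_K z1(1) by (simp add: subspace_add subspace_scale)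
    then have "H \<in> K" by (simp add: z0_def)
    then show False using hux s_K by blast
  qed
  define K' where "K' = span (insert z0 K0)"
  have "dim K' = dim K"
    using z0K K0(2,3) by (auto simp: K'_def dim_insert span_eq_iff[THEN iffD2, OF K0(1)])
  have "insert z0 K0 \<subseteq> ker t1" "insert z0 K0 \<subseteq> ker t2"
    using kill1 kill2 K0(4) by (auto simp: ker_def t1_def t2_def)
  then have K'_ker: "K' \<subseteq> ker t1" "K' \<subseteq> ker t2"
    unfolding K'_def by (simp_all only: span_minimal subspace_ker)
  have "dim (ker t1) \<le> dim K'" using minimal[OF t12(1) t1nz] \<open>dim K' = dim K\<close> by (simp add: K_def)
  then have ker1: "ker t1 = K'"
    using subspace_dim_equal[of K' "ker t1"] K'_ker subspace_ker by (auto simp: K'_def)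
  have m1: "minimal_tensor G t1"
  proof
    show "dim (ker t) \<le> dim (ker t1)" if "t \<in> L" "t \<noteq> 0" for t
      using minimal[OF that] ker1 \<open>dim K' = dim K\<close> by (simp add: K_def)
  qed (use t12 t1nz in auto)
  define c where "c = (t2 \<bullet> t1) / (t1 \<bullet> t1)"
  have "t2 - c *\<^sub>R t1 = 0"
  proof (rule minimal_tensor_rank_two_unique[OF m1 uniq[OF m1]])
    show "t2 - c *\<^sub>R t1 \<in> L" using t12 subspace_L by (simp add: subspace_diff subspace_scale)
    show "ker t1 \<subseteq> ker (t2 - c *\<^sub>R t1)" using K'_ker ker1 by (auto simp: ker_def)
    show "(t2 - c *\<^sub>R t1) \<bullet> t1 = 0" using t1nz by (simp add: c_def inner_diff_left)
  qed
  then have "br (br u (br u a)) = br (c *\<^sub>R br u a)"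
    using z1(2)[of "br u (br u a)"] z1(2)[of "br u a"] by (auto simp: t1_def t2_def fun_eq_iff)
  then have "br u (br u a) = c *\<^sub>R br u a"
    by (intro br_inject) (auto simp: br_s subspace_scale subspace_s)
  moreover have "br u (br u a) \<bullet> br u a = 0"
    using br_skew[of u "br u a" "br u a"] by (simp add: inner_commute)
  ultimately have "c * (br u a \<bullet> br u a) = 0" by simp
  then show False using ua uua \<open>br u (br u a) = c *\<^sub>R br u a\<close> by simp
qed

lemma s_projection:
  obtains \<pi> where "linear \<pi>" "\<And>x. \<pi> x \<in> s" "\<And>x. x \<in> s \<Longrightarrow> \<pi> x = x"
    "\<And>x y. \<pi> x \<bullet> y = x \<bullet> \<pi> y" "\<And>x. x - \<pi> x \<in> K"
proof -
  obtain \<pi> where \<pi>: "linear \<pi>" "\<And>x. \<pi> x \<in> s" "\<And>x. x \<in> s \<Longrightarrow> \<pi> x = x"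
    "\<And>x y. \<pi> x \<bullet> y = x \<bullet> \<pi> y"
    using orthogonal_projection_exists[OF subspace_s] by metis
  have "x - \<pi> x \<in> K" for x
  proof -
    obtain y z where yz: "x = y + z" "y \<in> s" "z \<in> K" by (rule s_K_decomposition)
    have "\<pi> z \<bullet> \<pi> z = 0"
      using \<pi>(2)[of z] \<pi>(3)[OF \<pi>(2), of z] \<pi>(4)[of z "\<pi> z"] yz(3) by (auto simp: s_def inner_commute)
    then show ?thesis using yz by (simp add: linear_add[OF \<pi>(1)] \<pi>(3))
  qed
  then show ?thesis using that \<pi> by blast
qed

text \<open>\<open>A\<close> preserves \<open>s\<close> and by skewness also \<open>K\<close>. Hence
  A.T is supported on \<open>s\<close> and orthogonal to \<open>T\<close>, so it vanishes and
  \<open>A\<close> is a derivation. Composing with the projection onto \<open>s\<close> makes it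
  vanish on \<open>K\<close>, as \<open>derivation_inner\<close> requires.\<close>

lemma restriction_inner:
  assumes uniq: "\<And>t. minimal_tensor G t \<Longrightarrow> minimal_tensor.rank_two t" and A: "A \<in> G"
  obtains y where "y \<in> s" "\<And>x. x \<in> s \<Longrightarrow> A x = br y x"
proof -
  note lA = G_linear[OF A]
  have As: "A x \<in> s" if "x \<in> s" for x using invariant_support[OF uniq A that] .
  have AK: "br (A z) w = 0" if z: "z \<in> K" for z w
  proof -
    obtain a k where a: "A z = a + k" "a \<in> s" "k \<in> K" by (rule s_K_decomposition)
    have "A z \<bullet> a = 0" using G_skew[OF A, of z a] As[OF a(2)] z by (auto simp: s_def inner_commute)
    moreover have "k \<bullet> a = 0" using a by (auto simp: s_def inner_commute)
    ultimately have "a = 0" using a(1) by (simp add: inner_add_left)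
    then show ?thesis using a Ls_K(1)[OF T_Ls] by simp
  qed
  have inv: "act A T = 0"
  proof (rule rank_two_unique[OF uniq[OF minimal_tensor_axioms]])
    show "act A T \<in> Ls"
      using act_L[OF A T_L] AK Ls_K(1)[OF T_Ls]
      by (auto simp: Ls_def ker_def ap_act[OF lA] linear_0[OF lA])
    show "act A T \<bullet> T = 0" by (rule orbit_orthogonal) (use A in \<open>auto simp: orbit_def\<close>)
  qed
  obtain \<pi> where \<pi>: "linear \<pi>" "\<And>x. \<pi> x \<in> s" "\<And>x. x \<in> s \<Longrightarrow> \<pi> x = x"
    "\<And>x y. \<pi> x \<bullet> y = x \<bullet> \<pi> y" "\<And>x. x - \<pi> x \<in> K"
    using s_projection by metis
  define D where "D x = A (\<pi> x)" for x
  have lD: "linear D" unfolding D_def using linear_compose[OF \<pi>(1) lA] by (simp add: o_def)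
  have orth: "a \<bullet> b = a \<bullet> \<pi> b" if "a \<in> s" for a b
    using \<pi>(3)[OF that] \<pi>(4)[of a b] by simp
  have soD: "so_V D"
    unfolding so_V_def
  proof (intro conjI allI lD)
    fix x y
    have "D x \<bullet> y = A (\<pi> x) \<bullet> \<pi> y" unfolding D_def by (rule orth[OF As[OF \<pi>(2)]])
    also have "\<dots> = - (A (\<pi> y) \<bullet> \<pi> x)" using G_skew[OF A, of "\<pi> x" "\<pi> y"] by (simp add: inner_commute)
    also have "A (\<pi> y) \<bullet> \<pi> x = D y \<bullet> x" unfolding D_def by (rule orth[OF As[OF \<pi>(2)], symmetric])
    finally show "D x \<bullet> y = - (x \<bullet> D y)" by (simp add: inner_commute)
  qed
  have DK: "D z = 0" if z: "z \<in> K" for z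
  proof -
    have "\<pi> z \<bullet> \<pi> z = 0"
      using \<pi>(2)[of z] \<pi>(3)[OF \<pi>(2), of z] \<pi>(4)[of z "\<pi> z"] z by (auto simp: s_def inner_commute)
    then show ?thesis by (simp add: D_def linear_0[OF lA])
  qed
  have "act D T = 0"
  proof (rule tensor_eqI)
    fix x y
    have red: "br x = br (\<pi> x)" for x using Ls_K(1)[OF T_Ls \<pi>(5)[of x]] by auto
    have red2: "br x y = br x (\<pi> y)" for x y using Ls_K(2)[OF T_Ls \<pi>(5)[of y], of x] by simp
    have "ap (act D T) x y = A (br (\<pi> x) (\<pi> y)) - br (A (\<pi> x)) (\<pi> y) - br (\<pi> x) (A (\<pi> y))"
      unfolding ap_act[OF lD] D_def
      using \<pi>(3)[OF br_s] red[of x] red2[of _ y] by simp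
    also have "\<dots> = ap (act A T) (\<pi> x) (\<pi> y)" by (simp add: ap_act[OF lA])
    finally show "ap (act D T) x y = ap 0 x y" using inv by simp
  qed
  moreover have "D x \<in> s" for x unfolding D_def by (rule As[OF \<pi>(2)])
  ultimately obtain y where y: "y \<in> s" "D = br y"
    using derivation_inner[OF soD _ DK] by blast
  have "A x = br y x" if "x \<in> s" for x
    using fun_cong[OF y(2), of x] \<pi>(3)[OF that] by (simp add: D_def)
  then show ?thesis using that[OF y(1)] by blast
qed

end

section \<open>Splitting off factors\<close>

text \<open>The image lies in \<open>U\<close> and the orthogonal complement is killed; for linear
  maps this yields faithfulness on \<open>U\<close> and triviality on every subspace orthogonal to
  it.\<close>

definition supported :: "'a::euclidean_space set \<Rightarrow> ('a \<Rightarrow> 'a) set \<Rightarrow> bool" where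
  "supported U g \<longleftrightarrow> (\<forall>A\<in>g. \<forall>x. A x \<in> U \<and> ((\<forall>u\<in>U. x \<bullet> u = 0) \<longrightarrow> A x = 0))"

definition lie_closed :: "('a::real_vector \<Rightarrow> 'a) set \<Rightarrow> bool" where
  "lie_closed g \<longleftrightarrow> endo_subspace g \<and> (\<forall>A\<in>g. \<forall>B\<in>g. lie_br A B \<in> g)"

definition good_type :: "('a::euclidean_space \<Rightarrow> 'a) set \<Rightarrow> 'a set \<Rightarrow> bool" where
  "good_type g U \<longleftrightarrow> type_full_so g U \<or> type_adjoint g U \<or> skew_prolong_zero g U"

text \<open>Relative to an ambient \<open>W\<close>, for the sake of the induction. Commutation,
  trace orthogonality and uniqueness of components are left out because they follow from the
  orthogonality of the supports.\<close>

definition splits :: "'a::euclidean_space set \<Rightarrow> ('a \<Rightarrow> 'a) set \<Rightarrow> bool" where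
  "splits W G \<longleftrightarrow> (\<exists>(n::nat) U g.
     (\<forall>j<n. subspace (U j) \<and> U j \<subseteq> W)
   \<and> (\<forall>i<n. \<forall>j<n. i \<noteq> j \<longrightarrow> (\<forall>x\<in>U i. \<forall>y\<in>U j. x \<bullet> y = 0))
   \<and> (\<forall>v\<in>W. \<exists>w. (\<forall>j<n. w j \<in> U j) \<and> v = (\<Sum>j<n. w j))
   \<and> (\<forall>j<n. g j \<subseteq> G \<and> lie_closed (g j) \<and> supported (U j) (g j) \<and> good_type (g j) (U j))
   \<and> (\<forall>A\<in>G. \<exists>As. (\<forall>j<n. As j \<in> g j) \<and> A = (\<lambda>x. \<Sum>j<n. As j x)))"

lemma splits_single:
  assumes "subspace W" "lie_closed G" "supported W G" "good_type G W"
  shows "splits W G"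
  unfolding splits_def
proof (intro exI conjI)
  show "\<forall>v\<in>W. \<exists>w. (\<forall>j<Suc 0. w j \<in> W) \<and> v = (\<Sum>j<Suc 0. w j)"
  proof
    fix v assume "v \<in> W"
    then show "\<exists>w. (\<forall>j<Suc 0. w j \<in> W) \<and> v = (\<Sum>j<Suc 0. w j)"
      by (intro exI[of _ "\<lambda>_. v"]) simp
  qed
  show "\<forall>A\<in>G. \<exists>As. (\<forall>j<Suc 0. As j \<in> G) \<and> A = (\<lambda>x. \<Sum>j<Suc 0. As j x)"
  proof
    fix A assume "A \<in> G"
    then show "\<exists>As. (\<forall>j<Suc 0. As j \<in> G) \<and> A = (\<lambda>x. \<Sum>j<Suc 0. As j x)"
      by (intro exI[of _ "\<lambda>_. A"]) simp
  qed
qed (use assms in auto)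

lemma splits_insert:
  assumes split: "splits W' G'" and W': "W' \<subseteq> W"
    and U: "subspace U" "U \<subseteq> W" "\<And>x u. x \<in> W' \<Longrightarrow> u \<in> U \<Longrightarrow> x \<bullet> u = 0"
    and dec: "\<And>v. v \<in> W \<Longrightarrow> \<exists>a\<in>U. \<exists>b\<in>W'. v = a + b"
    and g0: "g0 \<subseteq> G" "lie_closed g0" "supported U g0" "good_type g0 U" and G': "G' \<subseteq> G"
    and G_dec: "\<And>A. A \<in> G \<Longrightarrow> \<exists>B\<in>g0. \<exists>C\<in>G'. A = (\<lambda>x. B x + C x)"
  shows "splits W G"
proof -
  obtain n :: nat and V g where
    V: "\<forall>j<n. subspace (V j) \<and> V j \<subseteq> W'"
      "\<forall>i<n. \<forall>j<n. i \<noteq> j \<longrightarrow> (\<forall>x\<in>V i. \<forall>y\<in>V j. x \<bullet> y = 0)"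
      "\<forall>v\<in>W'. \<exists>w. (\<forall>j<n. w j \<in> V j) \<and> v = (\<Sum>j<n. w j)"
    and g: "\<forall>j<n. g j \<subseteq> G' \<and> lie_closed (g j) \<and> supported (V j) (g j) \<and> good_type (g j) (V j)"
      "\<forall>A\<in>G'. \<exists>As. (\<forall>j<n. As j \<in> g j) \<and> A = (\<lambda>x. \<Sum>j<n. As j x)"
    using split unfolding splits_def by blast
  define V' where "V' = V(n := U)"
  define g' where "g' = g(n := g0)"
  show ?thesis
    unfolding splits_def
  proof (rule exI[of _ "Suc n"], rule exI[of _ V'], rule exI[of _ g'], intro conjI)
    show "\<forall>j<Suc n. subspace (V' j) \<and> V' j \<subseteq> W"
    proof (intro allI impI)
      fix j assume "j < Suc n"
      then have "V' j = U \<or> j < n \<and> V' j = V j" by (auto simp: V'_def)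
      then show "subspace (V' j) \<and> V' j \<subseteq> W" using V(1) U(1,2) W' by (metis subset_trans)
    qed
    show "\<forall>i<Suc n. \<forall>j<Suc n. i \<noteq> j \<longrightarrow> (\<forall>x\<in>V' i. \<forall>y\<in>V' j. x \<bullet> y = 0)"
    proof (intro allI impI ballI)
      fix i j x y assume ij: "i < Suc n" "j < Suc n" "i \<noteq> j" and xy: "x \<in> V' i" "y \<in> V' j"
      consider "i < n" "j < n" | "i = n" "j < n" | "i < n" "j = n" using ij by linarith
      then show "x \<bullet> y = 0"
      proof cases
        case 1
        then show ?thesis using V(2) ij(3) xy by (auto simp: V'_def)
      next
        case 2
        then have "x \<in> U" "y \<in> W'" using V(1) xy by (auto simp: V'_def)
        then have "y \<bullet> x = 0" using U(3) by blast
        then show ?thesis by (simp add: inner_commute)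
      next
        case 3
        then have "y \<in> U" "x \<in> W'" using V(1) xy by (auto simp: V'_def)
        then show ?thesis using U(3) by simp
      qed
    qed
    show "\<forall>v\<in>W. \<exists>w. (\<forall>j<Suc n. w j \<in> V' j) \<and> v = (\<Sum>j<Suc n. w j)"
    proof
      fix v assume "v \<in> W"
      then obtain a b where ab: "a \<in> U" "b \<in> W'" "v = a + b" using dec by blast
      then obtain w where w: "\<forall>j<n. w j \<in> V j" "b = (\<Sum>j<n. w j)" using V(3) by blast
      show "\<exists>w. (\<forall>j<Suc n. w j \<in> V' j) \<and> v = (\<Sum>j<Suc n. w j)"
        by (rule exI[of _ "w(n := a)"]) (use w ab in \<open>auto simp: V'_def less_Suc_eq add.commute\<close>)
    qed
    show "\<forall>j<Suc n. g' j \<subseteq> G \<and> lie_closed (g' j) \<and> supported (V' j) (g' j) \<and> good_type (g' j) (V' j)"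
      using g(1) g0 G' by (auto simp: V'_def g'_def less_Suc_eq)
    show "\<forall>A\<in>G. \<exists>As. (\<forall>j<Suc n. As j \<in> g' j) \<and> A = (\<lambda>x. \<Sum>j<Suc n. As j x)"
    proof
      fix A assume "A \<in> G"
      then obtain B C where BC: "B \<in> g0" "C \<in> G'" "A = (\<lambda>x. B x + C x)" using G_dec by blast
      then obtain As where As: "\<forall>j<n. As j \<in> g j" "C = (\<lambda>x. \<Sum>j<n. As j x)" using g(2) by blast
      show "\<exists>As. (\<forall>j<Suc n. As j \<in> g' j) \<and> A = (\<lambda>x. \<Sum>j<Suc n. As j x)"
        by (rule exI[of _ "As(n := B)"]) (use As BC in \<open>auto simp: g'_def less_Suc_eq add.commute\<close>)
    qed
  qed
qed

text \<open>The image of a skew map is orthogonal to its kernel, so half of \<open>supported\<close>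
  implies the other.\<close>

lemma skew_values_in_support:
  assumes "so_V A" "subspace W" "\<And>x. (\<And>w. w \<in> W \<Longrightarrow> x \<bullet> w = 0) \<Longrightarrow> A x = 0"
  shows "A x \<in> W"
proof -
  obtain y z where yz: "A x = y + z" "y \<in> W" "\<And>w. w \<in> W \<Longrightarrow> z \<bullet> w = 0"
    using orthogonal_decomposition[OF assms(2)] by metis
  have "A z = 0" by (rule assms(3)[OF yz(3)])
  then have "A x \<bullet> z = 0" using so_V_skew[OF assms(1), of x z] by simp
  moreover have "y \<bullet> z = 0" using yz(3)[OF yz(2)] by (simp add: inner_commute)
  ultimately have "z = 0" using yz(1) by (simp add: inner_add_left)
  then show ?thesis using yz by simp
qed

lemma supportedI:
  assumes "\<And>A. A \<in> g \<Longrightarrow> so_V A" "subspace W"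
    and "\<And>A x. A \<in> g \<Longrightarrow> (\<And>w. w \<in> W \<Longrightarrow> x \<bullet> w = 0) \<Longrightarrow> A x = 0"
  shows "supported W g"
  unfolding supported_def using skew_values_in_support[OF assms(1,2)] assms(3) by blast

definition so_block :: "'a::euclidean_space set \<Rightarrow> ('a \<Rightarrow> 'a) set" where
  "so_block U = {A. so_V A \<and> (\<forall>x. (\<forall>u\<in>U. x \<bullet> u = 0) \<longrightarrow> A x = 0)}"

lemma supported_so_block: "subspace U \<Longrightarrow> supported U (so_block U)"
  by (rule supportedI) (auto simp: so_block_def)

lemma so_V_add: "so_V A \<Longrightarrow> so_V B \<Longrightarrow> so_V (\<lambda>x. A x + B x)"
  and so_V_scale: "so_V A \<Longrightarrow> so_V (\<lambda>x. c *\<^sub>R A x)"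
  and so_V_zero: "so_V (\<lambda>_. 0)"
  by (auto simp: so_V_def linear_compose_add linear_compose_scale_right linear_zero inner_add_left
      inner_add_right)

lemma so_V_lie_br:
  assumes A: "so_V A" and B: "so_V B"
  shows "so_V (lie_br A B)"
  unfolding so_V_def
proof (intro conjI allI linear_lie_br so_V_linear A B)
  fix x y
  show "lie_br A B x \<bullet> y = - (x \<bullet> lie_br A B y)"
    using so_V_skew[OF A, of "B x" y] so_V_skew[OF B, of "A x" y] so_V_skew[OF A, of x "B y"]
      so_V_skew[OF B, of x "A y"]
    by (simp add: lie_br_def inner_diff_left inner_diff_right)
qed

lemma lie_closed_so_block: "lie_closed (so_block U)"
proof -
  have "lie_br A B x = 0" if "so_V A" "so_V B" "A x = 0" "B x = 0" for A B :: "'a \<Rightarrow> 'a" and x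
    using that by (simp add: lie_br_def linear_0 so_V_linear)
  then show ?thesis
    unfolding lie_closed_def endo_subspace_def so_block_def
    by (auto simp: so_V_add so_V_scale so_V_zero so_V_lie_br)
qed

lemma type_full_so_block:
  assumes U: "subspace U"
  shows "type_full_so (so_block U) U"
  unfolding type_full_so_def
proof (intro allI impI)
  fix f assume f: "so_on U f"
  obtain \<pi> where \<pi>: "linear \<pi>" "\<And>x. \<pi> x \<in> U" "\<And>x. x \<in> U \<Longrightarrow> \<pi> x = x"
    "\<And>x y. \<pi> x \<bullet> y = x \<bullet> \<pi> y" "\<And>x w. w \<in> U \<Longrightarrow> (x - \<pi> x) \<bullet> w = 0"
    using orthogonal_projection_exists[OF U] by metis
  have orth: "a \<bullet> b = a \<bullet> \<pi> b" if "a \<in> U" for a b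
    using \<pi>(3)[OF that] \<pi>(4)[of a b] by simp
  have fU: "f (\<pi> x) \<in> U" for x using f \<pi>(2) by (auto simp: so_on_def)
  define A where "A x = f (\<pi> x)" for x
  have "linear A"
    using f \<pi>(2)
    by (intro linearI) (auto simp: A_def so_on_def linear_add[OF \<pi>(1)] linear_scale[OF \<pi>(1)])
  moreover have "A x \<bullet> y = - (x \<bullet> A y)" for x y
  proof -
    have "f (\<pi> x) \<bullet> \<pi> y = - (\<pi> x \<bullet> f (\<pi> y))" using f \<pi>(2) by (auto simp: so_on_def)
    then show ?thesis using orth[OF fU, of x y] orth[OF fU, of y x] by (simp add: A_def inner_commute)
  qed
  moreover have "A x = 0" if x: "\<forall>u\<in>U. x \<bullet> u = 0" for x
  proof -
    have "\<pi> x \<bullet> \<pi> x = 0" using \<pi>(4)[of x "\<pi> x"] \<pi>(3)[OF \<pi>(2), of x] \<pi>(2)[of x] x by simp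
    moreover have "f 0 = 0" using f subspace_0[OF U] unfolding so_on_def by (metis scaleR_zero_left)
    ultimately show ?thesis by (simp add: A_def)
  qed
  ultimately have "A \<in> so_block U" by (simp add: so_block_def so_V_def)
  moreover have "\<forall>w\<in>U. A w = f w" by (simp add: A_def \<pi>(3))
  ultimately show "\<exists>A\<in>so_block U. \<forall>w\<in>U. A w = f w" by blast
qed

context lie_so
begin

text \<open>\<open>A\<close> is half the sum of the bivectors \<open>rot (\<pi> b) (A b)\<close>
  over the standard basis; by skewness both terms of \<open>rot\<close> contribute \<open>A\<close>
  once.\<close>

lemma so_block_subset:
  assumes U: "subspace U" and rot: "\<And>x y. x \<in> U \<Longrightarrow> y \<in> U \<Longrightarrow> rot x y \<in> G"
  shows "so_block U \<subseteq> G"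
proof
  fix A assume A: "A \<in> so_block U"
  then have so: "so_V A" and lA: "linear A" by (auto simp: so_block_def so_V_linear)
  have AU: "A x \<in> U" for x using supported_so_block[OF U] A by (auto simp: supported_def)
  obtain \<pi> where \<pi>: "linear \<pi>" "\<And>x. \<pi> x \<in> U" "\<And>x. x \<in> U \<Longrightarrow> \<pi> x = x"
    "\<And>x y. \<pi> x \<bullet> y = x \<bullet> \<pi> y" "\<And>x w. w \<in> U \<Longrightarrow> (x - \<pi> x) \<bullet> w = 0"
    using orthogonal_projection_exists[OF U] by metis
  have A\<pi>: "A (\<pi> x) = A x" for x
  proof -
    have "A (x - \<pi> x) = 0" using A \<pi>(5) by (auto simp: so_block_def)
    then show ?thesis by (simp add: linear_diff[OF lA])
  qed
  have "(\<lambda>w. (1/2) *\<^sub>R (\<Sum>b\<in>Basis. rot (\<pi> b) (A b) w)) \<in> G"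
    by (intro G_scale G_sum rot \<pi>(2) AU)
  moreover have "(1/2) *\<^sub>R (\<Sum>b\<in>Basis. rot (\<pi> b) (A b) w) = A w" for w
  proof -
    have "(\<Sum>b\<in>Basis. (\<pi> b \<bullet> w) *\<^sub>R A b) = A w"
    proof -
      have "\<pi> b \<bullet> w = \<pi> w \<bullet> b" for b using \<pi>(4)[of b w] by (simp add: inner_commute)
      then show ?thesis using linear_sum_basis[OF lA, of "\<pi> w"] by (simp add: A\<pi>)
    qed
    moreover have "(\<Sum>b\<in>Basis. (A b \<bullet> w) *\<^sub>R \<pi> b) = - A w"
    proof -
      have "(\<Sum>b\<in>Basis. (A b \<bullet> w) *\<^sub>R \<pi> b) = - (\<Sum>b\<in>Basis. (A w \<bullet> b) *\<^sub>R \<pi> b)"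
        by (simp add: so_V_skew[OF so, of _ w] inner_commute[of _ "A w"] sum_negf)
      then show ?thesis using linear_sum_basis[OF \<pi>(1), of "A w"] \<pi>(3)[OF AU] by simp
    qed
    ultimately show ?thesis by (simp add: rot_def sum_subtractf flip: scaleR_2)
  qed
  ultimately show "A \<in> G" by simp
qed

text \<open>A form on \<open>W\<close> is extended through the projection. The endomorphisms chosen
  for each x are determined by the form, since \<open>G\<close> is supported on \<open>W\<close>;
  linearity in x is thus automatic despite the choice.\<close>

lemma no_tensor_skew_prolong_zero:
  assumes W: "subspace W" and sup: "supported W G" and L0: "\<And>t. t \<in> L \<Longrightarrow> t = 0"
  shows "skew_prolong_zero G W"
  unfolding skew_prolong_zero_def
proof (intro allI impI)
  fix S :: "'a \<Rightarrow> 'a \<Rightarrow> 'a \<Rightarrow> real"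
  assume S: "alt3_on W S \<and> (\<forall>X\<in>W. \<exists>A\<in>G. \<forall>u\<in>W. \<forall>v\<in>W. S X u v = A u \<bullet> v)"
  then have S1: "\<And>x x' y z. x \<in> W \<Longrightarrow> x' \<in> W \<Longrightarrow> y \<in> W \<Longrightarrow> z \<in> W \<Longrightarrow> S (x + x') y z = S x y z + S x' y z"
    and S2: "\<And>c x y z. x \<in> W \<Longrightarrow> y \<in> W \<Longrightarrow> z \<in> W \<Longrightarrow> S (c *\<^sub>R x) y z = c * S x y z"
    and S3: "\<And>x y z. x \<in> W \<Longrightarrow> y \<in> W \<Longrightarrow> z \<in> W \<Longrightarrow> S x y z = - S y x z"
    unfolding alt3_on_def by blast+
  obtain \<pi> where \<pi>: "linear \<pi>" "\<And>x. \<pi> x \<in> W" "\<And>x. x \<in> W \<Longrightarrow> \<pi> x = x"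
    "\<And>x y. \<pi> x \<bullet> y = x \<bullet> \<pi> y" "\<And>x w. w \<in> W \<Longrightarrow> (x - \<pi> x) \<bullet> w = 0"
    using orthogonal_projection_exists[OF W] by metis
  have "\<exists>A\<in>G. \<forall>u\<in>W. \<forall>v\<in>W. S (\<pi> x) u v = A u \<bullet> v" for x using S \<pi>(2) by blast
  then obtain F where F: "\<And>x. F x \<in> G" "\<And>x u v. u \<in> W \<Longrightarrow> v \<in> W \<Longrightarrow> S (\<pi> x) u v = F x u \<bullet> v"
    by metis
  have val: "F x y \<bullet> v = S (\<pi> x) (\<pi> y) (\<pi> v)" for x y v
  proof -
    have "F x (y - \<pi> y) = 0" using sup F(1) \<pi>(5) by (auto simp: supported_def)
    then have "F x y = F x (\<pi> y)" by (simp add: linear_diff[OF G_linear[OF F(1)]])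
    moreover have "F x (\<pi> y) \<in> W" using sup F(1) by (auto simp: supported_def)
    then have "F x (\<pi> y) \<bullet> v = F x (\<pi> y) \<bullet> \<pi> v"
      using \<pi>(3)[of "F x (\<pi> y)"] \<pi>(4)[of "F x (\<pi> y)" v] by simp
    ultimately show ?thesis using F(2)[OF \<pi>(2) \<pi>(2), of x y v] by simp
  qed
  have eqI: "a = b" if "\<And>v. a \<bullet> v = b \<bullet> v" for a b :: 'a
    using that by (metis inner_commute vector_eq_ldot)
  define t where "t = enc F"
  have t: "ap t x y = F x y" for x y
    unfolding t_def
  proof (rule ap_enc)
    show "linear (F x)" for x by (rule G_linear[OF F(1)])
    show "linear (\<lambda>x. F x y)" for y
    proof (rule linearI)
      show "F (a + b) y = F a y + F b y" for a b
        by (rule eqI) (simp add: val inner_add_left linear_add[OF \<pi>(1)] S1 \<pi>(2))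
      show "F (c *\<^sub>R a) y = c *\<^sub>R F a y" for c a
        by (rule eqI) (simp add: val linear_scale[OF \<pi>(1)] S2 \<pi>(2))
    qed
  qed
  have "t \<in> L"
  proof (rule LI)
    have "ap t x = F x" for x using t by auto
    then show "ap t x \<in> G" for x using F(1) by simp
    show "ap t x y = - ap t y x" for x y
      unfolding t by (rule eqI) (use S3[OF \<pi>(2) \<pi>(2) \<pi>(2), of x y] in \<open>simp add: val\<close>)
  qed
  then have "t = 0" by (rule L0)
  then have "F x y = 0" for x y using t[of x y] by simp
  then show "\<forall>x\<in>W. \<forall>y\<in>W. \<forall>z\<in>W. S x y z = 0"
    using val \<pi>(3) by (metis inner_zero_left)
qed

end

section \<open>The adjoint factor carried by the support\<close>

context minimal_tensor
begin

definition ad :: "('a \<Rightarrow> 'a) set" where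
  "ad = br ` s"

lemma br_ad: "br x \<in> ad"
proof -
  obtain y z where "x = y + z" "y \<in> s" "z \<in> K" by (rule s_K_decomposition)
  then have "br x = br y" by (auto simp: Ls_K(1)[OF T_Ls])
  then show ?thesis using \<open>y \<in> s\<close> by (simp add: ad_def)
qed

lemma endo_subspace_ad: "endo_subspace ad"
proof -
  have "(\<lambda>_. 0) = br 0" "\<And>x y. (\<lambda>z. br x z + br y z) = br (x + y)" "\<And>c x. (\<lambda>z. c *\<^sub>R br x z) = br (c *\<^sub>R x)"
    by auto
  then show ?thesis unfolding endo_subspace_def ad_def using subspace_s
    by (auto simp: subspace_0 subspace_add subspace_scale intro!: image_eqI)
qed

lemma lie_closed_ad: "lie_closed ad"
  unfolding lie_closed_def using endo_subspace_ad
  by (auto simp: ad_def lie_br_ap[OF T_Ls] br_s)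

lemma supported_ad: "supported s ad"
proof -
  have "br x z = 0" if z: "\<forall>u\<in>s. z \<bullet> u = 0" for x z
  proof -
    obtain a k where a: "z = a + k" "a \<in> s" "k \<in> K" by (rule s_K_decomposition)
    have "k \<bullet> a = 0" using a by (auto simp: s_def inner_commute)
    moreover have "z \<bullet> a = 0" using z a(2) by blast
    ultimately have "a = 0" using a(1) by (simp add: inner_add_left)
    then show ?thesis using a Ls_K(2)[OF T_Ls] by simp
  qed
  then show ?thesis by (auto simp: supported_def ad_def br_s)
qed

text \<open>\<open>br\<close> identifies \<open>s\<close> with \<open>ad\<close>, so ideals of
  \<open>ad\<close> pull back to ideals of \<open>s\<close>, to which \<open>ideal_eq_s\<close>
  applies.\<close>

lemma simple_ad: "simple_lie ad"
  unfolding simple_lie_def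
proof (intro conjI allI impI)
  obtain x y where xy: "br x y \<noteq> 0" by (rule br_values_nonzero)
  obtain z where "br (br x y) z \<noteq> 0" using br_nonzero[OF br_s xy] by blast
  then have "lie_br (br x) (br y) \<noteq> (\<lambda>_. 0)" by (auto simp: lie_br_ap[OF T_Ls] fun_eq_iff)
  then show "\<exists>A\<in>ad. \<exists>B\<in>ad. lie_br A B \<noteq> (\<lambda>_. 0)" using br_ad by blast
  fix I assume I: "lie_ideal I ad"
  then have Iad: "I \<subseteq> ad" and I0: "(\<lambda>_. 0) \<in> I" and Iadd: "\<And>A B. A \<in> I \<Longrightarrow> B \<in> I \<Longrightarrow> (\<lambda>x. A x + B x) \<in> I"
    and Iscale: "\<And>c A. A \<in> I \<Longrightarrow> (\<lambda>x. c *\<^sub>R A x) \<in> I" and Ibr: "\<And>A B. A \<in> ad \<Longrightarrow> B \<in> I \<Longrightarrow> lie_br A B \<in> I"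
    unfolding lie_ideal_def endo_subspace_def by blast+
  define W where "W = {x \<in> s. br x \<in> I}"
  have W: "subspace W"
  proof (rule subspaceI)
    have "br 0 = (\<lambda>_. 0)" by auto
    then show "0 \<in> W" using I0 subspace_s by (simp add: W_def subspace_0)
    show "x + y \<in> W" if "x \<in> W" "y \<in> W" for x y
    proof -
      have "br (x + y) = (\<lambda>z. br x z + br y z)" by auto
      then show ?thesis using that Iadd subspace_s by (simp add: W_def subspace_add)
    qed
    show "c *\<^sub>R x \<in> W" if "x \<in> W" for c x
    proof -
      have "br (c *\<^sub>R x) = (\<lambda>z. c *\<^sub>R br x z)" by auto
      then show ?thesis using that Iscale subspace_s by (simp add: W_def subspace_scale)
    qed
  qed
  have IW: "I = br ` W" using Iad by (auto simp: W_def ad_def)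
  show "I = {\<lambda>_. 0} \<or> I = ad"
  proof (cases "W = {0}")
    case True
    then show ?thesis using IW by (auto simp: fun_eq_iff)
  next
    case False
    then obtain w where w: "w \<in> W" "w \<noteq> 0" using subspace_0[OF W] by blast
    have "W = s"
    proof (rule ideal_eq_s[OF W _ w])
      show "br x v \<in> W" if "v \<in> W" for x v
        using that Ibr[OF br_ad, of "br v" x] by (simp add: W_def br_s lie_br_ap[OF T_Ls])
    qed (auto simp: W_def)
    then show ?thesis using IW by (simp add: ad_def)
  qed
qed

text \<open>The intertwiner is the inverse of \<open>br\<close> on \<open>s\<close>; the
  intertwining property is the Jacobi identity.\<close>

lemma type_adjoint_ad: "type_adjoint ad s"
proof -
  define \<phi> where "\<phi> = inv_into s br"
  have inj: "inj_on br s" using br_inject by (auto simp: inj_on_def)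
  have \<phi>: "\<phi> (br x) = x" if "x \<in> s" for x
    unfolding \<phi>_def by (rule inv_into_f_f[OF inj that])
  have "bij_betw \<phi> ad s" unfolding \<phi>_def ad_def by (rule bij_betw_inv_into) (simp add: bij_betw_def inj)
  moreover have "\<forall>A\<in>ad. \<forall>B\<in>ad. \<phi> (\<lambda>x. A x + B x) = \<phi> A + \<phi> B"
  proof (intro ballI)
    fix A B assume "A \<in> ad" "B \<in> ad"
    then obtain x y where xy: "x \<in> s" "y \<in> s" "A = br x" "B = br y" by (auto simp: ad_def)
    have "(\<lambda>z. A z + B z) = br (x + y)" using xy by auto
    then show "\<phi> (\<lambda>x. A x + B x) = \<phi> A + \<phi> B" using xy \<phi> subspace_s by (simp add: subspace_add)
  qed
  moreover have "\<forall>c. \<forall>A\<in>ad. \<phi> (\<lambda>x. c *\<^sub>R A x) = c *\<^sub>R \<phi> A"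
  proof (intro ballI allI)
    fix c A assume "A \<in> ad"
    then obtain x where x: "x \<in> s" "A = br x" by (auto simp: ad_def)
    have "(\<lambda>z. c *\<^sub>R A z) = br (c *\<^sub>R x)" using x by auto
    then show "\<phi> (\<lambda>x. c *\<^sub>R A x) = c *\<^sub>R \<phi> A" using x \<phi> subspace_s by (simp add: subspace_scale)
  qed
  moreover have "\<forall>A\<in>ad. \<forall>B\<in>ad. \<phi> (lie_br A B) = A (\<phi> B)"
    by (auto simp: ad_def \<phi> lie_br_ap[OF T_Ls] br_s)
  ultimately show ?thesis unfolding type_adjoint_def using simple_ad by blast
qed

lemma s_subset:
  assumes "subspace W" "supported W G"
  shows "s \<subseteq> W"
proof -
  have "{br x y |x y. True} \<subseteq> W" using assms(2) br_G by (auto simp: supported_def)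
  then show ?thesis unfolding span_br[symmetric] using assms(1) by (rule span_minimal)
qed

end

section \<open>Extracting one factor and the induction\<close>

context lie_so
begin

text \<open>The case split ranges over all minimal tensors, since \<open>restriction_inner\<close>
  needs rank two for each of them. The last conclusion, that \<open>G\<close> acts on
  \<open>U\<close> through \<open>g0\<close>, is what permits subtraction in the induction.\<close>

lemma ex_factor:
  assumes W: "subspace W" "supported W G" and t: "t \<in> L" "t \<noteq> 0"
  obtains U g0 where "subspace U" "U \<subseteq> W" "U \<noteq> {0}" "g0 \<subseteq> G" "lie_closed g0" "supported U g0"
    "good_type g0 U" "\<And>A. A \<in> G \<Longrightarrow> \<exists>B\<in>g0. \<forall>x\<in>U. A x = B x"
proof (cases "\<forall>T. minimal_tensor G T \<longrightarrow> minimal_tensor.rank_two T")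
  case True
  have "t \<in> L \<and> t \<noteq> 0" using t by simp
  from ex_max_dim[of "\<lambda>t. t \<in> L \<and> t \<noteq> 0", OF this, of ker]
  obtain T where T: "T \<in> L" "T \<noteq> 0" "\<And>t. t \<in> L \<Longrightarrow> t \<noteq> 0 \<Longrightarrow> dim (ker t) \<le> dim (ker T)" by blast
  interpret minimal_tensor G T using T by unfold_locales
  show ?thesis
  proof (rule that[of s ad])
    show "s \<noteq> {0}" using s_nonzero by blast
    show "ad \<subseteq> G" using br_G by (auto simp: ad_def)
    show "good_type ad s" using type_adjoint_ad by (simp add: good_type_def)
    show "\<exists>B\<in>ad. \<forall>x\<in>s. A x = B x" if A: "A \<in> G" for A
    proof -
      obtain y where "\<And>x. x \<in> s \<Longrightarrow> A x = br y x"
        using restriction_inner[OF _ A] True by blast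
      then show ?thesis using br_ad by blast
    qed
  qed (use subspace_s s_subset[OF W] lie_closed_ad supported_ad in auto)
next
  case False
  then obtain T where T: "minimal_tensor G T" "\<not> minimal_tensor.rank_two T" by blast
  interpret minimal_tensor G T by (rule T(1))
  obtain u0 where u0: "u0 \<in> s" "u0 \<noteq> 0" "\<And>x. x \<in> s \<Longrightarrow> br u0 x = 0 \<Longrightarrow> \<exists>c. x = c *\<^sub>R u0"
    using T(2) unfolding rank_two_def by blast
  define u where "u = (1 / norm u0) *\<^sub>R u0"
  have u: "u \<in> s" "norm u = 1" using u0 subspace_s by (simp_all add: u_def subspace_scale)
  have c: "\<exists>c. x = c *\<^sub>R u" if "x \<in> s" "br u x = 0" for x
  proof -
    have "br u0 x = 0" using that(2) u0(2) by (simp add: u_def)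
    from u0(3)[OF that(1) this] obtain c where "x = c *\<^sub>R u0" by blast
    then have "x = (c * norm u0) *\<^sub>R u" using u0(2) by (simp add: u_def)
    then show ?thesis by blast
  qed
  have r1: "3 \<le> dim s" "\<And>x y. x \<in> s \<Longrightarrow> y \<in> s \<Longrightarrow> rot x y \<in> G"
    using rank_one[OF u] c by blast+
  obtain U where U: "subspace U" "3 \<le> dim U" "\<And>x y. x \<in> U \<Longrightarrow> y \<in> U \<Longrightarrow> rot x y \<in> G"
    "\<And>A x. A \<in> G \<Longrightarrow> x \<in> U \<Longrightarrow> A x \<in> U"
    using invariant_so_block[OF subspace_s r1] by metis
  show ?thesis
  proof (rule that[of U "so_block U"])
    show "U \<noteq> {0}" using U(2) by auto
    show "U \<subseteq> W"
    proof
      fix x assume x: "x \<in> U"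
      have "card {x} < dim U" using U(2) by simp
      then obtain y where y: "y \<in> U" "norm y = 1" "\<And>z. z \<in> {x} \<Longrightarrow> z \<bullet> y = 0"
        using ex_orthogonal_unit_vector[OF U(1), of "{x}"] x by blast
      \<comment> \<open>Every element of \<open>U\<close> is, up to sign, a value of an element of
        \<open>G\<close>, and those values lie in \<open>W\<close>.\<close>
      have "rot x y y = - x" using y by (simp add: rot_def dot_square_norm)
      moreover have "rot x y y \<in> W" using W(2) U(3)[OF x y(1)] by (auto simp: supported_def)
      ultimately show "x \<in> W" using subspace_neg[OF W(1), of "- x"] by simp
    qed
    show "so_block U \<subseteq> G" by (rule so_block_subset[OF U(1,3)])
    show "good_type (so_block U) U" using type_full_so_block[OF U(1)] by (simp add: good_type_def)
    show "\<exists>B\<in>so_block U. \<forall>x\<in>U. A x = B x" if A: "A \<in> G" for A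
    proof -
      have "so_on U A"
        using U(4)[OF A] G_skew[OF A] by (auto simp: so_on_def linear_add[OF G_linear[OF A]] linear_scale[OF G_linear[OF A]])
      then obtain B where "B \<in> so_block U" "\<forall>w\<in>U. B w = A w"
        using type_full_so_block[OF U(1)] unfolding type_full_so_def by blast
      then show ?thesis by (intro bexI[of _ B]) auto
    qed
  qed (use U(1) lie_closed_so_block supported_so_block in auto)
qed

end

text \<open>Subtracting from \<open>A\<close> the element of \<open>g0\<close> with the same
  restriction to \<open>U\<close> leaves a map that kills \<open>U\<close>. So \<open>G\<close> is
  the sum of \<open>g0\<close> and the annihilator of \<open>U\<close>, which is supported on the
  complement of \<open>U\<close> in \<open>W\<close>, of smaller dimension.\<close>

lemma splits_lie_algebra:
  fixes W :: "'a::euclidean_space set"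
  assumes "lie_subalgebra_so G" "subspace W" "supported W G"
  shows "splits W G"
  using assms
proof (induction "dim W" arbitrary: W G rule: less_induct)
  case less
  interpret lie_so G by unfold_locales (rule less.prems)
  have closed: "lie_closed G" using less.prems(1) by (simp add: lie_subalgebra_so_def lie_closed_def)
  show ?case
  proof (cases "\<exists>t\<in>L. t \<noteq> 0")
    case False
    then have "skew_prolong_zero G W" using no_tensor_skew_prolong_zero less.prems by blast
    then show ?thesis using splits_single[of W G] less.prems closed by (simp add: good_type_def)
  next
    case True
    then obtain t where t: "t \<in> L" "t \<noteq> 0" by blast
    obtain U g0 where U: "subspace U" "U \<subseteq> W" "U \<noteq> {0}" and g0: "g0 \<subseteq> G" "lie_closed g0" "supported U g0"
      "good_type g0 U" and dec: "\<And>A. A \<in> G \<Longrightarrow> \<exists>B\<in>g0. \<forall>x\<in>U. A x = B x"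
      using ex_factor[OF less.prems(2,3) t] by metis
    define W' where "W' = {x \<in> W. \<forall>u\<in>U. x \<bullet> u = 0}"
    define G' where "G' = {A \<in> G. \<forall>x\<in>U. A x = 0}"
    have W': "subspace W'" using less.prems(2) by (auto simp: W'_def subspace_def inner_add_left)
    have W_dec: "\<exists>a\<in>U. \<exists>b\<in>W'. v = a + b" if v: "v \<in> W" for v
    proof -
      obtain a b where ab: "v = a + b" "a \<in> U" "\<And>w. w \<in> U \<Longrightarrow> b \<bullet> w = 0"
        using orthogonal_decomposition[OF U(1)] by metis
      have "b = v - a" using ab(1) by simp
      then have "b \<in> W" using v ab(2) U(2) less.prems(2) by (auto simp: subspace_diff)
      then show ?thesis using ab by (auto simp: W'_def)
    qed
    have "dim W' < dim W"
    proof (rule ccontr)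
      assume "\<not> dim W' < dim W"
      then have "W' = W" using subspace_dim_equal[OF W' less.prems(2)] by (auto simp: W'_def)
      then have "u \<bullet> u = 0" if "u \<in> U" for u using that U(2) unfolding W'_def by blast
      then show False using U(3) subspace_0[OF U(1)] by auto
    qed
    moreover have "lie_subalgebra_so G'"
      unfolding lie_subalgebra_so_def endo_subspace_def
      using G_zero G_add G_scale G_br G_so
      by (auto simp: G'_def lie_br_def linear_0[OF G_linear])
    moreover have "supported W' G'"
    proof (rule supportedI[OF _ W'])
      show "so_V A" if "A \<in> G'" for A using that G_so by (simp add: G'_def)
      fix A x assume A: "A \<in> G'" and x: "\<And>w. w \<in> W' \<Longrightarrow> x \<bullet> w = 0"
      have AG: "A \<in> G" using A by (simp add: G'_def)
      obtain c d where cd: "x = c + d" "c \<in> W" "\<And>w. w \<in> W \<Longrightarrow> d \<bullet> w = 0"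
        using orthogonal_decomposition[OF less.prems(2)] by metis
      obtain a b where ab: "a \<in> U" "b \<in> W'" "c = a + b" using W_dec[OF cd(2)] by blast
      have bW: "b \<in> W" "\<And>u. u \<in> U \<Longrightarrow> b \<bullet> u = 0" using ab(2) by (auto simp: W'_def)
      have "x \<bullet> b = b \<bullet> b"
        using bW(2)[OF ab(1)] cd(3)[OF bW(1)] by (simp add: cd(1) ab(3) inner_add_left inner_commute[of a])
      then have "b = 0" using x[OF ab(2)] by simp
      moreover have "A a = 0" using A ab(1) by (simp add: G'_def)
      moreover have "A d = 0" using less.prems(3) AG cd(3) by (auto simp: supported_def)
      ultimately show "A x = 0" by (simp add: cd(1) ab(3) linear_add[OF G_linear[OF AG]])
    qed
    ultimately have "splits W' G'" using less.hyps W' by blast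
    then show ?thesis
    proof (rule splits_insert[OF _ _ U(1,2) _ W_dec g0])
      show "W' \<subseteq> W" "G' \<subseteq> G" by (auto simp: W'_def G'_def)
      show "x \<bullet> u = 0" if "x \<in> W'" "u \<in> U" for x u using that by (simp add: W'_def)
      show "\<exists>B\<in>g0. \<exists>C\<in>G'. A = (\<lambda>x. B x + C x)" if A: "A \<in> G" for A
      proof -
        obtain B where B: "B \<in> g0" "\<forall>x\<in>U. A x = B x" using dec[OF A] by blast
        then have "(\<lambda>x. A x - B x) \<in> G'" using G_diff[OF A, of B] g0(1) by (auto simp: G'_def)
        then show ?thesis using B(1) by (intro bexI[of _ B] bexI[of _ "\<lambda>x. A x - B x"]) auto
      qed
    qed
  qed
qed

theorem theorem3p2:
  fixes G :: "('a::euclidean_space \<Rightarrow> 'a) set"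
  assumes "lie_subalgebra_so G"
  shows "\<exists>(n::nat) (W :: nat \<Rightarrow> 'a set) (g :: nat \<Rightarrow> ('a \<Rightarrow> 'a) set).
     \<comment> \<open>orthogonal decomposition V = \<Oplus>_j W_j\<close>
     (\<forall>j<n. subspace (W j))
   \<and> (\<forall>i<n. \<forall>j<n. i \<noteq> j \<longrightarrow> (\<forall>x\<in>W i. \<forall>y\<in>W j. x \<bullet> y = 0))
   \<and> (\<forall>v. \<exists>w. (\<forall>j<n. w j \<in> W j) \<and> v = (\<Sum>j<n. w j))
     \<comment> \<open>orthogonal decomposition G = \<Oplus>_j g_j as Lie algebras\<close>
   \<and> (\<forall>j<n. g j \<subseteq> G \<and> endo_subspace (g j) \<and> (\<forall>A\<in>g j. \<forall>B\<in>g j. lie_br A B \<in> g j))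
   \<and> (\<forall>i<n. \<forall>j<n. i \<noteq> j \<longrightarrow> (\<forall>A\<in>g i. \<forall>B\<in>g j. lie_br A B = (\<lambda>_. 0) \<and> frob A B = 0))
   \<and> (\<forall>A\<in>G. \<exists>As. (\<forall>j<n. As j \<in> g j) \<and> A = (\<lambda>x. \<Sum>j<n. As j x))
   \<and> (\<forall>As. (\<forall>j<n. As j \<in> g j) \<and> (\<lambda>x. \<Sum>j<n. As j x) = (\<lambda>_. 0) \<longrightarrow> (\<forall>j<n. As j = (\<lambda>_. 0)))
     \<comment> \<open>g_j preserves W_j, acts faithfully on W_j and trivially on W_i, i \<noteq> j\<close>
   \<and> (\<forall>j<n. \<forall>A\<in>g j. \<forall>w\<in>W j. A w \<in> W j)
   \<and> (\<forall>j<n. \<forall>A\<in>g j. (\<forall>w\<in>W j. A w = 0) \<longrightarrow> A = (\<lambda>_. 0))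
   \<and> (\<forall>i<n. \<forall>j<n. i \<noteq> j \<longrightarrow> (\<forall>A\<in>g j. \<forall>w\<in>W i. A w = 0))
     \<comment> \<open>each (g_j, W_j) is of type (i), (ii) or (iii)\<close>
   \<and> (\<forall>j<n. type_full_so (g j) (W j) \<or> type_adjoint (g j) (W j) \<or> skew_prolong_zero (g j) (W j))"
proof -
  interpret lie_so G by unfold_locales (rule assms)
  have "supported UNIV G"
  proof (rule supportedI)
    fix A and x :: 'a assume "A \<in> G" "\<And>w. w \<in> UNIV \<Longrightarrow> x \<bullet> w = 0"
    then show "A x = 0" using linear_0[OF G_linear, of A] inner_eq_zero_iff[of x] by auto
  qed (simp_all add: G_so)
  then have "splits UNIV G" by (intro splits_lie_algebra assms) auto
  then obtain n :: nat and W g where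
    W: "\<forall>j<n. subspace (W j) \<and> W j \<subseteq> UNIV"
      "\<forall>i<n. \<forall>j<n. i \<noteq> j \<longrightarrow> (\<forall>x\<in>W i. \<forall>y\<in>W j. x \<bullet> y = 0)"
      "\<forall>v\<in>UNIV. \<exists>w. (\<forall>j<n. w j \<in> W j) \<and> v = (\<Sum>j<n. w j)"
    and g: "\<forall>j<n. g j \<subseteq> G \<and> lie_closed (g j) \<and> supported (W j) (g j) \<and> good_type (g j) (W j)"
      "\<forall>A\<in>G. \<exists>As. (\<forall>j<n. As j \<in> g j) \<and> A = (\<lambda>x. \<Sum>j<n. As j x)"
    unfolding splits_def by blast
  have lin: "linear A" if "A \<in> g j" "j < n" for A j using that g(1) G_linear by blast
  have val: "A x \<in> W j" if "A \<in> g j" "j < n" for A j x using that g(1) unfolding supported_def by blast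
  have triv: "A x = 0" if "A \<in> g j" "j < n" "i < n" "i \<noteq> j" "x \<in> W i" for A i j x
  proof -
    have "\<forall>u\<in>W j. x \<bullet> u = 0" using W(2) that by blast
    then show ?thesis using that g(1) unfolding supported_def by blast
  qed
  have faith: "A = (\<lambda>_. 0)" if A: "A \<in> g j" "j < n" and 0: "\<forall>w\<in>W j. A w = 0" for A j
  proof
    fix x
    have "subspace (W j)" using W(1) A(2) by blast
    then obtain y z where yz: "x = y + z" "y \<in> W j" "\<And>w. w \<in> W j \<Longrightarrow> z \<bullet> w = 0"
      using orthogonal_decomposition by metis
    have "A z = 0" using A g(1) yz(3) unfolding supported_def by blast
    then show "A x = 0" using 0 yz by (simp add: linear_add[OF lin[OF A]])
  qed
  \<comment> \<open>The values of either map lie in a subspace on which the other vanishes, and the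
    two images are orthogonal.\<close>
  have cross: "lie_br A B = (\<lambda>_. 0) \<and> frob A B = 0"
    if "i < n" "j < n" "i \<noteq> j" "A \<in> g i" "B \<in> g j" for i j A B
  proof
    have "A (B x) = 0" "B (A x) = 0" for x
      using triv[OF that(4,1,2) _ val[OF that(5,2)], of x] triv[OF that(5,2,1) _ val[OF that(4,1)], of x] that(3)
      by auto
    then show "lie_br A B = (\<lambda>_. 0)" by (simp add: lie_br_def)
    have "A x \<bullet> B x = 0" for x
      using W(2) val[OF that(4,1), of x] val[OF that(5,2), of x] that(1-3) by blast
    then show "frob A B = 0" by (simp add: frob_def)
  qed
  have unique: "As j = (\<lambda>_. 0)"
    if As: "\<forall>j<n. As j \<in> g j" "(\<lambda>x. \<Sum>j<n. As j x) = (\<lambda>_. 0)" and j: "j < n" for As j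
  proof (rule faith[OF _ j])
    show "As j \<in> g j" using As(1) j by blast
    show "\<forall>w\<in>W j. As j w = 0"
    proof
      fix w assume w: "w \<in> W j"
      have "(\<Sum>i<n. As i w) = (\<Sum>i<n. if i = j then As j w else 0)"
        using triv[OF _ _ j _ w] As(1) by (intro sum.cong refl) auto
      then show "As j w = 0" using fun_cong[OF As(2), of w] j by simp
    qed
  qed
  show ?thesis
  proof (rule exI[of _ n], rule exI[of _ W], rule exI[of _ g], intro conjI)
    show "\<forall>v. \<exists>w. (\<forall>j<n. w j \<in> W j) \<and> v = (\<Sum>j<n. w j)" using W(3) by blast
    show "\<forall>j<n. g j \<subseteq> G \<and> endo_subspace (g j) \<and> (\<forall>A\<in>g j. \<forall>B\<in>g j. lie_br A B \<in> g j)"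
      using g(1) unfolding lie_closed_def by blast
    show "\<forall>i<n. \<forall>j<n. i \<noteq> j \<longrightarrow> (\<forall>A\<in>g i. \<forall>B\<in>g j. lie_br A B = (\<lambda>_. 0) \<and> frob A B = 0)"
      using cross by blast
    show "\<forall>As. (\<forall>j<n. As j \<in> g j) \<and> (\<lambda>x. \<Sum>j<n. As j x) = (\<lambda>_. 0) \<longrightarrow> (\<forall>j<n. As j = (\<lambda>_. 0))"
      using unique by blast
    show "\<forall>j<n. \<forall>A\<in>g j. \<forall>w\<in>W j. A w \<in> W j" using val by blast
    show "\<forall>j<n. \<forall>A\<in>g j. (\<forall>w\<in>W j. A w = 0) \<longrightarrow> A = (\<lambda>_. 0)" using faith by blast
    show "\<forall>i<n. \<forall>j<n. i \<noteq> j \<longrightarrow> (\<forall>A\<in>g j. \<forall>w\<in>W i. A w = 0)" using triv by blast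
    show "\<forall>j<n. type_full_so (g j) (W j) \<or> type_adjoint (g j) (W j) \<or> skew_prolong_zero (g j) (W j)"
      using g(1) unfolding good_type_def by blast
  qed (use W g in auto)
qed

end
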